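(* Let $p$ be a prime and $k\ge1$ a natural number. The following four steps are well defined and lead from the bilinear 4-cocycle $Q$ in characteristic zero to a bipolynomial heptagon 5-cocycle of degrees $p^k$ in both permitted colorings, over the field $\mathbb F_p(\beta)$: (1) raise each $Q_{\Delta^4}(\nu,\eta)$ to the power $p^k$; (2) take the coboundary of the resulting cochain; (3) divide by $p$; (4) reduce modulo $p$. Explicitly: (a) For a 5-simplex $i_0\dots i_5$ and generic 3-cocycles $\omega,\nu,\eta$ on it over $\mathbb Q$, the element $\frac1p\sum_{s=0}^5(-1)^s\bigl(Q_{i_0\dots\widehat{i_s}\dots i_5}(\nu,\eta)\bigr)^{p^k}$ of $\mathbb Q(\beta)[\beta_\nu,\beta_\eta]$ has nonnegative valuation, so that its reduction modulo $p$, denoted $\mathfrak c_{i_0\dots i_5}(\nu,\eta)\in\mathbb F_p(\beta)[\beta_\nu,\beta_\eta]$, is defined. (b) $\mathfrak c_{i_0\dots i_5}(\nu,\eta)$ is polynomial of degree $p^k$ in $\beta_\nu$ and of degree $p^k$ in $\beta_\eta$, and depends only on the pair of permitted colorings of $i_0\dots i_5$ determined by $\nu$ and $\eta$, i.e., only on $\nu$ and $\eta$ modulo multiples of $\omega$. (c) $\mathfrak c$ is a heptagon 5-cocycle: for a 6-simplex $i_0\dots i_6$ with the generic 3-cocycle $\omega$ over $\mathbb F_p$ and any pair $(r_1,r_2)$ of permitted colorings of it, $\sum_{s=0}^6(-1)^s\,\mathfrak c_{i_0\dots\widehat{i_s}\dots i_6}(r_1,r_2)=0$, where the colorings are restricted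 to the 5-faces.
   Context: Conventions. $i_0\dots i_n$ denotes the $n$-simplex with vertices $i_0<\dots<i_n$; the simplicial coboundary is $(\delta\mu)_{i_0\dots i_{n+1}}=\sum_s(-1)^s\mu_{i_0\dots\widehat{i_s}\dots i_{n+1}}$. Colorings. Given a 3-cocycle $\omega$ with all components nonzero in a field, the set of colors of a 4-simplex $\Delta^4$ is the space of 3-cocycles on $\Delta^4$ modulo multiples of $\omega|_{\Delta^4}$; a permitted coloring of a 5-simplex is an assignment of colors to its 4-faces induced by a single 3-cocycle $\nu$ on the 5-simplex; a permitted coloring of a 6-simplex is an assignment of colors to all its 4-faces whose restriction to each 5-face is permitted. The 4-cocycle $Q$. For 3-cocycles $\nu,\eta$ on a 4-simplex put $\mu_{ijkl}=\nu_{ijkl}\eta_{ijkl}/\omega_{ijkl}$ and $Q_{\Delta^4}(\nu,\eta)=(\delta\mu)(\Delta^4)$. It depends only on $\nu,\eta$ modulo $\omega$, and its alternating sum over the 4-faces of any 5-simplex vanishes. Generic cocycles. On a given simplex, "generic" 3-cocycles $\omega,\nu,\eta$ are those whose linearly independent components are indeterminates: $\beta,\beta_\nu,\beta_\eta$ denote maximal sets of linearly independent components of $\omega,\nu,\eta$ respectively (for instance, those on tetrahedra containing the first vertex), taken as independent indeterminates over $\mathbb Q$ (or, after reduction, over $\mathbb F_p$), the other components being determined by the cocycle condition. Valuation and reduction. On the polynomial ring $\mathbb Q(\beta)[\beta_\nu,\beta_\eta]$ the discrete valuation is $p^l\,\frac{P(\beta,\beta_\nu,\beta_\eta)}{R(\beta)}\mapsto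 l$, where $P,R$ are polynomials with integer coefficients, each having at least one coefficient not divisible by $p$ (the zero element has valuation $+\infty$). An element of valuation $l\ge0$ is reduced modulo $p$ as follows: the result is $0$ if $l>0$, and is $P/R$ with all coefficients reduced modulo $p$ if $l=0$; this lies in $\mathbb F_p(\beta)[\beta_\nu,\beta_\eta]$. "Bipolynomial" means that values depend polynomially on each of the two colorings $r_1,r_2$. *)

theory Defs
  imports
    Complex_Main
    "HOL-Library.Poly_Mapping"
    "HOL-Library.Nat_Bijection"
    "HOL-Computational_Algebra.Fraction_Field"
    "Berlekamp_Zassenhaus.Finite_Field"
begin

text \<open>
  A simplex is the finite set of its vertices, natural numbers in their usual order; an
  \<open>n\<close>-simplex has \<open>n + 1\<close> vertices. A cochain is a function on vertex sets, of which
  only the values on simplices of the relevant dimension matter.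
\<close>

definition faces :: "nat \<Rightarrow> nat set \<Rightarrow> nat set set" where
  "faces d V = {F. F \<subseteq> V \<and> card F = d + 1}"

text \<open>The exponent is the position \<open>s\<close> of \<open>v = i\<^sub>s\<close> in the increasing
  enumeration \<open>i\<^sub>0 < i\<^sub>1 < \<dots>\<close> of \<open>D\<close>.\<close>

definition coboundary :: "(nat set \<Rightarrow> 'a::comm_ring_1) \<Rightarrow> nat set \<Rightarrow> 'a" where
  "coboundary \<mu> D = (\<Sum>v\<in>D. (-1) ^ card {u\<in>D. u < v} * \<mu> (D - {v}))"

definition cocycle3 :: "nat set \<Rightarrow> (nat set \<Rightarrow> 'a::comm_ring_1) \<Rightarrow> bool" where
  "cocycle3 V \<nu> \<longleftrightarrow> (\<forall>D\<in>faces 4 V. coboundary \<nu> D = 0)"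

definition cocycle3_in :: "'a::comm_ring_1 set \<Rightarrow> nat set \<Rightarrow> (nat set \<Rightarrow> 'a) \<Rightarrow> bool" where
  "cocycle3_in K V \<nu> \<longleftrightarrow> cocycle3 V \<nu> \<and> (\<forall>F\<in>faces 3 V. \<nu> F \<in> K)"

text \<open>Linear independence of components, as linear functionals on the space of 3-cocycles of
  \<open>V\<close> over the field \<open>'k\<close>.\<close>

definition indep_components :: "'k::field itself \<Rightarrow> nat set \<Rightarrow> nat set set \<Rightarrow> bool" where
  "indep_components _ V B \<longleftrightarrow> B \<subseteq> faces 3 V \<and>
     (\<forall>a :: nat set \<Rightarrow> 'k.
        (\<forall>\<nu>. cocycle3 V \<nu> \<longrightarrow> (\<Sum>F\<in>B. a F * \<nu> F) = 0) \<longrightarrow> (\<forall>F\<in>B. a F = 0))"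

definition max_indep_components :: "'k::field itself \<Rightarrow> nat set \<Rightarrow> nat set set \<Rightarrow> bool" where
  "max_indep_components T V B \<longleftrightarrow> indep_components T V B \<and>
     (\<forall>B'. indep_components T V B' \<and> B \<subseteq> B' \<longrightarrow> B' = B)"

text \<open>
  The indeterminate of \<open>\<beta>\<close> belonging to a tetrahedron \<open>F\<close> has index
  \<open>set_encode F\<close>; the linearly ordered index type makes the polynomial ring an instance of
  \<open>idom\<close>, so that its fraction field can be formed. There is one ambient field for all
  simplices; \<open>ratfuns B\<close> below is its subfield of rational functions in the
  indeterminates of \<open>B\<close>.
\<close>

type_synonym 'a bpoly = "(nat \<Rightarrow>\<^sub>0 nat) \<Rightarrow>\<^sub>0 'a"
type_synonym 'a ratfun = "'a bpoly fract"

text \<open>The indeterminates of \<open>\<beta>\<^sub>\<nu>\<close> and \<open>\<beta>\<^sub>\<eta>\<close>.\<close>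

datatype cvar = Nu "nat set" | Eta "nat set"

type_synonym 'c cpoly = "(cvar \<Rightarrow>\<^sub>0 nat) \<Rightarrow>\<^sub>0 'c"

definition pvar :: "'v \<Rightarrow> ('v \<Rightarrow>\<^sub>0 nat) \<Rightarrow>\<^sub>0 'a::comm_ring_1" where
  "pvar v = Poly_Mapping.single (Poly_Mapping.single v 1) 1"

definition pconst :: "'a \<Rightarrow> ('v \<Rightarrow>\<^sub>0 nat) \<Rightarrow>\<^sub>0 'a::comm_ring_1" where
  "pconst a = Poly_Mapping.single 0 a"

definition vars_in :: "'v set \<Rightarrow> (('v \<Rightarrow>\<^sub>0 nat) \<Rightarrow>\<^sub>0 'a::zero) \<Rightarrow> bool" where
  "vars_in S f \<longleftrightarrow> (\<forall>m\<in>Poly_Mapping.keys f. Poly_Mapping.keys m \<subseteq> S)"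

text \<open>Image of \<open>f\<close> under the homomorphism given by \<open>h\<close> on coefficients and
  by \<open>x\<close> on indeterminates.\<close>

definition peval :: "('a::zero \<Rightarrow> 'b::comm_ring_1) \<Rightarrow> ('v \<Rightarrow> 'b) \<Rightarrow> (('v \<Rightarrow>\<^sub>0 nat) \<Rightarrow>\<^sub>0 'a) \<Rightarrow> 'b" where
  "peval h x f = (\<Sum>m\<in>Poly_Mapping.keys f. h (Poly_Mapping.lookup f m) * (\<Prod>v\<in>Poly_Mapping.keys m. x v ^ Poly_Mapping.lookup m v))"

definition degree_in :: "'v set \<Rightarrow> (('v \<Rightarrow>\<^sub>0 nat) \<Rightarrow>\<^sub>0 'a::zero) \<Rightarrow> nat" where
  "degree_in S f = Max (insert 0 ((\<lambda>m. \<Sum>v\<in>Poly_Mapping.keys m \<inter> S. Poly_Mapping.lookup m v) ` Poly_Mapping.keys f))"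

definition ratvar :: "nat set \<Rightarrow> 'a::field ratfun" where
  "ratvar F = Fract (pvar (set_encode F)) 1"

definition ratconst :: "'a::field \<Rightarrow> 'a ratfun" where
  "ratconst a = Fract (pconst a) 1"

definition ratfuns :: "nat set set \<Rightarrow> 'a::field ratfun set" where
  "ratfuns B = {Fract f g | f g. g \<noteq> 0 \<and> vars_in (set_encode ` B) f \<and> vars_in (set_encode ` B) g}"

text \<open>The value of a rational function under the substitution of \<open>\<omega> F\<close> for the
  indeterminate of \<open>F\<close>. It is defined as soon as some fraction representing
  \<open>q\<close> has a denominator with nonzero value, and then independent of that
  fraction.\<close>

definition ratval :: "(nat set \<Rightarrow> 'a::field ratfun) \<Rightarrow> 'a ratfun \<Rightarrow> 'a ratfun" where
  "ratval \<omega> q = (let ev = peval ratconst (\<lambda>n. \<omega> (set_decode n)) in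
     THE z. \<exists>f g. q = Fract f g \<and> ev g \<noteq> 0 \<and> z = ev f / ev g)"

definition cpolys :: "nat set set \<Rightarrow> nat set set \<Rightarrow> nat set set \<Rightarrow> 'a::field ratfun cpoly set" where
  "cpolys B B\<^sub>\<nu> B\<^sub>\<eta> =
     {x. vars_in (Nu ` B\<^sub>\<nu> \<union> Eta ` B\<^sub>\<eta>) x \<and> (\<forall>m. Poly_Mapping.lookup x m \<in> ratfuns B)}"

text \<open>
  \<open>pfrac p B B\<^sub>\<nu> B\<^sub>\<eta> l P R x\<close> says \<open>x = p\<^sup>l P / R\<close> with
  \<open>P\<close>, \<open>R\<close> as in the definition of the valuation. The ring
  \<open>\<int>[\<beta>, \<beta>\<^sub>\<nu>, \<beta>\<^sub>\<eta>]\<close> is represented as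
  \<open>\<int>[\<beta>][\<beta>\<^sub>\<nu>, \<beta>\<^sub>\<eta>]\<close>.
\<close>

definition pfrac :: "nat \<Rightarrow> nat set set \<Rightarrow> nat set set \<Rightarrow> nat set set \<Rightarrow>
    int \<Rightarrow> int bpoly cpoly \<Rightarrow> int bpoly \<Rightarrow> rat ratfun cpoly \<Rightarrow> bool" where
  "pfrac p B B\<^sub>\<nu> B\<^sub>\<eta> l P R x \<longleftrightarrow>
     vars_in (Nu ` B\<^sub>\<nu> \<union> Eta ` B\<^sub>\<eta>) P \<and> (\<forall>m. vars_in (set_encode ` B) (Poly_Mapping.lookup P m)) \<and>
     vars_in (set_encode ` B) R \<and>
     (\<exists>m n. \<not> int p dvd Poly_Mapping.lookup (Poly_Mapping.lookup P m) n) \<and>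
     (\<exists>n. \<not> int p dvd Poly_Mapping.lookup R n) \<and>
     (\<forall>m. Poly_Mapping.lookup x m = of_nat p powi l *
        Fract (Poly_Mapping.map of_int (Poly_Mapping.lookup P m)) (Poly_Mapping.map of_int R))"

definition has_valuation :: "nat \<Rightarrow> nat set set \<Rightarrow> nat set set \<Rightarrow> nat set set \<Rightarrow>
    rat ratfun cpoly \<Rightarrow> int \<Rightarrow> bool" where
  "has_valuation p B B\<^sub>\<nu> B\<^sub>\<eta> x l \<longleftrightarrow> (\<exists>P R. pfrac p B B\<^sub>\<nu> B\<^sub>\<eta> l P R x)"

text \<open>The zero element has valuation \<open>+\<infinity>\<close>.\<close>

definition nonneg_valuation :: "nat \<Rightarrow> nat set set \<Rightarrow> nat set set \<Rightarrow> nat set set \<Rightarrow>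
    rat ratfun cpoly \<Rightarrow> bool" where
  "nonneg_valuation p B B\<^sub>\<nu> B\<^sub>\<eta> x \<longleftrightarrow> x = 0 \<or> (\<exists>l\<ge>0. has_valuation p B B\<^sub>\<nu> B\<^sub>\<eta> x l)"

definition reduces_to :: "nat set set \<Rightarrow> nat set set \<Rightarrow> nat set set \<Rightarrow>
    rat ratfun cpoly \<Rightarrow> 'p::prime_card mod_ring ratfun cpoly \<Rightarrow> bool" where
  "reduces_to B B\<^sub>\<nu> B\<^sub>\<eta> x y \<longleftrightarrow>
     (x = 0 \<or> (\<exists>l>0. has_valuation CARD('p) B B\<^sub>\<nu> B\<^sub>\<eta> x l)) \<and> y = 0 \<or>
     (\<exists>P R. pfrac CARD('p) B B\<^sub>\<nu> B\<^sub>\<eta> 0 P R x \<and>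
        (\<forall>m. Poly_Mapping.lookup y m =
           Fract (Poly_Mapping.map of_int (Poly_Mapping.lookup P m)) (Poly_Mapping.map of_int R)))"

text \<open>
  \<open>K\<close> is the field of definition, a subfield of \<open>'a\<close>. A color of a 4-simplex
  \<open>D\<close> is a coset modulo \<open>\<omega>\<close>; its elements are normalised to be
  \<open>0\<close> outside the tetrahedra of \<open>D\<close>, so that equal colors are equal sets.
\<close>

definition color :: "'a::field set \<Rightarrow> (nat set \<Rightarrow> 'a) \<Rightarrow> nat set \<Rightarrow> (nat set \<Rightarrow> 'a) \<Rightarrow> (nat set \<Rightarrow> 'a) set" where
  "color K \<omega> D \<nu> = {\<lambda>F. if F \<in> faces 3 D then \<nu> F + t * \<omega> F else 0 | t. t \<in> K}"

definition colors :: "'a::field set \<Rightarrow> (nat set \<Rightarrow> 'a) \<Rightarrow> nat set \<Rightarrow> (nat set \<Rightarrow> 'a) set set" where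
  "colors K \<omega> D = {color K \<omega> D \<nu> | \<nu>. cocycle3_in K D \<nu>}"

definition induces :: "'a::field set \<Rightarrow> (nat set \<Rightarrow> 'a) \<Rightarrow> nat set \<Rightarrow> (nat set \<Rightarrow> 'a) \<Rightarrow>
    (nat set \<Rightarrow> (nat set \<Rightarrow> 'a) set) \<Rightarrow> bool" where
  "induces K \<omega> V \<nu> r \<longleftrightarrow> cocycle3_in K V \<nu> \<and> (\<forall>D\<in>faces 4 V. r D = color K \<omega> D \<nu>)"

definition permitted5 :: "'a::field set \<Rightarrow> (nat set \<Rightarrow> 'a) \<Rightarrow> nat set \<Rightarrow>
    (nat set \<Rightarrow> (nat set \<Rightarrow> 'a) set) \<Rightarrow> bool" where
  "permitted5 K \<omega> V r \<longleftrightarrow> (\<exists>\<nu>. induces K \<omega> V \<nu> r)"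

definition permitted6 :: "'a::field set \<Rightarrow> (nat set \<Rightarrow> 'a) \<Rightarrow> nat set \<Rightarrow>
    (nat set \<Rightarrow> (nat set \<Rightarrow> 'a) set) \<Rightarrow> bool" where
  "permitted6 K \<omega> W r \<longleftrightarrow>
     (\<forall>D\<in>faces 4 W. r D \<in> colors K \<omega> D) \<and> (\<forall>V\<in>faces 5 W. permitted5 K \<omega> V r)"

definition generic_omega :: "nat set \<Rightarrow> nat set set \<Rightarrow> (nat set \<Rightarrow> 'k::field ratfun) \<Rightarrow> bool" where
  "generic_omega V B \<omega> \<longleftrightarrow> cocycle3 V \<omega> \<and> (\<forall>F\<in>B. \<omega> F = ratvar F)"

definition generic_triple :: "nat set \<Rightarrow> nat set set \<Rightarrow> nat set set \<Rightarrow> nat set set \<Rightarrow>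
    (nat set \<Rightarrow> 'k::field ratfun) \<Rightarrow> (nat set \<Rightarrow> 'k ratfun cpoly) \<Rightarrow> (nat set \<Rightarrow> 'k ratfun cpoly) \<Rightarrow> bool" where
  "generic_triple V B B\<^sub>\<nu> B\<^sub>\<eta> \<omega> \<nu> \<eta> \<longleftrightarrow>
     max_indep_components TYPE('k) V B \<and> max_indep_components TYPE('k) V B\<^sub>\<nu> \<and>
     max_indep_components TYPE('k) V B\<^sub>\<eta> \<and>
     generic_omega V B \<omega> \<and>
     cocycle3 V \<nu> \<and> (\<forall>F\<in>B\<^sub>\<nu>. \<nu> F = pvar (Nu F)) \<and>
     cocycle3 V \<eta> \<and> (\<forall>F\<in>B\<^sub>\<eta>. \<eta> F = pvar (Eta F))"

definition Qval :: "(nat set \<Rightarrow> 'c::field) \<Rightarrow> (nat set \<Rightarrow> 'c cpoly) \<Rightarrow> (nat set \<Rightarrow> 'c cpoly) \<Rightarrow>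
    nat set \<Rightarrow> 'c cpoly" where
  "Qval \<omega> \<nu> \<eta> D = coboundary (\<lambda>F. pconst (1 / \<omega> F) * \<nu> F * \<eta> F) D"

definition lifted :: "nat \<Rightarrow> nat \<Rightarrow> (nat set \<Rightarrow> 'c::field) \<Rightarrow> (nat set \<Rightarrow> 'c cpoly) \<Rightarrow>
    (nat set \<Rightarrow> 'c cpoly) \<Rightarrow> nat set \<Rightarrow> 'c cpoly" where
  "lifted p k \<omega> \<nu> \<eta> V = pconst (1 / of_nat p) * coboundary (\<lambda>D. Qval \<omega> \<nu> \<eta> D ^ (p ^ k)) V"

text \<open>\<open>c\<close> is the polynomial \<open>\<cc>\<close> of the 5-simplex \<open>V\<close>, written in the
  indeterminates \<open>B\<close>, \<open>B\<^sub>\<nu>\<close>, \<open>B\<^sub>\<eta>\<close>.\<close>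

definition reduced_cochain :: "nat \<Rightarrow> nat set \<Rightarrow> nat set set \<Rightarrow> nat set set \<Rightarrow> nat set set \<Rightarrow>
    'p::prime_card mod_ring ratfun cpoly \<Rightarrow> bool" where
  "reduced_cochain k V B B\<^sub>\<nu> B\<^sub>\<eta> c \<longleftrightarrow> (\<exists>\<omega> \<nu> \<eta>.
     generic_triple V B B\<^sub>\<nu> B\<^sub>\<eta> \<omega> \<nu> \<eta> \<and>
     reduces_to B B\<^sub>\<nu> B\<^sub>\<eta> (lifted CARD('p) k \<omega> \<nu> \<eta> V) c)"

text \<open>The value of \<open>c\<close> at given cocycles \<open>\<omega>\<close>, \<open>\<nu>\<close>,
  \<open>\<eta>\<close>: their components are substituted for the indeterminates.\<close>

definition cval :: "(nat set \<Rightarrow> 'a::field ratfun) \<Rightarrow> 'a ratfun cpoly \<Rightarrow>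
    (nat set \<Rightarrow> 'a ratfun) \<Rightarrow> (nat set \<Rightarrow> 'a ratfun) \<Rightarrow> 'a ratfun" where
  "cval \<omega> c \<nu> \<eta> = peval (ratval \<omega>) (\<lambda>v. case v of Nu F \<Rightarrow> \<nu> F | Eta F \<Rightarrow> \<eta> F) c"

end

(*
For 4-cochains x on a 5-simplex V, the expression delta(x^q)(V) - (delta x (V))^q with q = p^k is
p times an integral polynomial in the values of x, the Frobenius defect.  Since Q is a coboundary,
the characteristic zero element in (a) is exactly the defect of Q.  The components of a 3-cocycle
are integral linear combinations, not all zero modulo p, of a maximal independent set of
components, so Q reduces modulo p, and the reduced cochain is the defect of Q formed over F_p.
The defect of a coboundary is closed: p times it is a coboundary over the integers, and the general
case is a specialisation.  This gives the heptagon relation.  The degrees follow from homogeneity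
and from nonvanishing, for which a suitable choice of cocycles exhibits the coefficient
C(p^k, p^(k-1)) / p, not divisible by p.
*)
theory Submission
  imports Defs
begin

section \<open>Compatible relations and partial homomorphisms\<close>

text \<open>Neither reduction modulo p nor substitution into rational functions is a total ring
  homomorphism: each is defined only where denominators survive. Both are therefore treated as
  relations closed under the ring operations (\<open>ring_rel\<close>), so that whatever is built by
  ring operations from related data is again related. This is why the defect has to be an explicit
  integral expression: over F_p the division by p has no meaning, but the expression does. The
  obstacle to reducing Q is that the sets of independent components are arbitrary, so that solving
  for the other components might introduce denominators divisible by p. It does not: the tetrahedra
  of a 5-simplex, read through their two missing vertices, are the edges of the complete graph on
  six vertices, a relation between components is a potential difference, and the potential can be
  replaced by the indicator of one of its level sets. The coefficients are then 0, 1 and -1. In (c)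
  the permitted colorings of the 6-simplex are given only face by face, without a common cocycle;
  what is glued is the values of Q, not the cocycles.\<close>

definition ring_rel :: "('a::comm_ring_1 \<Rightarrow> 'b::comm_ring_1 \<Rightarrow> bool) \<Rightarrow> bool" where
  "ring_rel S \<longleftrightarrow> S 0 0 \<and> S 1 1 \<and> (\<forall>a b. S a b \<longrightarrow> S (- a) (- b)) \<and>
     (\<forall>a b c d. S a b \<longrightarrow> S c d \<longrightarrow> S (a + c) (b + d) \<and> S (a * c) (b * d))"

lemma ring_rel_zero: "ring_rel S \<Longrightarrow> S 0 0"
  and ring_rel_one: "ring_rel S \<Longrightarrow> S 1 1"
  and ring_rel_uminus: "ring_rel S \<Longrightarrow> S a b \<Longrightarrow> S (- a) (- b)"
  and ring_rel_add: "ring_rel S \<Longrightarrow> S a b \<Longrightarrow> S c d \<Longrightarrow> S (a + c) (b + d)"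
  and ring_rel_mult: "ring_rel S \<Longrightarrow> S a b \<Longrightarrow> S c d \<Longrightarrow> S (a * c) (b * d)"
  unfolding ring_rel_def by blast+

lemma ring_rel_power: "ring_rel S \<Longrightarrow> S a b \<Longrightarrow> S (a ^ n) (b ^ n)"
  by (induction n) (auto intro: ring_rel_one ring_rel_mult)

lemma ring_rel_sum: "ring_rel S \<Longrightarrow> (\<And>x. x \<in> A \<Longrightarrow> S (f x) (g x)) \<Longrightarrow> S (sum f A) (sum g A)"
  by (induction A rule: infinite_finite_induct) (auto intro: ring_rel_zero ring_rel_add)

lemma ring_rel_of_nat: "ring_rel S \<Longrightarrow> S (of_nat n) (of_nat n)"
  by (induction n) (auto intro: ring_rel_zero ring_rel_one ring_rel_add)

lemma ring_rel_of_int: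
  assumes "ring_rel S"
  shows "S (of_int n) (of_int n)"
proof (cases n)
  case (nonneg m)
  then show ?thesis using ring_rel_of_nat[OF assms] by simp
next
  case (neg m)
  then show ?thesis
    using ring_rel_uminus[OF assms ring_rel_of_nat[OF assms, of "Suc m"]] by simp
qed

lemma ring_rel_coboundary:
  assumes S: "ring_rel S" and "\<And>v. v \<in> D \<Longrightarrow> S (x (D - {v})) (y (D - {v}))"
  shows "S (coboundary x D) (coboundary y D)"
  unfolding coboundary_def
  by (intro ring_rel_sum[OF S] ring_rel_mult[OF S] ring_rel_power[OF S] ring_rel_uminus[OF S]
      ring_rel_one[OF S] assms(2))

text \<open>The graph of h over D is a subring of the product: D is a subring and h a homomorphism
  on it, while the values of h outside D are unconstrained.\<close>

definition ring_map_on :: "'a::comm_ring_1 set \<Rightarrow> ('a \<Rightarrow> 'b::comm_ring_1) \<Rightarrow> bool" where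
  "ring_map_on D h \<longleftrightarrow> ring_rel (\<lambda>a b. a \<in> D \<and> b = h a)"

lemma ring_map_onI:
  assumes "0 \<in> D" "1 \<in> D" "h 1 = 1" "\<And>a. a \<in> D \<Longrightarrow> - a \<in> D"
    and "\<And>a b. a \<in> D \<Longrightarrow> b \<in> D \<Longrightarrow> a + b \<in> D" "\<And>a b. a \<in> D \<Longrightarrow> b \<in> D \<Longrightarrow> a * b \<in> D"
    and add: "\<And>a b. a \<in> D \<Longrightarrow> b \<in> D \<Longrightarrow> h (a + b) = h a + h b"
    and "\<And>a b. a \<in> D \<Longrightarrow> b \<in> D \<Longrightarrow> h (a * b) = h a * h b"
  shows "ring_map_on D h"
proof -
  have h0: "h 0 = 0" using add[of 0 0] assms(1) by simp
  have "- h a = h (- a)" if "a \<in> D" for a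
    using add[OF that assms(4)[OF that]] h0 by (intro minus_unique) simp
  then show ?thesis using assms h0 by (auto simp: ring_map_on_def ring_rel_def)
qed

lemma ring_map_on_zero: "ring_map_on D h \<Longrightarrow> 0 \<in> D \<and> h 0 = 0"
  and ring_map_on_one: "ring_map_on D h \<Longrightarrow> 1 \<in> D \<and> h 1 = 1"
  and ring_map_on_uminus: "ring_map_on D h \<Longrightarrow> a \<in> D \<Longrightarrow> - a \<in> D \<and> h (- a) = - h a"
  and ring_map_on_add: "ring_map_on D h \<Longrightarrow> a \<in> D \<Longrightarrow> b \<in> D \<Longrightarrow> a + b \<in> D \<and> h (a + b) = h a + h b"
  and ring_map_on_mult: "ring_map_on D h \<Longrightarrow> a \<in> D \<Longrightarrow> b \<in> D \<Longrightarrow> a * b \<in> D \<and> h (a * b) = h a * h b"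
  unfolding ring_map_on_def ring_rel_def by metis+

lemma ring_map_zero: "ring_map_on UNIV h \<Longrightarrow> h 0 = 0"
  and ring_map_one: "ring_map_on UNIV h \<Longrightarrow> h 1 = 1"
  and ring_map_uminus: "ring_map_on UNIV h \<Longrightarrow> h (- a) = - h a"
  and ring_map_add: "ring_map_on UNIV h \<Longrightarrow> h (a + b) = h a + h b"
  and ring_map_mult: "ring_map_on UNIV h \<Longrightarrow> h (a * b) = h a * h b"
  unfolding ring_map_on_def ring_rel_def by simp_all

lemma ring_map_on_comp:
  assumes "ring_map_on UNIV f" "ring_map_on UNIV g"
  shows "ring_map_on UNIV (\<lambda>a. g (f a))"
  using assms by (auto simp: ring_map_on_def ring_rel_def)

lemma ring_map_on_of_int: "ring_map_on UNIV (of_int :: int \<Rightarrow> 'a::comm_ring_1)"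
  by (rule ring_map_onI) auto

lemma ring_map_on_pconst: "ring_map_on UNIV (pconst :: 'a::comm_ring_1 \<Rightarrow> ('v \<Rightarrow>\<^sub>0 nat) \<Rightarrow>\<^sub>0 'a)"
  by (rule ring_map_onI) (auto simp: pconst_def single_add mult_single)

lemma pconst_zero [simp]: "pconst 0 = 0"
  and pconst_one [simp]: "pconst 1 = 1"
  by (simp_all add: pconst_def)

lemma pconst_add: "pconst (a + b) = pconst a + pconst b"
  and pconst_mult: "pconst (a * b) = pconst a * pconst b"
  by (simp_all add: pconst_def single_add mult_single)

lemma pconst_of_int [simp]: "pconst (of_int n) = of_int n"
  by (simp add: pconst_def)

lemma pconst_of_nat [simp]: "pconst (of_nat n) = of_nat n"
  by (simp add: pconst_def)

lemma lookup_pconst_mult: "Poly_Mapping.lookup (pconst c * x) m = c * Poly_Mapping.lookup x m"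
proof -
  have "pconst c * x = Poly_Mapping.map ((*) c) x"
    by (simp add: mult_map_scale_conv_mult pconst_def)
  then show ?thesis by (simp add: map.rep_eq when_def)
qed

lemma sum_singles:
  "x = (\<Sum>m\<in>Poly_Mapping.keys x. Poly_Mapping.single m (Poly_Mapping.lookup x m))"
  for x :: "'m \<Rightarrow>\<^sub>0 'a::comm_monoid_add"
proof (rule poly_mapping_eqI)
  fix k
  have "(\<Sum>m\<in>Poly_Mapping.keys x. Poly_Mapping.lookup (Poly_Mapping.single m (Poly_Mapping.lookup x m)) k)
      = (\<Sum>m\<in>Poly_Mapping.keys x. if m = k then Poly_Mapping.lookup x k else 0)"
    by (rule sum.cong) (auto simp: lookup_single)
  also have "\<dots> = Poly_Mapping.lookup x k" by (simp add: in_keys_iff)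
  finally show "Poly_Mapping.lookup x k
      = Poly_Mapping.lookup (\<Sum>m\<in>Poly_Mapping.keys x. Poly_Mapping.single m (Poly_Mapping.lookup x m)) k"
    by (simp add: lookup_sum)
qed

section \<open>Evaluation of polynomials\<close>

definition monomial_value :: "('v \<Rightarrow> 'b::comm_ring_1) \<Rightarrow> ('v \<Rightarrow>\<^sub>0 nat) \<Rightarrow> 'b" where
  "monomial_value x m = (\<Prod>v\<in>Poly_Mapping.keys m. x v ^ Poly_Mapping.lookup m v)"

lemma monomial_value_superset:
  assumes "finite A" "Poly_Mapping.keys m \<subseteq> A"
  shows "monomial_value x m = (\<Prod>v\<in>A. x v ^ Poly_Mapping.lookup m v)"
  unfolding monomial_value_def
  by (rule prod.mono_neutral_left) (use assms in \<open>auto simp: in_keys_iff\<close>)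

lemma monomial_value_add: "monomial_value x (m + n) = monomial_value x m * monomial_value x n"
proof -
  let ?A = "Poly_Mapping.keys m \<union> Poly_Mapping.keys n"
  have "monomial_value x k = (\<Prod>v\<in>?A. x v ^ Poly_Mapping.lookup k v)" if "k \<in> {m, n, m + n}" for k
    by (rule monomial_value_superset) (use that keys_add[of m n] in auto)
  then show ?thesis by (simp add: lookup_add power_add prod.distrib)
qed

lemma monomial_value_zero [simp]: "monomial_value x 0 = 1"
  by (simp add: monomial_value_def)

text \<open>Sums can cancel monomials; a common finite superset of the supports allows termwise
  comparison.\<close>

lemma peval_superset:
  assumes "finite A" "Poly_Mapping.keys f \<subseteq> A" "h 0 = 0"
  shows "peval h x f = (\<Sum>m\<in>A. h (Poly_Mapping.lookup f m) * monomial_value x m)"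
  unfolding peval_def monomial_value_def[symmetric]
  by (rule sum.mono_neutral_left) (use assms in \<open>auto simp: in_keys_iff\<close>)

lemma peval_single:
  "h 0 = 0 \<Longrightarrow> peval h x (Poly_Mapping.single m a) = h a * monomial_value x m"
  by (subst peval_superset[of "{m}"]) auto

lemma peval_pconst: "h 0 = 0 \<Longrightarrow> peval h x (pconst a) = h a"
  by (simp add: pconst_def peval_single)

lemma peval_pvar: "h 0 = 0 \<Longrightarrow> h 1 = 1 \<Longrightarrow> peval h x (pvar v) = x v"
  by (simp add: pvar_def peval_single monomial_value_def)

lemma peval_zero [simp]: "peval h x 0 = 0"
  by (simp add: peval_def)

text \<open>Stated for a partial coefficient map because \<open>ratval\<close> will be one.\<close>

lemma peval_ring_map_on:
  fixes h :: "'a::comm_ring_1 \<Rightarrow> 'b::comm_ring_1" and x :: "'v \<Rightarrow> 'b"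
  assumes h: "ring_map_on D h"
  shows "ring_map_on {f. \<forall>m. Poly_Mapping.lookup f m \<in> D} (peval h x)"
proof -
  let ?E = "{f :: ('v \<Rightarrow>\<^sub>0 nat) \<Rightarrow>\<^sub>0 'a. \<forall>m. Poly_Mapping.lookup f m \<in> D}"
  have zero: "0 \<in> D" "h 0 = 0" using ring_map_on_zero[OF h] by auto
  \<comment> \<open>Membership in the domain travels with the value, since h is known to be additive
    and multiplicative only inside D.\<close>
  have add: "f + g \<in> ?E \<and> peval h x (f + g) = peval h x f + peval h x g"
    if "f \<in> ?E" "g \<in> ?E" for f g
  proof
    show "f + g \<in> ?E" using that ring_map_on_add[OF h] by (auto simp: lookup_add)
    let ?A = "Poly_Mapping.keys f \<union> Poly_Mapping.keys g"
    have "peval h x k = (\<Sum>m\<in>?A. h (Poly_Mapping.lookup k m) * monomial_value x m)"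
      if "k \<in> {f, g, f + g}" for k
      by (rule peval_superset) (use that keys_add[of f g] zero in auto)
    then show "peval h x (f + g) = peval h x f + peval h x g"
      using that ring_map_on_add[OF h]
      by (simp add: lookup_add ring_distribs sum.distrib)
  qed
  have sum: "sum F A \<in> ?E \<and> peval h x (sum F A) = (\<Sum>a\<in>A. peval h x (F a))"
    if "\<And>a. a \<in> A \<Longrightarrow> F a \<in> ?E" for F and A :: "'m set"
    using that
  proof (induction A rule: infinite_finite_induct)
    case (insert a A)
    then show ?case using add[of "F a" "sum F A"] by simp
  qed (use zero in simp_all)
  have single: "Poly_Mapping.single m a \<in> ?E" if "a \<in> D" for m a
    using that zero by (auto simp: lookup_single when_def)
  have mult: "f * g \<in> ?E \<and> peval h x (f * g) = peval h x f * peval h x g"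
    if f: "f \<in> ?E" and g: "g \<in> ?E" for f g
  proof -
    let ?s = "\<lambda>m n. Poly_Mapping.single (m + n) (Poly_Mapping.lookup f m * Poly_Mapping.lookup g n)"
    have s: "?s m n \<in> ?E \<and> peval h x (?s m n) = h (Poly_Mapping.lookup f m) * monomial_value x m *
         (h (Poly_Mapping.lookup g n) * monomial_value x n)" for m n
    proof
      have D: "Poly_Mapping.lookup f m * Poly_Mapping.lookup g n \<in> D"
        and hm: "h (Poly_Mapping.lookup f m * Poly_Mapping.lookup g n)
          = h (Poly_Mapping.lookup f m) * h (Poly_Mapping.lookup g n)"
        using f g ring_map_on_mult[OF h] by auto
      show "?s m n \<in> ?E" by (rule single[OF D])
      show "peval h x (?s m n) = h (Poly_Mapping.lookup f m) * monomial_value x m *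
         (h (Poly_Mapping.lookup g n) * monomial_value x n)"
        unfolding peval_single[where h = h, OF zero(2)] hm monomial_value_add
        by (simp only: mult_ac)
    qed
    have fg: "f * g = (\<Sum>m\<in>Poly_Mapping.keys f. \<Sum>n\<in>Poly_Mapping.keys g. ?s m n)"
      unfolding mult_single[symmetric] sum_product[symmetric] sum_singles[symmetric] ..
    have inner: "(\<Sum>n\<in>Poly_Mapping.keys g. ?s m n) \<in> ?E \<and>
        peval h x (\<Sum>n\<in>Poly_Mapping.keys g. ?s m n)
        = (\<Sum>n\<in>Poly_Mapping.keys g. peval h x (?s m n))" for m
      by (rule sum) (use s in blast)
    have outer: "f * g \<in> ?E \<and> peval h x (f * g) =
        (\<Sum>m\<in>Poly_Mapping.keys f. peval h x (\<Sum>n\<in>Poly_Mapping.keys g. ?s m n))"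
      unfolding fg by (rule sum) (use inner in blast)
    have eval: "peval h x k = (\<Sum>m\<in>Poly_Mapping.keys k. h (Poly_Mapping.lookup k m) * monomial_value x m)" for k
      by (rule peval_superset[where h = h]) (use zero in auto)
    have "peval h x (f * g) = peval h x f * peval h x g"
      unfolding outer[THEN conjunct2] inner[THEN conjunct2] s[THEN conjunct2]
      unfolding eval sum_product ..
    then show ?thesis using outer by blast
  qed
  have one: "1 \<in> ?E" "peval h x 1 = 1"
    using single[of 1 0] peval_single[where h = h, OF zero(2), of x 0 1] ring_map_on_one[OF h] by simp_all
  show ?thesis
  proof (rule ring_map_onI)
    show "0 \<in> ?E" using zero by simp
    show "- f \<in> ?E" if "f \<in> ?E" for f
      using that ring_map_on_uminus[OF h] by simp
  qed (use one add mult in blast)+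
qed

lemma peval_ring_map: "ring_map_on UNIV h \<Longrightarrow> ring_map_on UNIV (peval h x)"
  using peval_ring_map_on[of UNIV h x] by simp

lemma lookup_map: "h 0 = 0 \<Longrightarrow> Poly_Mapping.lookup (Poly_Mapping.map h f) m = h (Poly_Mapping.lookup f m)"
  by (simp add: map.rep_eq when_def)

section \<open>Coefficientwise maps and sets of variables\<close>

lemma pvar_power:
  "pvar v ^ n = (Poly_Mapping.single (Poly_Mapping.single v n) 1 :: ('v \<Rightarrow>\<^sub>0 nat) \<Rightarrow>\<^sub>0 'a::comm_ring_1)"
proof (induction n)
  case (Suc n)
  have "pvar v ^ Suc n = (Poly_Mapping.single (Poly_Mapping.single v 1) 1 :: ('v \<Rightarrow>\<^sub>0 nat) \<Rightarrow>\<^sub>0 'a) *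
      Poly_Mapping.single (Poly_Mapping.single v n) 1"
    by (simp only: power_Suc Suc) (simp add: pvar_def)
  also have "\<dots> = Poly_Mapping.single (Poly_Mapping.single v (Suc n)) 1"
    by (simp add: mult_single single_add[symmetric])
  finally show ?case .
qed simp

lemma monomial_value_pvar:
  "monomial_value pvar m = (Poly_Mapping.single m 1 :: ('v \<Rightarrow>\<^sub>0 nat) \<Rightarrow>\<^sub>0 'a::comm_ring_1)"
proof -
  have "(\<Prod>v\<in>A. Poly_Mapping.single (Poly_Mapping.single v (c v)) (1::'a))
      = Poly_Mapping.single (\<Sum>v\<in>A. Poly_Mapping.single v (c v)) 1" if "finite A" for A and c :: "'v \<Rightarrow> nat"
    using that by (induction A) (auto simp: mult_single)
  from this[OF finite_keys[of m], of "Poly_Mapping.lookup m"] show ?thesis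
    unfolding monomial_value_def pvar_power sum_singles[symmetric] .
qed

text \<open>Mapping coefficients is evaluation at the variables themselves, so it inherits
  multiplicativity from \<open>peval_ring_map\<close>.\<close>

lemma map_eq_peval:
  fixes h :: "'a::comm_ring_1 \<Rightarrow> 'b::comm_ring_1"
  assumes "h 0 = 0"
  shows "Poly_Mapping.map h f = peval (\<lambda>a. pconst (h a)) pvar f"
proof -
  have "peval (\<lambda>a. pconst (h a)) pvar f =
      (\<Sum>m\<in>Poly_Mapping.keys f. Poly_Mapping.single m (h (Poly_Mapping.lookup f m)))"
    unfolding peval_def monomial_value_def[symmetric] monomial_value_pvar
    by (simp add: pconst_def mult_single)
  also have "\<dots> = Poly_Mapping.map h (\<Sum>m\<in>Poly_Mapping.keys f. Poly_Mapping.single m (Poly_Mapping.lookup f m))"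
    by (rule poly_mapping_eqI)
      (use assms in \<open>auto simp: lookup_sum lookup_map lookup_single when_def if_distrib[of h] in_keys_iff cong: if_cong\<close>)
  finally show ?thesis by (simp add: sum_singles[symmetric])
qed

lemma map_ring_map:
  fixes h :: "'a::comm_ring_1 \<Rightarrow> 'b::comm_ring_1"
  assumes "ring_map_on UNIV h"
  shows "ring_map_on UNIV (Poly_Mapping.map h :: (('v \<Rightarrow>\<^sub>0 nat) \<Rightarrow>\<^sub>0 'a) \<Rightarrow> _)"
proof -
  have "ring_map_on UNIV (peval (\<lambda>a. pconst (h a)) (pvar :: 'v \<Rightarrow> ('v \<Rightarrow>\<^sub>0 nat) \<Rightarrow>\<^sub>0 'b))"
    by (intro peval_ring_map ring_map_on_comp[OF assms ring_map_on_pconst])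
  moreover have "peval (\<lambda>a. pconst (h a)) (pvar :: 'v \<Rightarrow> ('v \<Rightarrow>\<^sub>0 nat) \<Rightarrow>\<^sub>0 'b) = Poly_Mapping.map h"
    using ring_map_on_zero[OF assms] by (intro ext map_eq_peval[symmetric]) blast
  ultimately show ?thesis by simp
qed

lemma vars_in_zero [simp]: "vars_in S 0"
  and vars_in_one [simp]: "vars_in S 1"
  and vars_in_uminus: "vars_in S f \<Longrightarrow> vars_in S (- f)"
  and vars_in_pconst [simp]: "vars_in S (pconst a)"
  and vars_in_pvar: "v \<in> S \<Longrightarrow> vars_in S (pvar v)"
  by (auto simp: vars_in_def pconst_def pvar_def in_keys_iff)

lemma vars_in_add: "vars_in S f \<Longrightarrow> vars_in S g \<Longrightarrow> vars_in S (f + g)"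
  using keys_add[of f g] by (auto simp: vars_in_def)

lemma vars_in_mult:
  fixes f g :: "('v \<Rightarrow>\<^sub>0 nat) \<Rightarrow>\<^sub>0 'a::comm_ring_1"
  assumes "vars_in S f" "vars_in S g"
  shows "vars_in S (f * g)"
  unfolding vars_in_def
proof
  fix k assume "k \<in> Poly_Mapping.keys (f * g)"
  then obtain m n where "k = m + n" "m \<in> Poly_Mapping.keys f" "n \<in> Poly_Mapping.keys g"
    using keys_mult[of f g] by blast
  then show "Poly_Mapping.keys k \<subseteq> S"
    using assms[unfolded vars_in_def] keys_add[of m n] by blast
qed

lemma vars_in_sum: "(\<And>a. a \<in> A \<Longrightarrow> vars_in S (f a)) \<Longrightarrow> vars_in S (sum f A)"
  by (induction A rule: infinite_finite_induct) (auto intro: vars_in_add)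

lemma vars_in_map: "h 0 = 0 \<Longrightarrow> vars_in S f \<Longrightarrow> vars_in S (Poly_Mapping.map h f)"
  unfolding vars_in_def by (auto simp: in_keys_iff lookup_map)

section \<open>Simplicial coboundary\<close>

definition vsign :: "nat set \<Rightarrow> nat \<Rightarrow> 'a::comm_ring_1" where
  "vsign V v = (- 1) ^ card {u\<in>V. u < v}"

lemma coboundary_vsign: "coboundary x V = (\<Sum>v\<in>V. vsign V v * x (V - {v}))"
  by (simp add: coboundary_def vsign_def)

lemma vsign_square [simp]: "vsign V v * vsign V v = 1"
  by (simp add: vsign_def flip: power_add mult_2)

lemma vsign_cases: "vsign V v = 1 \<or> vsign V v = - 1"
  by (simp add: vsign_def minus_one_power_iff)

text \<open>Deleting v moves every later vertex down by one place.\<close>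

lemma vsign_remove:
  assumes "finite V" "v \<in> V"
  shows "vsign (V - {v}) u = (if v < u then - vsign V u else vsign V u :: 'a::comm_ring_1)"
proof (cases "v < u")
  case True
  then have "{w\<in>V. w < u} = insert v {w\<in>V - {v}. w < u}" using assms by auto
  then have "card {w\<in>V. w < u} = Suc (card {w\<in>V - {v}. w < u})" using assms by simp
  then show ?thesis using True unfolding vsign_def by simp
next
  case False
  then have "{w\<in>V. w < u} = {w\<in>V - {v}. w < u}" by auto
  then show ?thesis using False unfolding vsign_def by simp
qed

lemma coboundary_cong: "(\<And>v. v \<in> V \<Longrightarrow> x (V - {v}) = y (V - {v})) \<Longrightarrow> coboundary x V = coboundary y V"
  unfolding coboundary_def by (rule sum.cong) auto

lemma coboundary_add: "coboundary (\<lambda>F. x F + y F) V = coboundary x V + coboundary y V"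
  by (simp add: coboundary_def distrib_left sum.distrib)

lemma coboundary_mult: "coboundary (\<lambda>F. c * x F) V = c * coboundary x V"
  by (simp add: coboundary_def sum_distrib_left mult_ac)

lemma sum_pairs:
  fixes g :: "nat \<Rightarrow> nat \<Rightarrow> 'a::comm_monoid_add"
  assumes "finite W"
  shows "(\<Sum>v\<in>W. \<Sum>u\<in>W - {v}. g v u) = (\<Sum>v\<in>W. \<Sum>u\<in>{u\<in>W. u < v}. g v u + g u v)"
proof -
  have "(\<Sum>u\<in>W - {v}. g v u) = (\<Sum>u\<in>{u\<in>W. u < v}. g v u) + (\<Sum>u\<in>{u\<in>W. v < u}. g v u)" for v
  proof -
    have "W - {v} = {u\<in>W. u < v} \<union> {u\<in>W. v < u}" by auto
    then show ?thesis using assms by (simp add: sum.union_disjoint disjoint_iff)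
  qed
  moreover have "(\<Sum>v\<in>W. \<Sum>u\<in>{u\<in>W. v < u}. g v u) = (\<Sum>v\<in>W. \<Sum>u\<in>{u\<in>W. u < v}. g u v)"
    using sum.swap_restrict[OF assms assms, of g "\<lambda>v u. v < u"] by simp
  ultimately show ?thesis by (simp add: sum.distrib)
qed

text \<open>A face of codimension two arises from two orders of deletion with opposite signs, which
  leaves the difference of the weights. Constant h gives \<delta>\<delta> = 0; arbitrary h gives the
  cut relations below.\<close>

lemma sum_vsign_coboundary:
  fixes x :: "nat set \<Rightarrow> 'a::comm_ring_1"
  assumes "finite V"
  shows "(\<Sum>v\<in>V. vsign V v * (h v * coboundary x (V - {v})))
    = (\<Sum>v\<in>V. \<Sum>u\<in>{u\<in>V. u < v}. vsign V v * vsign V u * (h v - h u) * x (V - {v} - {u}))"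
proof -
  have "(\<Sum>v\<in>V. vsign V v * (h v * coboundary x (V - {v})))
      = (\<Sum>v\<in>V. \<Sum>u\<in>V - {v}. vsign V v * vsign (V - {v}) u * h v * x (V - {v} - {u}))"
    by (simp add: coboundary_vsign sum_distrib_left mult_ac)
  also have "\<dots> = (\<Sum>v\<in>V. \<Sum>u\<in>{u\<in>V. u < v}. vsign V v * vsign (V - {v}) u * h v * x (V - {v} - {u}) +
       vsign V u * vsign (V - {u}) v * h u * x (V - {u} - {v}))"
    by (rule sum_pairs[OF assms])
  also have "\<dots> = (\<Sum>v\<in>V. \<Sum>u\<in>{u\<in>V. u < v}. vsign V v * vsign V u * (h v - h u) * x (V - {v} - {u}))"
  proof (intro sum.cong refl)
    fix v u assume "v \<in> V" "u \<in> {u\<in>V. u < v}"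
    then have "vsign (V - {v}) u = (vsign V u :: 'a)" "vsign (V - {u}) v = (- vsign V v :: 'a)"
      using assms by (auto simp: vsign_remove)
    moreover have "V - {u} - {v} = V - {v} - {u}" by auto
    ultimately show "vsign V v * vsign (V - {v}) u * h v * x (V - {v} - {u}) +
       vsign V u * vsign (V - {u}) v * h u * x (V - {u} - {v})
      = vsign V v * vsign V u * (h v - h u) * x (V - {v} - {u})"
      by (simp add: algebra_simps)
  qed
  finally show ?thesis .
qed

lemma coboundary_coboundary:
  assumes "finite V"
  shows "coboundary (coboundary x) V = 0"
  using sum_vsign_coboundary[OF assms, of "\<lambda>_. 1" x] by (simp add: coboundary_vsign[of "coboundary x"])

text \<open>Contraction to a vertex a that precedes D. If a lies in D, only the face without a
  contributes and nothing has to be closed; otherwise closedness on the cone over D trades its base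
  for its sides.\<close>

lemma coboundary_cone:
  fixes x :: "nat set \<Rightarrow> 'a::comm_ring_1"
  assumes fin: "finite D" and min: "\<forall>u\<in>D. a \<le> u"
    and zero: "a \<notin> D \<Longrightarrow> coboundary x (insert a D) = 0"
  shows "coboundary (\<lambda>T. if a \<in> T then 0 else x (insert a T)) D = x D"
proof (cases "a \<in> D")
  case True
  have "{u\<in>D. u < a} = {}" using min by force
  then have e: "vsign D a = (1::'a)" unfolding vsign_def by (simp only: card.empty power_0)
  have "coboundary (\<lambda>T. if a \<in> T then 0 else x (insert a T)) D
      = (\<Sum>v\<in>D. if v = a then x D else 0)"
    unfolding coboundary_vsign using True e by (intro sum.cong) (auto simp: insert_absorb)
  then show ?thesis using fin True by simp
next
  case False
  have a: "vsign (insert a D) a = (1::'a)"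
  proof -
    have "{u \<in> insert a D. u < a} = {}" using min by force
    then show ?thesis unfolding vsign_def by (simp only: card.empty power_0)
  qed
  have D: "insert a D - {a} = D" using False by auto
  have "vsign (insert a D) v * x (insert a D - {v}) = - (vsign D v * x (insert a (D - {v})))" if "v \<in> D" for v
  proof -
    have "a < v" using that min False by (metis order_le_less)
    then have "vsign D v = (- vsign (insert a D) v :: 'a)"
      using vsign_remove[of "insert a D" a v] fin D by simp
    moreover have "insert a D - {v} = insert a (D - {v})" using \<open>a < v\<close> by auto
    ultimately show ?thesis by simp
  qed
  then have "coboundary x (insert a D) = x D - (\<Sum>v\<in>D. vsign D v * x (insert a (D - {v})))"
    unfolding coboundary_vsign using fin False by (simp add: a D sum_negf)
  moreover have "coboundary (\<lambda>T. if a \<in> T then 0 else x (insert a T)) D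
      = (\<Sum>v\<in>D. vsign D v * x (insert a (D - {v})))"
    unfolding coboundary_vsign using False by (intro sum.cong) auto
  ultimately show ?thesis using zero[OF False] by simp
qed

section \<open>Indicator cochains\<close>

definition face_indicator :: "nat set \<Rightarrow> nat set \<Rightarrow> 'a::comm_ring_1" where
  "face_indicator T T' = (if T' = T then 1 else 0)"

lemma coboundary_face_indicator_0: "(\<And>v. v \<in> F \<Longrightarrow> F - {v} \<noteq> T) \<Longrightarrow> coboundary (face_indicator T) F = 0"
  by (auto simp: coboundary_def face_indicator_def intro!: sum.neutral)

lemma coboundary_face_indicator:
  assumes "finite F" "w \<in> F"
  shows "coboundary (face_indicator (F - {w})) F = vsign F w"
proof -
  have "coboundary (face_indicator (F - {w})) F = (\<Sum>v\<in>F. if v = w then vsign F w else 0)"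
    unfolding coboundary_vsign using assms by (intro sum.cong) (auto simp: face_indicator_def)
  then show ?thesis using assms by simp
qed

text \<open>Separates the values of y from coboundaries whose entries are 0, 1 or -1, and thus exist
  over every ring.\<close>

lemma coboundary_eq_sum_face_indicator:
  assumes "finite A" "\<And>v. v \<in> F \<Longrightarrow> F - {v} \<in> A"
  shows "coboundary y F = (\<Sum>T\<in>A. y T * coboundary (face_indicator T) F)"
proof -
  have "(\<Sum>T\<in>A. y T * coboundary (face_indicator T) F)
      = (\<Sum>v\<in>F. \<Sum>T\<in>A. vsign F v * (if F - {v} = T then y T else 0))"
    unfolding coboundary_vsign face_indicator_def sum_distrib_left
    by (subst sum.swap) (auto intro!: sum.cong)
  also have "\<dots> = (\<Sum>v\<in>F. vsign F v * y (F - {v}))"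
    using assms by (intro sum.cong refl) (simp add: sum_distrib_left[symmetric])
  finally show ?thesis by (simp add: coboundary_vsign)
qed

section \<open>The Frobenius defect of the coboundary\<close>

text \<open>The quotient of \<open>(a + b) ^ p - a ^ p - b ^ p\<close> by p, with the division
  carried out in the natural numbers, so that it makes sense in characteristic p.\<close>

definition binomial_defect :: "nat \<Rightarrow> 'a \<Rightarrow> 'a \<Rightarrow> 'a::comm_ring_1" where
  "binomial_defect p a b = (\<Sum>i\<in>{1..<p}. of_nat ((p choose i) div p) * a ^ i * b ^ (p - i))"

lemma add_power_prime_eq:
  fixes a b :: "'a::comm_ring_1"
  assumes "prime p"
  shows "(a + b) ^ p = a ^ p + b ^ p + of_nat p * binomial_defect p a b"
proof -
  have p: "p > 0" using assms prime_gt_0_nat by blast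
  have "{..p} = insert 0 (insert p {1..<p})" using p by auto
  then have "(a + b) ^ p = b ^ p + (a ^ p + (\<Sum>i\<in>{1..<p}. of_nat (p choose i) * a ^ i * b ^ (p - i)))"
    using p by (simp add: binomial_ring)
  also have "(\<Sum>i\<in>{1..<p}. of_nat (p choose i) * a ^ i * b ^ (p - i)) = of_nat p * binomial_defect p a b"
    unfolding binomial_defect_def sum_distrib_left
  proof (intro sum.cong refl)
    fix i assume "i \<in> {1..<p}"
    then have "p dvd (p choose i)" using assms by (intro dvd_choose_prime) auto
    then have "(of_nat (p choose i) :: 'a) = of_nat p * of_nat ((p choose i) div p)"
      by (metis dvd_mult_div_cancel of_nat_mult)
    then show "of_nat (p choose i) * a ^ i * b ^ (p - i) = of_nat p * (of_nat ((p choose i) div p) * a ^ i * b ^ (p - i))"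
      by (simp add: mult_ac)
  qed
  finally show ?thesis by (simp add: add_ac)
qed

fun sum_defect :: "nat \<Rightarrow> 'a list \<Rightarrow> 'a::comm_ring_1" where
  "sum_defect p [] = 0"
| "sum_defect p (x # xs) = binomial_defect p x (sum_list xs) + sum_defect p xs"

lemma sum_list_power_prime:
  assumes "prime p"
  shows "sum_list xs ^ p = (\<Sum>x\<leftarrow>xs. x ^ p) + of_nat p * sum_defect p xs"
proof (induction xs)
  case Nil
  then show ?case using assms by (auto simp: power_0_left)
next
  case (Cons x xs)
  then show ?case by (simp add: add_power_prime_eq[OF assms] algebra_simps)
qed

text \<open>With A the sum of the p^k-th powers and E the previous defect, the next power is
  \<open>(A + p E) ^ p\<close>. The three summands are what remains, after division by p, of
  \<open>A ^ p\<close>, of the mixed terms and of \<open>(p E) ^ p\<close>.\<close>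

fun power_defect :: "nat \<Rightarrow> nat \<Rightarrow> 'a list \<Rightarrow> 'a::comm_ring_1" where
  "power_defect p 0 xs = 0"
| "power_defect p (Suc k) xs = sum_defect p (map (\<lambda>x. x ^ (p ^ k)) xs) +
     binomial_defect p (\<Sum>x\<leftarrow>xs. x ^ (p ^ k)) (of_nat p * power_defect p k xs) +
     of_nat p ^ (p - 1) * power_defect p k xs ^ p"

lemma sum_list_power_prime_power:
  fixes xs :: "'a::comm_ring_1 list"
  assumes "prime p"
  shows "sum_list xs ^ (p ^ k) = (\<Sum>x\<leftarrow>xs. x ^ (p ^ k)) + of_nat p * power_defect p k xs"
proof (induction k)
  case (Suc k)
  have p: "(of_nat p :: 'a) ^ p = of_nat p * of_nat p ^ (p - 1)"
    using assms prime_gt_0_nat[of p] by (metis power_eq_if not_less_zero)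
  have "sum_list xs ^ (p ^ Suc k) = ((\<Sum>x\<leftarrow>xs. x ^ (p ^ k)) + of_nat p * power_defect p k xs) ^ p"
    by (simp add: power_mult mult.commute[of p] flip: Suc)
  also have "\<dots> = (\<Sum>x\<leftarrow>xs. x ^ (p ^ k)) ^ p + (of_nat p * power_defect p k xs) ^ p +
      of_nat p * binomial_defect p (\<Sum>x\<leftarrow>xs. x ^ (p ^ k)) (of_nat p * power_defect p k xs)"
    by (rule add_power_prime_eq[OF assms])
  also have "(\<Sum>x\<leftarrow>xs. x ^ (p ^ k)) ^ p = (\<Sum>x\<leftarrow>xs. x ^ (p ^ Suc k)) +
       of_nat p * sum_defect p (map (\<lambda>x. x ^ (p ^ k)) xs)"
    using sum_list_power_prime[OF assms, of "map (\<lambda>x. x ^ (p ^ k)) xs"]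
    by (simp add: o_def mult.commute[of p] flip: power_mult)
  finally show ?case by (simp add: power_mult_distrib p algebra_simps)
qed simp

text \<open>The second sum repairs the signs for p = 2, where (-1)^q is 1 = -1 + 2 instead of -1;
  for odd p it is zero. Both terms are negative because \<open>power_defect\<close> measures the
  power of the sum minus the sum of the powers.\<close>

definition frobenius_defect :: "nat \<Rightarrow> nat \<Rightarrow> (nat set \<Rightarrow> 'a) \<Rightarrow> nat set \<Rightarrow> 'a::comm_ring_1" where
  "frobenius_defect p k x V =
     - power_defect p k (map (\<lambda>v. vsign V v * x (V - {v})) (sorted_list_of_set V))
     - (\<Sum>v\<in>V. (if even p \<and> odd (card {u\<in>V. u < v}) then 1 else 0) * x (V - {v}) ^ (p ^ k))"

lemma of_nat_mult_frobenius_defect: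
  fixes x :: "nat set \<Rightarrow> 'a::comm_ring_1"
  assumes p: "prime p" and k: "k \<ge> 1" and V: "finite V"
  shows "of_nat p * frobenius_defect p k x V = coboundary (\<lambda>D. x D ^ (p ^ k)) V - coboundary x V ^ (p ^ k)"
proof -
  let ?ys = "map (\<lambda>v. vsign V v * x (V - {v})) (sorted_list_of_set V)"
  let ?e = "\<lambda>v. if even p \<and> odd (card {u\<in>V. u < v}) then 1 else 0 :: 'a"
  have sl: "(\<Sum>v\<leftarrow>sorted_list_of_set V. f v) = (\<Sum>v\<in>V. f v)" for f :: "nat \<Rightarrow> 'a"
    using V by (simp add: sum_list_distinct_conv_sum_set)
  have eq: "coboundary x V = sum_list ?ys"
    by (simp add: sl coboundary_vsign)
  have "coboundary x V ^ (p ^ k) = (\<Sum>y\<leftarrow>?ys. y ^ (p ^ k)) + of_nat p * power_defect p k ?ys"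
    unfolding eq by (rule sum_list_power_prime_power[OF p])
  also have "(\<Sum>y\<leftarrow>?ys. y ^ (p ^ k)) = (\<Sum>v\<in>V. (vsign V v * x (V - {v})) ^ (p ^ k))"
    by (simp add: o_def sl)
  also have "\<dots> = (\<Sum>v\<in>V. vsign V v * x (V - {v}) ^ (p ^ k) + of_nat p * (?e v * x (V - {v}) ^ (p ^ k)))"
  proof (intro sum.cong refl)
    fix v
    have "(vsign V v :: 'a) ^ (p ^ k) = vsign V v + of_nat p * ?e v"
    proof (cases "even p")
      case True
      then have "p = 2" using p primes_dvd_imp_eq two_is_prime_nat by blast
      \<comment> \<open>Here \<open>k \<ge> 1\<close> matters: with exponent 1 the sign would not
        become 1.\<close>
      moreover have "even (p ^ k)" using True k by simp
      ultimately show ?thesis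
        by (cases "odd (card {u\<in>V. u < v})") (simp_all add: vsign_def power_mult[symmetric] mult.commute)
    next
      case False
      then have "odd (p ^ k)" by simp
      then show ?thesis using False
        by (cases "odd (card {u\<in>V. u < v})") (simp_all add: vsign_def)
    qed
    then show "(vsign V v * x (V - {v})) ^ (p ^ k) = vsign V v * x (V - {v}) ^ (p ^ k) + of_nat p * (?e v * x (V - {v}) ^ (p ^ k))"
      unfolding power_mult_distrib by (simp only: ring_distribs mult.assoc)
  qed
  also have "\<dots> = coboundary (\<lambda>D. x D ^ (p ^ k)) V + of_nat p * (\<Sum>v\<in>V. ?e v * x (V - {v}) ^ (p ^ k))"
    unfolding coboundary_vsign by (simp only: sum.distrib sum_distrib_left)
  finally have main: "coboundary x V ^ (p ^ k) = coboundary (\<lambda>D. x D ^ (p ^ k)) V +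
      of_nat p * (\<Sum>v\<in>V. ?e v * x (V - {v}) ^ (p ^ k)) + of_nat p * power_defect p k ?ys" .
  show ?thesis unfolding frobenius_defect_def main by (simp only: ring_distribs) simp
qed

lemma frobenius_defect_cong:
  assumes "\<And>v. v \<in> V \<Longrightarrow> x (V - {v}) = y (V - {v})"
  shows "frobenius_defect p k x V = frobenius_defect p k y V"
proof (cases "finite V")
  case True
  then have eq: "map (\<lambda>v. vsign V v * x (V - {v})) (sorted_list_of_set V)
      = map (\<lambda>v. vsign V v * y (V - {v})) (sorted_list_of_set V)"
    using assms by (intro map_cong) auto
  show ?thesis unfolding frobenius_defect_def eq using assms by simp
qed (simp add: frobenius_defect_def)

section \<open>Transfer of the defect along compatible relations\<close>

lemma ring_rel_binomial_defect:
  assumes S: "ring_rel S"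
  shows "S a b \<Longrightarrow> S c d \<Longrightarrow> S (binomial_defect p a c) (binomial_defect p b d)"
  unfolding binomial_defect_def
  by (intro ring_rel_sum[OF S] ring_rel_mult[OF S] ring_rel_power[OF S] ring_rel_of_nat[OF S])

lemma ring_rel_sum_list:
  assumes S: "ring_rel S"
  shows "list_all2 S xs ys \<Longrightarrow> S (sum_list xs) (sum_list ys)"
  by (induction xs ys rule: list_all2_induct) (auto intro!: ring_rel_zero[OF S] ring_rel_add[OF S])

lemma ring_rel_sum_defect:
  assumes S: "ring_rel S"
  shows "list_all2 S xs ys \<Longrightarrow> S (sum_defect p xs) (sum_defect p ys)"
  by (induction xs ys rule: list_all2_induct)
    (auto intro!: ring_rel_zero[OF S] ring_rel_add[OF S] ring_rel_binomial_defect[OF S] ring_rel_sum_list[OF S])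

lemma ring_rel_power_defect:
  assumes S: "ring_rel S" and xs: "list_all2 S xs ys"
  shows "S (power_defect p k xs) (power_defect p k ys)"
proof (induction k)
  case 0
  then show ?case using S by (simp add: ring_rel_zero)
next
  case (Suc k)
  have "list_all2 S (map (\<lambda>x. x ^ (p ^ k)) xs) (map (\<lambda>x. x ^ (p ^ k)) ys)"
    using xs by (simp add: list_all2_conv_all_nth ring_rel_power[OF S])
  then show ?case
    unfolding power_defect.simps
    by (intro ring_rel_add[OF S] ring_rel_mult[OF S] ring_rel_power[OF S] ring_rel_of_nat[OF S]
        ring_rel_binomial_defect[OF S] ring_rel_sum_list[OF S] ring_rel_sum_defect[OF S] Suc)
qed

lemma ring_rel_frobenius_defect:
  assumes S: "ring_rel S" and V: "finite V" and x: "\<And>v. v \<in> V \<Longrightarrow> S (x (V - {v})) (y (V - {v}))"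
  shows "S (frobenius_defect p k x V) (frobenius_defect p k y V)"
proof -
  have sign: "S (vsign V v) (vsign V v)" for v
    unfolding vsign_def by (intro ring_rel_power[OF S] ring_rel_uminus[OF S] ring_rel_one[OF S])
  have "list_all2 S (map (\<lambda>v. vsign V v * x (V - {v})) (sorted_list_of_set V))
     (map (\<lambda>v. vsign V v * y (V - {v})) (sorted_list_of_set V))"
    unfolding list_all2_map1 list_all2_map2
    by (rule list.rel_refl_strong) (use V in \<open>auto intro!: ring_rel_mult[OF S] sign x\<close>)
  from ring_rel_power_defect[OF S this]
  have "S (- power_defect p k (map (\<lambda>v. vsign V v * x (V - {v})) (sorted_list_of_set V))
      + - (\<Sum>v\<in>V. (if even p \<and> odd (card {u\<in>V. u < v}) then 1 else 0) * x (V - {v}) ^ (p ^ k)))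
     (- power_defect p k (map (\<lambda>v. vsign V v * y (V - {v})) (sorted_list_of_set V))
      + - (\<Sum>v\<in>V. (if even p \<and> odd (card {u\<in>V. u < v}) then 1 else 0) * y (V - {v}) ^ (p ^ k)))"
    by (intro ring_rel_add[OF S] ring_rel_uminus[OF S] ring_rel_sum[OF S] ring_rel_mult[OF S]
        ring_rel_power[OF S] x) (auto intro: ring_rel_zero[OF S] ring_rel_one[OF S])
  then show ?thesis unfolding frobenius_defect_def by simp
qed

text \<open>Over the integers, \<open>p\<close> times the defect of a coboundary is itself a coboundary;
  the general case is a specialisation of the universal integral one.\<close>

lemma coboundary_frobenius_defect_coboundary:
  fixes y :: "nat set \<Rightarrow> 'a::comm_ring_1"
  assumes p: "prime p" and k: "k \<ge> 1" and W: "finite W"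
  shows "coboundary (frobenius_defect p k (coboundary y)) W = 0"
proof -
  \<comment> \<open>Independent integral indeterminates: their polynomial ring has no p-torsion, so
    the factor p can be cancelled. The map \<open>e\<close> below then substitutes the actual values
    of y.\<close>
  define y' :: "nat set \<Rightarrow> int bpoly" where "y' T = pvar (set_encode T)" for T
  let ?c' = "coboundary (frobenius_defect p k (coboundary y')) W"
  have p0: "p \<noteq> 0" using p by auto
  have "of_nat p * ?c' = coboundary (\<lambda>V. of_nat p * frobenius_defect p k (coboundary y') V) W"
    by (simp add: coboundary_mult)
  also have "\<dots> = coboundary (coboundary (\<lambda>D. coboundary y' D ^ (p ^ k))) W"
    using W p0 by (intro coboundary_cong) (simp add: of_nat_mult_frobenius_defect[OF p k] coboundary_coboundary power_0_left)
  also have "\<dots> = 0" by (rule coboundary_coboundary[OF W])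
  finally have c': "?c' = 0" using p0 by simp
  define e where "e = peval (of_int :: int \<Rightarrow> 'a) (\<lambda>n. y (set_decode n))"
  define S where "S = (\<lambda>a b. b = e a)"
  have S: "ring_rel S"
    unfolding e_def S_def using peval_ring_map[OF ring_map_on_of_int] by (simp add: ring_map_on_def)
  have y': "S (y' T) (y T)" if "finite T" for T
    using that by (simp add: S_def e_def y'_def peval_pvar)
  have "S ?c' (coboundary (frobenius_defect p k (coboundary y)) W)"
    using W by (intro ring_rel_coboundary[OF S] ring_rel_frobenius_defect[OF S] y') auto
  then have "coboundary (frobenius_defect p k (coboundary y)) W = e ?c'" by (simp add: S_def)
  then show ?thesis using c' by (simp add: e_def)
qed

section \<open>Components of 3-cocycles\<close>

lemma finite_faces: "finite V \<Longrightarrow> finite (faces d V)"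
  by (simp add: faces_def)

lemma faces_finite_face: "F \<in> faces d V \<Longrightarrow> finite F"
  by (auto simp: faces_def intro: card_ge_0_finite)

lemma faces_remove: "D \<in> faces (Suc d) V \<Longrightarrow> v \<in> D \<Longrightarrow> D - {v} \<in> faces d V"
  by (auto simp: faces_def)

lemma faces_mono: "D \<subseteq> V \<Longrightarrow> faces d D \<subseteq> faces d V"
  by (auto simp: faces_def)

lemma cocycle3_mono: "D \<subseteq> V \<Longrightarrow> cocycle3 V \<nu> \<Longrightarrow> cocycle3 D \<nu>"
  using faces_mono[of D V 4] by (auto simp: cocycle3_def)

lemma cocycle3_coboundary: "cocycle3 V (coboundary y)"
  unfolding cocycle3_def using coboundary_coboundary[OF faces_finite_face] by blast

text \<open>A simplex is a cone over its first vertex. The primitive is written out because its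
  values are themselves components of \<omega>.\<close>

lemma cocycle3_eq_coboundary:
  assumes V: "finite V" and \<omega>: "cocycle3 V \<omega>" and F: "F \<in> faces 3 V"
  shows "\<omega> F = coboundary (\<lambda>T. if Min V \<in> T then 0 else \<omega> (insert (Min V) T)) F"
proof (rule coboundary_cone[symmetric])
  show "finite F" using F by (rule faces_finite_face)
  show "\<forall>u\<in>F. Min V \<le> u" using F V by (auto simp: faces_def)
  assume "Min V \<notin> F"
  moreover have "V \<noteq> {}" using F by (auto simp: faces_def)
  ultimately have "insert (Min V) F \<in> faces 4 V"
    using F V finite_subset[of F V] by (auto simp: faces_def)
  then show "coboundary \<omega> (insert (Min V) F) = 0" using \<omega> by (simp add: cocycle3_def)
qed

lemma ring_map_on_face_indicator:
  assumes h: "ring_map_on UNIV h"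
  shows "coboundary (face_indicator T) F = h (coboundary (face_indicator T) F)"
proof -
  define S where "S = (\<lambda>a b. b = h a)"
  have S: "ring_rel S" using h by (simp add: S_def ring_map_on_def)
  have "S (coboundary (face_indicator T) F) (coboundary (face_indicator T) F)"
    by (rule ring_rel_coboundary[OF S])
      (use ring_map_on_zero[OF h] ring_map_on_one[OF h] in \<open>auto simp: S_def face_indicator_def\<close>)
  then show ?thesis by (simp add: S_def)
qed

text \<open>Over any ring, 3-cocycles are spanned by the images of the coboundaries of the indicator
  functions of triangles; these exist over the prime ring.\<close>

lemma cocycle3_relation_lift:
  fixes h :: "'k::comm_ring_1 \<Rightarrow> 'a::comm_ring_1"
  assumes h: "ring_map_on UNIV h" and V: "finite V" and "A \<subseteq> faces 3 V"
    and rel: "\<And>\<nu>. cocycle3 V \<nu> \<Longrightarrow> (\<Sum>F\<in>A. a F * \<nu> F) = 0"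
    and \<omega>: "cocycle3 V \<omega>"
  shows "(\<Sum>F\<in>A. h (a F) * \<omega> F) = 0"
proof -
  let ?y = "\<lambda>T. if Min V \<in> T then 0 else \<omega> (insert (Min V) T)"
  have hom: "h (x * y) = h x * h y" for x y using ring_map_on_mult[OF h] by simp
  have hsum: "h (sum f A) = (\<Sum>F\<in>A. h (f F))" for f
    by (induction A rule: infinite_finite_induct) (use ring_map_on_zero[OF h] ring_map_on_add[OF h] in auto)
  have \<omega>F: "\<omega> F = (\<Sum>T\<in>faces 2 V. ?y T * coboundary (face_indicator T) F)" if "F \<in> A" for F
  proof -
    have F: "F \<in> faces 3 V" using that assms(3) by blast
    have "\<And>v. v \<in> F \<Longrightarrow> F - {v} \<in> faces 2 V"
      using F faces_remove[of F 2] by (simp add: eval_nat_numeral)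
    then show ?thesis
      using cocycle3_eq_coboundary[OF V \<omega> F] coboundary_eq_sum_face_indicator[OF finite_faces[OF V], of F 2 ?y]
      by simp
  qed
  have "(\<Sum>F\<in>A. h (a F) * \<omega> F)
      = (\<Sum>F\<in>A. \<Sum>T\<in>faces 2 V. ?y T * (h (a F) * h (coboundary (face_indicator T) F)))"
    by (intro sum.cong refl)
      (simp add: \<omega>F sum_distrib_left mult_ac ring_map_on_face_indicator[OF h, symmetric])
  also have "\<dots> = (\<Sum>T\<in>faces 2 V. ?y T * h (\<Sum>F\<in>A. a F * coboundary (face_indicator T) F))"
    by (subst sum.swap) (simp add: sum_distrib_left hsum hom)
  also have "\<dots> = 0"
    using rel[OF cocycle3_coboundary] ring_map_on_zero[OF h] by simp
  finally show ?thesis .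
qed

lemma vsign_nonzero: "vsign V v \<noteq> (0::'a::comm_ring_1)"
  by (metis mult_zero_left vsign_square zero_neq_one)

text \<open>The incidence sign with a boundary triangle is a unit in every characteristic; hence no
  component vanishes on all cocycles, not even modulo p.\<close>

lemma cocycle3_nonzero_component:
  assumes "F \<in> faces 3 V"
  obtains T where "coboundary (face_indicator T) F \<noteq> (0::'a::comm_ring_1)"
proof -
  obtain w where w: "w \<in> F" using assms by (fastforce simp: faces_def)
  have "coboundary (face_indicator (F - {w})) F = (vsign F w :: 'a)"
    using assms w faces_finite_face by (intro coboundary_face_indicator) auto
  then show ?thesis using vsign_nonzero[of F w, where ?'a = 'a] that[of "F - {w}"] by auto
qed

text \<open>The coefficient at F cannot be zero, as the relation would then be one within the
  independent set B.\<close>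

lemma max_indep_components_dependent:
  assumes B: "max_indep_components TYPE('k::field) V B" and V: "finite V"
    and F: "F \<in> faces 3 V" "F \<notin> B"
  obtains a :: "nat set \<Rightarrow> 'k::field" where "a F \<noteq> 0"
    "\<And>\<nu>. cocycle3 V \<nu> \<Longrightarrow> (\<Sum>F'\<in>insert F B. a F' * \<nu> F') = 0"
proof -
  have ind: "indep_components TYPE('k) V B" and "\<not> indep_components TYPE('k) V (insert F B)"
    using B F by (auto simp: max_indep_components_def)
  moreover have sub: "B \<subseteq> faces 3 V" using ind by (simp add: indep_components_def)
  ultimately obtain a :: "nat set \<Rightarrow> 'k" where
    a: "\<And>\<nu>. cocycle3 V \<nu> \<Longrightarrow> (\<Sum>F'\<in>insert F B. a F' * \<nu> F') = 0"
    and ne: "\<exists>F'\<in>insert F B. a F' \<noteq> 0"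
    using F by (auto simp: indep_components_def)
  have fin: "finite B" using sub finite_faces[OF V] finite_subset by blast
  have "a F \<noteq> 0"
  proof
    assume "a F = 0"
    then have "\<forall>\<nu>. cocycle3 V \<nu> \<longrightarrow> (\<Sum>F'\<in>B. a F' * \<nu> F') = 0"
      using a fin F(2) by simp
    then have "\<forall>F'\<in>B. a F' = 0" using ind by (simp add: indep_components_def)
    then show False using ne \<open>a F = 0\<close> by auto
  qed
  then show ?thesis using a that by blast
qed

section \<open>Tetrahedra of a 5-simplex as pairs of omitted vertices\<close>

lemma sum_faces_pairs:
  assumes V: "card V = 6"
  shows "(\<Sum>F\<in>faces 3 V. f F) = (\<Sum>v\<in>V. \<Sum>u\<in>{u\<in>V. u < v}. f (V - {v} - {u}))"
proof -
  have fin: "finite V" using V card_ge_0_finite by force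
  have "bij_betw (\<lambda>(v, u). V - {v} - {u}) (SIGMA v:V. {u\<in>V. u < v}) (faces 3 V)"
  proof (rule bij_betw_byWitness[where f' = "\<lambda>F. (Max (V - F), Min (V - F))"])
    show "\<forall>a\<in>SIGMA v:V. {u\<in>V. u < v}. (Max (V - (case a of (v, u) \<Rightarrow> V - {v} - {u})), Min (V - (case a of (v, u) \<Rightarrow> V - {v} - {u}))) = a"
    proof
      fix a assume "a \<in> (SIGMA v:V. {u\<in>V. u < v})"
      then obtain v u where a: "a = (v, u)" "v \<in> V" "u \<in> V" "u < v" by auto
      then have "V - (V - {v} - {u}) = {u, v}" by auto
      then show "(Max (V - (case a of (v, u) \<Rightarrow> V - {v} - {u})), Min (V - (case a of (v, u) \<Rightarrow> V - {v} - {u}))) = a"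
        using a by simp
    qed
    have *: "Max (V - F) \<in> V \<and> Min (V - F) \<in> V \<and> Min (V - F) < Max (V - F) \<and> V - {Max (V - F)} - {Min (V - F)} = F"
      if "F \<in> faces 3 V" for F
    proof -
      have FV: "F \<subseteq> V" and "card F = 4" using that by (auto simp: faces_def)
      then have "card (V - F) = 2" using V by (simp add: card_Diff_subset finite_subset[OF _ fin])
      then obtain x y where xy: "V - F = {x, y}" "x \<noteq> y" by (auto simp: card_2_iff)
      then have "x \<in> V" "y \<in> V" "F = V - {x} - {y}" "F = V - {y} - {x}" using FV by auto
      then show ?thesis using xy unfolding xy(1) by (cases "x < y") (auto simp: max_def min_def)
    qed
    then show "\<forall>F\<in>faces 3 V. (case (Max (V - F), Min (V - F)) of (v, u) \<Rightarrow> V - {v} - {u}) = F"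
      and "(\<lambda>F. (Max (V - F), Min (V - F))) ` faces 3 V \<subseteq> (SIGMA v:V. {u\<in>V. u < v})" by auto
    show "(\<lambda>(v, u). V - {v} - {u}) ` (SIGMA v:V. {u\<in>V. u < v}) \<subseteq> faces 3 V"
      using V fin by (auto simp: faces_def card_Diff_singleton)
  qed
  then have "(\<Sum>F\<in>faces 3 V. f F) = (\<Sum>x\<in>(SIGMA v:V. {u\<in>V. u < v}). f (case x of (v, u) \<Rightarrow> V - {v} - {u}))"
    by (rule sum.reindex_bij_betw[symmetric])
  then show ?thesis using fin by (subst sum.Sigma) (auto simp: case_prod_beta)
qed

text \<open>Read off \<open>sum_faces_pairs\<close>: for the indicator function of F the sum is 1,
  so some pair contributes.\<close>

lemma face_pair:
  assumes V: "card V = 6" and F: "F \<in> faces 3 V"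
  obtains v u where "v \<in> V" "u \<in> V" "u < v" "F = V - {v} - {u}"
proof -
  have "(\<Sum>F'\<in>faces 3 V. if F' = F then 1 else 0 :: nat) = 1"
    using F V finite_faces[of V 3] card_ge_0_finite[of V] by simp
  then have "(\<Sum>v\<in>V. \<Sum>u\<in>{u\<in>V. u < v}. if V - {v} - {u} = F then 1 else 0 :: nat) = 1"
    by (simp only: sum_faces_pairs[OF V])
  moreover have "(\<Sum>v\<in>V. \<Sum>u\<in>{u\<in>V. u < v}. if V - {v} - {u} = F then 1 else 0 :: nat) = 0"
    if "\<not> (\<exists>v\<in>V. \<exists>u\<in>{u\<in>V. u < v}. V - {v} - {u} = F)"
    using that by (intro sum.neutral ballI) auto
  ultimately have "\<exists>v\<in>V. \<exists>u\<in>{u\<in>V. u < v}. V - {v} - {u} = F" by fastforce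
  then show ?thesis using that by blast
qed

text \<open>Reading a tetrahedron \<open>V - {u, v}\<close> as the edge \<open>uv\<close> of the complete graph on \<open>V\<close>,
  3-cocycles become circulations, and each function \<open>h\<close> on the vertices gives a cut relation.\<close>

definition cut_coeff :: "nat set \<Rightarrow> (nat \<Rightarrow> int) \<Rightarrow> nat set \<Rightarrow> int" where
  "cut_coeff V h F = vsign V (Max (V - F)) * vsign V (Min (V - F)) * (h (Max (V - F)) - h (Min (V - F)))"

lemma cut_coeff_pair:
  assumes "v \<in> V" "u \<in> V" "u < v"
  shows "cut_coeff V h (V - {v} - {u}) = vsign V v * vsign V u * (h v - h u)"
proof -
  have "V - (V - {v} - {u}) = {u, v}" using assms by auto
  then show ?thesis using assms by (simp add: cut_coeff_def)
qed

text \<open>Closedness of \<nu> on the 4-face opposite to v is conservation at the vertex v. Adding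
  these conditions with signs and weights \<open>h v\<close> leaves a difference of h on each
  edge.\<close>

lemma cut_relation:
  fixes \<nu> :: "nat set \<Rightarrow> int"
  assumes V: "card V = 6" and \<nu>: "cocycle3 V \<nu>"
  shows "(\<Sum>F\<in>faces 3 V. cut_coeff V h F * \<nu> F) = 0"
proof -
  have fin: "finite V" using V card_ge_0_finite by force
  have "V - {v} \<in> faces 4 V" if "v \<in> V" for v
    using that V fin by (auto simp: faces_def)
  then have "(\<Sum>v\<in>V. vsign V v * (h v * coboundary \<nu> (V - {v}))) = 0"
    using \<nu> by (simp add: cocycle3_def)
  moreover have "(\<Sum>F\<in>faces 3 V. cut_coeff V h F * \<nu> F)
      = (\<Sum>v\<in>V. \<Sum>u\<in>{u\<in>V. u < v}. vsign V v * vsign V u * (h v - h u) * \<nu> (V - {v} - {u}))"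
    unfolding sum_faces_pairs[OF V] by (intro sum.cong refl) (auto simp: cut_coeff_pair)
  ultimately show ?thesis using sum_vsign_coboundary[OF fin, of h \<nu>] by simp
qed

text \<open>Conversely every relation is of this kind. The coboundary of the indicator of the
  triangle complementary to v0, v, w is a unit circulation around v0, v, w; tested on it, the
  relation, with the signs absorbed, adds up to zero around that cycle. The potential at v is then
  the coefficient on the edge from v to v0 = Min V.\<close>

lemma relation_potential:
  fixes b :: "nat set \<Rightarrow> 'a::comm_ring_1"
  assumes V: "card V = 6" and b: "\<And>\<nu>. cocycle3 V \<nu> \<Longrightarrow> (\<Sum>F\<in>faces 3 V. b F * \<nu> F) = 0"
  obtains \<pi> where "\<And>u v. u \<in> V \<Longrightarrow> v \<in> V \<Longrightarrow> u < v \<Longrightarrow>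
     vsign V v * vsign V u * b (V - {v} - {u}) = \<pi> v - \<pi> u"
proof -
  have fin: "finite V" and "V \<noteq> {}" using V card_ge_0_finite by force+
  define v0 where "v0 = Min V"
  define \<pi> where "\<pi> v = (if v = v0 then 0 else vsign V v * vsign V v0 * b (V - {v} - {v0}))" for v
  have v0: "v0 \<in> V" "\<And>v. v \<in> V \<Longrightarrow> v0 \<le> v" using fin \<open>V \<noteq> {}\<close> by (auto simp: v0_def)
  have "vsign V w * vsign V v * b (V - {w} - {v}) = \<pi> w - \<pi> v"
    if vw: "v \<in> V" "w \<in> V" "v < w" for v w
  proof (cases "v = v0")
    case True
    then show ?thesis using vw by (simp add: \<pi>_def)
  next
    case False
    then have lt: "v0 < v" using v0(2)[OF vw(1)] by simp
    \<comment> \<open>The tetrahedra containing \<open>?T\<close> are exactly \<open>?Fw\<close>,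
      \<open>?Fv\<close> and \<open>?Fu\<close>, so only three terms of the relation
      survive.\<close>
    let ?u = v0 and ?T = "V - {v0} - {v} - {w}"
    let ?\<nu> = "coboundary (face_indicator ?T) :: nat set \<Rightarrow> 'a"
    let ?Fw = "V - {v} - {?u}" and ?Fv = "V - {w} - {?u}" and ?Fu = "V - {w} - {v}"
    have fs: "?Fw \<in> faces 3 V" "?Fv \<in> faces 3 V" "?Fu \<in> faces 3 V"
      using V fin vw lt v0(1) by (auto simp: faces_def card_Diff_singleton)
    have z: "?\<nu> F = 0" if F: "F \<in> faces 3 V" "F \<notin> {?Fw, ?Fv, ?Fu}" for F
    proof (rule coboundary_face_indicator_0)
      fix x assume x: "x \<in> F"
      show "F - {x} \<noteq> ?T"
      proof
        assume "F - {x} = ?T"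
        then have "F = insert x ?T" "x \<notin> ?T" "x \<in> V" using x F(1) by (auto simp: faces_def)
        then have "F \<in> {?Fw, ?Fv, ?Fu}" using vw lt v0(1) by auto
        then show False using F(2) by blast
      qed
    qed
    have w: "?\<nu> ?Fw = vsign V w" and v: "?\<nu> ?Fv = - vsign V v" and u: "?\<nu> ?Fu = vsign V ?u"
    proof -
      have T: "?T = ?Fw - {w}" "?T = ?Fv - {v}" "?T = ?Fu - {?u}" by auto
      have "coboundary (face_indicator (?Fw - {w})) ?Fw = (vsign ?Fw w :: 'a)"
        by (rule coboundary_face_indicator) (use fin vw lt in auto)
      then show "?\<nu> ?Fw = vsign V w" using vw lt v0(1) fin unfolding T(1) by (simp add: vsign_remove)
      have "coboundary (face_indicator (?Fv - {v})) ?Fv = (vsign ?Fv v :: 'a)"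
        by (rule coboundary_face_indicator) (use fin vw lt in auto)
      then show "?\<nu> ?Fv = - vsign V v" using vw lt v0(1) fin unfolding T(2) by (simp add: vsign_remove)
      have "coboundary (face_indicator (?Fu - {?u})) ?Fu = (vsign ?Fu ?u :: 'a)"
        by (rule coboundary_face_indicator) (use fin vw lt v0(1) in auto)
      then show "?\<nu> ?Fu = vsign V ?u" using vw lt v0(1) fin unfolding T(3) by (simp add: vsign_remove)
    qed
    have "w \<in> ?Fw" "w \<notin> ?Fv" "w \<notin> ?Fu" "v \<in> ?Fv" "v \<notin> ?Fu" using vw lt by auto
    then have dist: "?Fw \<noteq> ?Fv" "?Fw \<noteq> ?Fu" "?Fv \<noteq> ?Fu" by metis+
    have "0 = (\<Sum>F\<in>faces 3 V. b F * ?\<nu> F)" using b[OF cocycle3_coboundary] by simp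
    also have "\<dots> = (\<Sum>F\<in>{?Fw, ?Fv, ?Fu}. b F * ?\<nu> F)"
      by (rule sum.mono_neutral_right) (use z fs finite_faces[OF fin] in auto)
    also have "\<dots> = b ?Fw * vsign V w - b ?Fv * vsign V v + b ?Fu * vsign V ?u"
      using dist w v u by simp
    \<comment> \<open>Multiplication by all three signs makes the sign from each incidence a
      square.\<close>
    finally have "vsign V w * vsign V v * vsign V ?u * (b ?Fw * vsign V w - b ?Fv * vsign V v + b ?Fu * vsign V ?u) = 0"
      by simp
    then have "vsign V v * vsign V ?u * b ?Fw * (vsign V w * vsign V w) - vsign V w * vsign V ?u * b ?Fv * (vsign V v * vsign V v)
       + vsign V w * vsign V v * b ?Fu * (vsign V ?u * vsign V ?u) = 0"
      by (simp only: ring_distribs mult_ac)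
    then have "vsign V w * vsign V v * b ?Fu = vsign V w * vsign V ?u * b ?Fv - vsign V v * vsign V ?u * b ?Fw"
      by (simp add: algebra_simps)
    then show ?thesis using lt vw by (simp add: \<pi>_def)
  qed
  then show ?thesis using that by blast
qed

text \<open>Integer rows, tested on integer cocycles only. \<open>component_matrix_expand\<close>
  carries them over to every commutative ring, so a single matrix serves characteristic 0 and
  characteristic p.\<close>

definition component_matrix :: "nat set \<Rightarrow> nat set set \<Rightarrow> (nat set \<Rightarrow> nat set \<Rightarrow> int) \<Rightarrow> bool" where
  "component_matrix V B n \<longleftrightarrow> finite V \<and> B \<subseteq> faces 3 V \<and>
     (\<forall>F\<in>faces 3 V. \<forall>\<nu>::nat set \<Rightarrow> int. cocycle3 V \<nu> \<longrightarrow> \<nu> F = (\<Sum>F'\<in>B. n F F' * \<nu> F'))"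

text \<open>With everything on one side, the expansion is a linear relation among components, and
  relations lift by \<open>cocycle3_relation_lift\<close>.\<close>

lemma component_expand_lift:
  fixes \<nu> :: "nat set \<Rightarrow> 'a::comm_ring_1" and c :: "nat set \<Rightarrow> int"
  assumes fin: "finite V" and sub: "B \<subseteq> faces 3 V" and F: "F \<in> faces 3 V"
    and c: "\<And>x::nat set \<Rightarrow> int. cocycle3 V x \<Longrightarrow> x F = (\<Sum>F'\<in>B. c F' * x F')"
    and \<nu>: "cocycle3 V \<nu>"
  shows "\<nu> F = (\<Sum>F'\<in>B. of_int (c F') * \<nu> F')"
proof -
  let ?a = "\<lambda>F'. (if F' = F then 1 else 0) - (if F' \<in> B then c F' else 0)"
  have split: "(\<Sum>F'\<in>faces 3 V. f F' - g F') = x - (\<Sum>F'\<in>B. y F')"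
    if "\<And>F'. F' \<in> faces 3 V \<Longrightarrow> f F' = (if F' = F then x else 0)"
      and "\<And>F'. F' \<in> faces 3 V \<Longrightarrow> g F' = (if F' \<in> B then y F' else 0)"
    for f g y :: "nat set \<Rightarrow> 'b::ab_group_add" and x
  proof -
    have "(\<Sum>F'\<in>faces 3 V. f F' - g F')
      = (\<Sum>F'\<in>faces 3 V. if F' = F then x else 0) - (\<Sum>F'\<in>faces 3 V. if F' \<in> B then y F' else 0)"
      unfolding sum_subtractf[symmetric] by (rule sum.cong) (use that in auto)
    then show ?thesis using F sub finite_faces[OF fin, of 3]
      by (simp add: sum.inter_restrict[symmetric] Int_absorb1)
  qed
  have "(\<Sum>F'\<in>faces 3 V. of_int (?a F') * \<nu> F') = 0"
  proof (rule cocycle3_relation_lift[OF ring_map_on_of_int fin order_refl _ \<nu>])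
    fix x :: "nat set \<Rightarrow> int" assume "cocycle3 V x"
    have "(\<Sum>F'\<in>faces 3 V. ?a F' * x F') = x F - (\<Sum>F'\<in>B. c F' * x F')"
      unfolding left_diff_distrib by (rule split) auto
    then show "(\<Sum>F'\<in>faces 3 V. ?a F' * x F') = 0" using c[OF \<open>cocycle3 V x\<close>] by simp
  qed
  moreover have "(\<Sum>F'\<in>faces 3 V. of_int (?a F') * \<nu> F') = \<nu> F - (\<Sum>F'\<in>B. of_int (c F') * \<nu> F')"
    unfolding of_int_diff left_diff_distrib by (rule split) auto
  ultimately show ?thesis by simp
qed

text \<open>Unimodularity of graphs. A rational relation supported on \<open>insert F B\<close> has
  a potential; replacing it by the indicator of a level set gives a cut relation with coefficients
  0, 1, -1. The support does not grow, since the indicator changes along an edge only if the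
  potential does, and the coefficient at F is a unit, so the component at F is solved for without
  division.\<close>

lemma component_row_exists:
  assumes V: "card V = 6" and B: "max_indep_components TYPE(rat) V B" and F: "F \<in> faces 3 V"
  shows "\<exists>r :: nat set \<Rightarrow> int. \<forall>\<nu>::nat set \<Rightarrow> int. cocycle3 V \<nu> \<longrightarrow> \<nu> F = (\<Sum>F'\<in>B. r F' * \<nu> F')"
proof -
  have fin: "finite V" using V card_ge_0_finite by force
  have sub: "B \<subseteq> faces 3 V" using B by (simp add: max_indep_components_def indep_components_def)
  have finB: "finite B" using sub finite_faces[OF fin] finite_subset by blast
  show ?thesis
  proof (cases "F \<in> B")
    case True
    have "(\<Sum>F'\<in>B. (if F' = F then 1 else 0) * \<nu> F') = \<nu> F" for \<nu> :: "nat set \<Rightarrow> int"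
      using True finB by (simp add: if_distrib[of "\<lambda>x. x * _"] cong: if_cong)
    then show ?thesis by (intro exI[of _ "\<lambda>F'. if F' = F then 1 else 0"]) simp
  next
    case False
    obtain a :: "nat set \<Rightarrow> rat" where aF: "a F \<noteq> 0"
      and a: "\<And>\<nu>. cocycle3 V \<nu> \<Longrightarrow> (\<Sum>F'\<in>insert F B. a F' * \<nu> F') = 0"
      using max_indep_components_dependent[OF B fin F False] by blast
    define b where "b F' = (if F' \<in> insert F B then a F' else 0)" for F'
    have b: "(\<Sum>F'\<in>faces 3 V. b F' * \<nu> F') = 0" if "cocycle3 V \<nu>" for \<nu>
    proof -
      have "(\<Sum>F'\<in>faces 3 V. b F' * \<nu> F') = (\<Sum>F'\<in>insert F B. b F' * \<nu> F')"
        by (rule sum.mono_neutral_right) (use sub F finite_faces[OF fin] in \<open>auto simp: b_def\<close>)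
      also have "\<dots> = (\<Sum>F'\<in>insert F B. a F' * \<nu> F')" by (rule sum.cong) (auto simp: b_def)
      finally show ?thesis using a[OF that] by simp
    qed
    obtain \<pi> where \<pi>: "\<And>u v. u \<in> V \<Longrightarrow> v \<in> V \<Longrightarrow> u < v \<Longrightarrow>
        vsign V v * vsign V u * b (V - {v} - {u}) = \<pi> v - \<pi> u"
      using relation_potential[OF V b] by blast
    obtain v1 u1 where vu: "v1 \<in> V" "u1 \<in> V" "u1 < v1" "F = V - {v1} - {u1}"
      using face_pair[OF V F] by blast
    \<comment> \<open>The level set through one end of the edge F; it separates the two ends because
      the relation is nonzero at F.\<close>
    define h :: "nat \<Rightarrow> int" where "h v = (if \<pi> v = \<pi> v1 then 1 else 0)" for v
    have bF: "b F \<noteq> 0" using aF by (simp add: b_def)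
    have sgn: "vsign V v * vsign V u \<noteq> (0::rat)" for v u
      by (simp add: vsign_nonzero)
    have "\<pi> v1 \<noteq> \<pi> u1" using \<pi>[OF vu(2,1,3)] bF vu(4) sgn by (metis mult_eq_0_iff right_minus_eq)
    have mF: "cut_coeff V h F * cut_coeff V h F = 1"
    proof -
      have "h v1 - h u1 = 1" using \<open>\<pi> v1 \<noteq> \<pi> u1\<close> by (simp add: h_def)
      then have "cut_coeff V h F * cut_coeff V h F = (vsign V v1 * vsign V v1) * (vsign V u1 * vsign V u1)"
        unfolding vu(4) cut_coeff_pair[OF vu(1-3)] by (simp only: mult_1_right mult_ac)
      then show ?thesis unfolding vsign_square by simp
    qed
    have supp: "F' \<in> insert F B" if F': "F' \<in> faces 3 V" and m: "cut_coeff V h F' \<noteq> 0" for F'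
    proof -
      obtain v u where vu': "v \<in> V" "u \<in> V" "u < v" "F' = V - {v} - {u}"
        using face_pair[OF V F'] by blast
      then have "h v \<noteq> h u" using m by (auto simp: cut_coeff_pair)
      then have "\<pi> v \<noteq> \<pi> u" by (auto simp: h_def)
      then have "b F' \<noteq> 0" using \<pi>[OF vu'(2,1,3)] vu'(4) by auto
      then show ?thesis by (auto simp: b_def split: if_splits)
    qed
    \<comment> \<open>\<open>cut_coeff V h F\<close> is its own inverse.\<close>
    let ?r = "\<lambda>F'. - cut_coeff V h F * cut_coeff V h F'"
    have "\<nu> F = (\<Sum>F'\<in>B. ?r F' * \<nu> F')" if \<nu>: "cocycle3 V \<nu>" for \<nu> :: "nat set \<Rightarrow> int"
    proof -
      have "0 = (\<Sum>F'\<in>faces 3 V. cut_coeff V h F' * \<nu> F')" using cut_relation[OF V \<nu>] by simp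
      also have "\<dots> = (\<Sum>F'\<in>insert F B. cut_coeff V h F' * \<nu> F')"
        by (rule sum.mono_neutral_right) (use sub F finite_faces[OF fin] supp in auto)
      also have "\<dots> = cut_coeff V h F * \<nu> F + (\<Sum>F'\<in>B. cut_coeff V h F' * \<nu> F')"
        using finB False by simp
      finally have "cut_coeff V h F * \<nu> F = - (\<Sum>F'\<in>B. cut_coeff V h F' * \<nu> F')" by simp
      then have "cut_coeff V h F * cut_coeff V h F * \<nu> F = cut_coeff V h F * - (\<Sum>F'\<in>B. cut_coeff V h F' * \<nu> F')"
        by (simp only: mult.assoc)
      then have "\<nu> F = cut_coeff V h F * - (\<Sum>F'\<in>B. cut_coeff V h F' * \<nu> F')" by (simp only: mF mult_1_left)
      also have "\<dots> = (\<Sum>F'\<in>B. ?r F' * \<nu> F')"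
        by (simp only: mult_minus_right mult_minus_left sum_distrib_left sum_negf mult.assoc)
      finally show ?thesis .
    qed
    then show ?thesis by (intro exI[of _ ?r]) simp
  qed
qed

lemma component_matrix_exists:
  assumes V: "card V = 6" and B: "max_indep_components TYPE(rat) V B"
  obtains n where "component_matrix V B n"
proof -
  have "finite V" using V card_ge_0_finite by force
  moreover have "B \<subseteq> faces 3 V" using B by (simp add: max_indep_components_def indep_components_def)
  moreover have "\<forall>F\<in>faces 3 V. \<exists>r :: nat set \<Rightarrow> int. \<forall>\<nu>::nat set \<Rightarrow> int. cocycle3 V \<nu> \<longrightarrow>
     \<nu> F = (\<Sum>F'\<in>B. r F' * \<nu> F')"
    using component_row_exists[OF V B] by blast
  from bchoice[OF this] obtain n :: "nat set \<Rightarrow> nat set \<Rightarrow> int" where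
    "\<forall>F\<in>faces 3 V. \<forall>\<nu>::nat set \<Rightarrow> int. cocycle3 V \<nu> \<longrightarrow> \<nu> F = (\<Sum>F'\<in>B. n F F' * \<nu> F')" ..
  ultimately have "component_matrix V B n" by (simp add: component_matrix_def)
  then show ?thesis by (rule that)
qed

lemma component_matrix_faces: "component_matrix V B n \<Longrightarrow> B \<subseteq> faces 3 V"
  by (auto simp: component_matrix_def)

lemma component_matrix_finite_basis: "component_matrix V B n \<Longrightarrow> finite B"
  by (auto simp: component_matrix_def intro: finite_subset[OF _ finite_faces])

lemma component_matrix_expand:
  fixes \<nu> :: "nat set \<Rightarrow> 'a::comm_ring_1"
  assumes n: "component_matrix V B n" and F: "F \<in> faces 3 V" and \<nu>: "cocycle3 V \<nu>"
  shows "\<nu> F = (\<Sum>F'\<in>B. of_int (n F F') * \<nu> F')"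
proof -
  show ?thesis
    by (rule component_expand_lift[OF _ _ F _ \<nu>]) (use n F in \<open>auto simp: component_matrix_def\<close>)
qed

text \<open>If a row vanished in the ring, the component at F would be zero on all cocycles over it.
  The case of interest is characteristic p.\<close>

lemma component_matrix_row_nonzero:
  assumes n: "component_matrix V B n" and F: "F \<in> faces 3 V"
  obtains F' where "F' \<in> B" "of_int (n F F') \<noteq> (0::'a::comm_ring_1)"
proof -
  obtain T where "coboundary (face_indicator T) F \<noteq> (0::'a)"
    using cocycle3_nonzero_component[OF F] by blast
  then have ne: "(\<Sum>F'\<in>B. of_int (n F F') * coboundary (face_indicator T) F') \<noteq> (0::'a)"
    unfolding component_matrix_expand[OF n F cocycle3_coboundary, symmetric] .
  have "\<exists>F'\<in>B. of_int (n F F') \<noteq> (0::'a)"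
  proof (rule ccontr)
    assume "\<not> ?thesis"
    then have "(\<Sum>F'\<in>B. of_int (n F F') * coboundary (face_indicator T) F') = (0::'a)"
      by (intro sum.neutral ballI) (metis mult_zero_left)
    with ne show False by contradiction
  qed
  then show ?thesis by (elim bexE) (rule that)
qed

section \<open>Reduction modulo a prime\<close>

text \<open>One integral polynomial read over an arbitrary field: reduction is the passage from its
  rational reading to the one over F_p.\<close>

definition frac_of :: "int bpoly \<Rightarrow> 'k::field ratfun" where
  "frac_of r = Fract (Poly_Mapping.map of_int r) 1"

definition frac_poly :: "int bpoly cpoly \<Rightarrow> 'k::field ratfun cpoly" where
  "frac_poly P = Poly_Mapping.map frac_of P"

lemma ring_map_on_frac_of: "ring_map_on UNIV (frac_of :: int bpoly \<Rightarrow> 'k::field ratfun)"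
proof -
  have "ring_map_on UNIV (\<lambda>f :: 'k bpoly. Fract f 1)"
    by (rule ring_map_onI) (auto simp: One_fract_def)
  from ring_map_on_comp[OF map_ring_map[OF ring_map_on_of_int] this]
  show ?thesis unfolding frac_of_def .
qed

lemma frac_of_zero [simp]: "frac_of 0 = 0"
  and frac_of_one [simp]: "frac_of 1 = 1"
  and frac_of_add: "frac_of (r + s) = frac_of r + frac_of s"
  and frac_of_mult: "frac_of (r * s) = frac_of r * frac_of s"
  by (rule ring_map_zero ring_map_one ring_map_uminus ring_map_add ring_map_mult, rule ring_map_on_frac_of)+

lemma frac_of_sum: "frac_of (sum f A) = (\<Sum>a\<in>A. frac_of (f a))"
  by (induction A rule: infinite_finite_induct) (auto simp: frac_of_add)

lemma frac_of_of_int: "frac_of (of_int z) = of_int z"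
proof -
  define S :: "int bpoly \<Rightarrow> 'a ratfun \<Rightarrow> bool" where "S a b \<longleftrightarrow> b = frac_of a" for a b
  have "ring_rel S" using ring_map_on_frac_of by (simp add: S_def[abs_def] ring_map_on_def)
  from ring_rel_of_int[OF this, of z] show ?thesis by (simp add: S_def)
qed

lemma frac_of_eq_0_iff: "frac_of r = (0 :: 'k::field ratfun) \<longleftrightarrow> Poly_Mapping.map of_int r = (0 :: 'k bpoly)"
  by (simp add: frac_of_def Zero_fract_def eq_fract)

lemma frac_of_divide:
  "frac_of r / frac_of s = Fract (Poly_Mapping.map of_int r) (Poly_Mapping.map of_int s)"
  by (simp add: frac_of_def)

lemma map_pvar:
  assumes "ring_map_on UNIV h"
  shows "Poly_Mapping.map h (pvar v) = pvar v"
  using ring_map_on_zero[OF assms] ring_map_on_one[OF assms] by (simp add: pvar_def)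

lemma frac_of_pvar: "frac_of (pvar (set_encode F)) = ratvar F"
  by (simp add: frac_of_def ratvar_def map_pvar[OF ring_map_on_of_int])

lemma ring_map_on_frac_poly: "ring_map_on UNIV (frac_poly :: int bpoly cpoly \<Rightarrow> 'k::field ratfun cpoly)"
  unfolding frac_poly_def[abs_def] by (rule map_ring_map[OF ring_map_on_frac_of])

lemma frac_poly_zero [simp]: "frac_poly 0 = 0"
  and frac_poly_one [simp]: "frac_poly 1 = 1"
  and frac_poly_uminus: "frac_poly (- r) = - frac_poly r"
  and frac_poly_add: "frac_poly (r + s) = frac_poly r + frac_poly s"
  and frac_poly_mult: "frac_poly (r * s) = frac_poly r * frac_poly s"
  by (rule ring_map_zero ring_map_one ring_map_uminus ring_map_add ring_map_mult, rule ring_map_on_frac_poly)+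

lemma lookup_frac_poly: "Poly_Mapping.lookup (frac_poly P) m = frac_of (Poly_Mapping.lookup P m)"
  by (simp add: frac_poly_def lookup_map)

lemma frac_poly_pconst: "frac_poly (pconst r) = pconst (frac_of r)"
  by (simp add: frac_poly_def pconst_def)

lemma frac_poly_pvar: "frac_poly (pvar v) = pvar v"
  unfolding frac_poly_def by (rule map_pvar[OF ring_map_on_frac_of])

lemma of_int_mod_ring_eq_0_iff: "(of_int z :: 'p::prime_card mod_ring) = 0 \<longleftrightarrow> int CARD('p) dvd z"
  by (simp add: of_int_eq_0_iff_char_dvd)

lemma map_of_int_mod_ring_eq_0_iff:
  "Poly_Mapping.map of_int r = (0 :: ('v \<Rightarrow>\<^sub>0 nat) \<Rightarrow>\<^sub>0 'p::prime_card mod_ring) \<longleftrightarrow>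
    (\<forall>n. int CARD('p) dvd Poly_Mapping.lookup r n)"
  by (simp add: poly_mapping_eq_iff fun_eq_iff lookup_map of_int_mod_ring_eq_0_iff)

lemma map_of_int_rat_eq_0_iff:
  "Poly_Mapping.map of_int r = (0 :: ('v \<Rightarrow>\<^sub>0 nat) \<Rightarrow>\<^sub>0 rat) \<longleftrightarrow> r = 0"
  by (simp add: poly_mapping_eq_iff fun_eq_iff lookup_map)

text \<open>Pairs with a common integral numerator and denominator, the latter nonzero modulo p.
  Unlike in \<open>reduces_to\<close>, the numerator may be divisible by p, so no case distinction
  on the valuation stands in the way of the ring operations. The two notions agree by
  \<open>reduces_to_iff\<close>.\<close>

definition reduction_rel :: "nat set set \<Rightarrow> nat set set \<Rightarrow> nat set set \<Rightarrow>
    rat ratfun cpoly \<Rightarrow> 'p::prime_card mod_ring ratfun cpoly \<Rightarrow> bool" where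
  "reduction_rel B B\<^sub>\<nu> B\<^sub>\<eta> x y \<longleftrightarrow> (\<exists>P R.
     vars_in (Nu ` B\<^sub>\<nu> \<union> Eta ` B\<^sub>\<eta>) P \<and> (\<forall>m. vars_in (set_encode ` B) (Poly_Mapping.lookup P m)) \<and>
     vars_in (set_encode ` B) R \<and> Poly_Mapping.map of_int R \<noteq> (0 :: 'p mod_ring bpoly) \<and>
     pconst (frac_of R) * x = frac_poly P \<and> pconst (frac_of R) * y = frac_poly P)"

lemma vars_in_coeff_mult:
  fixes P Q :: "'a::comm_ring_1 bpoly cpoly"
  assumes "\<forall>m. vars_in S (Poly_Mapping.lookup P m)" "\<forall>m. vars_in S (Poly_Mapping.lookup Q m)"
  shows "\<forall>m. vars_in S (Poly_Mapping.lookup (P * Q) m)"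
proof -
  \<comment> \<open>The evaluation is irrelevant, hence the point \<open>undefined\<close>: only
    closure of the domain under products is used.\<close>
  have "ring_map_on {r :: 'a bpoly. vars_in S r} (\<lambda>x. x)"
    by (rule ring_map_onI) (auto intro: vars_in_add vars_in_mult vars_in_uminus)
  from ring_map_on_mult[OF peval_ring_map_on[OF this], of P Q undefined] assms
  show ?thesis by simp
qed

lemma reduction_rel_zero: "reduction_rel B B\<^sub>\<nu> B\<^sub>\<eta> 0 (0 :: 'p::prime_card mod_ring ratfun cpoly)"
proof -
  have "Poly_Mapping.map of_int (1 :: int bpoly) = (1 :: 'p mod_ring bpoly)"
    using ring_map_on_one[OF map_ring_map[OF ring_map_on_of_int]] by blast
  then show ?thesis
    unfolding reduction_rel_def by (intro exI[of _ 0] exI[of _ 1]) simp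
qed

lemma reduction_rel_ofI:
  assumes "vars_in (Nu ` B\<^sub>\<nu> \<union> Eta ` B\<^sub>\<eta>) P" "\<forall>m. vars_in (set_encode ` B) (Poly_Mapping.lookup P m)"
  shows "reduction_rel B B\<^sub>\<nu> B\<^sub>\<eta> (frac_poly P) (frac_poly P :: 'p::prime_card mod_ring ratfun cpoly)"
proof -
  have "Poly_Mapping.map of_int (1 :: int bpoly) = (1 :: 'p mod_ring bpoly)"
    using ring_map_on_one[OF map_ring_map[OF ring_map_on_of_int]] by blast
  then show ?thesis
    unfolding reduction_rel_def using assms by (intro exI[of _ P] exI[of _ 1]) simp
qed

text \<open>Denominators are multiplied, and their product stays nonzero modulo p because
  polynomials over F_p form an integral domain; this is Gauss's lemma.\<close>

lemma ring_rel_reduction_rel: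
  "ring_rel (reduction_rel B B\<^sub>\<nu> B\<^sub>\<eta> :: _ \<Rightarrow> 'p::prime_card mod_ring ratfun cpoly \<Rightarrow> bool)"
proof -
  let ?S = "reduction_rel B B\<^sub>\<nu> B\<^sub>\<eta> :: _ \<Rightarrow> 'p mod_ring ratfun cpoly \<Rightarrow> bool"
  have one: "?S 1 1"
  proof -
    have "\<forall>m. vars_in (set_encode ` B) (Poly_Mapping.lookup (1 :: int bpoly cpoly) m)"
      by (simp add: lookup_one when_def)
    from reduction_rel_ofI[OF vars_in_one this] show ?thesis by simp
  qed
  have neg: "?S (- x) (- y)" if "?S x y" for x y
  proof -
    obtain P R where PR: "vars_in (Nu ` B\<^sub>\<nu> \<union> Eta ` B\<^sub>\<eta>) P" "\<forall>m. vars_in (set_encode ` B) (Poly_Mapping.lookup P m)"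
      "vars_in (set_encode ` B) R" "Poly_Mapping.map of_int R \<noteq> (0 :: 'p mod_ring bpoly)"
      "pconst (frac_of R) * x = frac_poly P" "pconst (frac_of R) * y = frac_poly P"
      using \<open>?S x y\<close> unfolding reduction_rel_def by blast
    then show ?thesis unfolding reduction_rel_def
      by (intro exI[of _ "- P"] exI[of _ R]) (simp add: vars_in_uminus frac_poly_uminus)
  qed
  have "?S (x + x') (y + y') \<and> ?S (x * x') (y * y')" if xy: "?S x y" and xy': "?S x' y'" for x y x' y'
  proof -
    let ?v = "Nu ` B\<^sub>\<nu> \<union> Eta ` B\<^sub>\<eta>" and ?b = "set_encode ` B"
    obtain P R where PR: "vars_in ?v P" "\<forall>m. vars_in ?b (Poly_Mapping.lookup P m)"
      "vars_in ?b R" "Poly_Mapping.map of_int R \<noteq> (0 :: 'p mod_ring bpoly)"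
      "pconst (frac_of R) * x = frac_poly P" "pconst (frac_of R) * y = frac_poly P"
      using xy unfolding reduction_rel_def by blast
    obtain P' R' where PR': "vars_in ?v P'" "\<forall>m. vars_in ?b (Poly_Mapping.lookup P' m)"
      "vars_in ?b R'" "Poly_Mapping.map of_int R' \<noteq> (0 :: 'p mod_ring bpoly)"
      "pconst (frac_of R') * x' = frac_poly P'" "pconst (frac_of R') * y' = frac_poly P'"
      using xy' unfolding reduction_rel_def by blast
    have "Poly_Mapping.map of_int (R * R') = (Poly_Mapping.map of_int R * Poly_Mapping.map of_int R' :: 'p mod_ring bpoly)"
      using ring_map_on_mult[OF map_ring_map[OF ring_map_on_of_int]] by blast
    then have R: "Poly_Mapping.map of_int (R * R') \<noteq> (0 :: 'p mod_ring bpoly)" "vars_in ?b (R * R')"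
      using PR PR' by (simp_all add: vars_in_mult)
    let ?P = "pconst R' * P + pconst R * P'"
    have "vars_in ?v ?P" "\<forall>m. vars_in ?b (Poly_Mapping.lookup ?P m)"
      using PR PR' by (simp_all add: vars_in_add vars_in_mult lookup_add lookup_pconst_mult)
    moreover have "pconst (frac_of (R * R')) * (x + x') = frac_poly ?P"
      unfolding frac_poly_add frac_poly_mult frac_poly_pconst frac_of_mult pconst_mult
        PR(5)[symmetric] PR'(5)[symmetric] by (simp only: ring_distribs mult_ac)
    moreover have "pconst (frac_of (R * R')) * (y + y') = frac_poly ?P"
      unfolding frac_poly_add frac_poly_mult frac_poly_pconst frac_of_mult pconst_mult
        PR(6)[symmetric] PR'(6)[symmetric] by (simp only: ring_distribs mult_ac)
    ultimately have add: "?S (x + x') (y + y')"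
      unfolding reduction_rel_def using R by (intro exI[of _ ?P] exI[of _ "R * R'"]) blast
    have "vars_in ?v (P * P')" "\<forall>m. vars_in ?b (Poly_Mapping.lookup (P * P') m)"
      using PR PR' vars_in_coeff_mult by (blast intro: vars_in_mult)+
    moreover have "pconst (frac_of (R * R')) * (x * x') = frac_poly (P * P')"
      unfolding frac_poly_mult frac_of_mult pconst_mult
        PR(5)[symmetric] PR'(5)[symmetric] by (simp only: mult_ac)
    moreover have "pconst (frac_of (R * R')) * (y * y') = frac_poly (P * P')"
      unfolding frac_poly_mult frac_of_mult pconst_mult
        PR(6)[symmetric] PR'(6)[symmetric] by (simp only: mult_ac)
    ultimately have "?S (x * x') (y * y')"
      unfolding reduction_rel_def using R by (intro exI[of _ "P * P'"] exI[of _ "R * R'"]) blast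
    with add show ?thesis by blast
  qed
  then show ?thesis unfolding ring_rel_def using one neg reduction_rel_zero by blast
qed

lemma reduction_rel_pvar:
  "v \<in> Nu ` B\<^sub>\<nu> \<union> Eta ` B\<^sub>\<eta> \<Longrightarrow> reduction_rel B B\<^sub>\<nu> B\<^sub>\<eta> (pvar v) (pvar v :: 'p::prime_card mod_ring ratfun cpoly)"
proof -
  assume v: "v \<in> Nu ` B\<^sub>\<nu> \<union> Eta ` B\<^sub>\<eta>"
  have "\<forall>m. vars_in (set_encode ` B) (Poly_Mapping.lookup (pvar v :: int bpoly cpoly) m)"
    by (simp add: pvar_def lookup_single when_def)
  from reduction_rel_ofI[OF vars_in_pvar[OF v] this] show ?thesis by (simp add: frac_poly_pvar)
qed

text \<open>Covers the divisions by components of \<omega> in Q. What is nonzero modulo p is nonzero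
  over the rationals too, so the inverse is genuine on both sides.\<close>

lemma reduction_rel_inverse:
  assumes "vars_in (set_encode ` B) r" "Poly_Mapping.map of_int r \<noteq> (0 :: 'p::prime_card mod_ring bpoly)"
  shows "reduction_rel B B\<^sub>\<nu> B\<^sub>\<eta> (pconst (1 / frac_of r)) (pconst (1 / frac_of r) :: 'p mod_ring ratfun cpoly)"
proof -
  have "frac_of r \<noteq> (0 :: 'p mod_ring ratfun)" using assms by (simp add: frac_of_eq_0_iff)
  moreover have "r \<noteq> 0" using assms(2) ring_map_on_zero[OF map_ring_map[OF ring_map_on_of_int]] by metis
  then have "frac_of r \<noteq> (0 :: rat ratfun)" by (simp add: frac_of_eq_0_iff map_of_int_rat_eq_0_iff)
  ultimately show ?thesis
    unfolding reduction_rel_def using assms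
    by (intro exI[of _ 1] exI[of _ r]) (simp add: lookup_one when_def flip: pconst_mult)
qed

lemma scaled_eq_frac_poly_iff:
  assumes "Poly_Mapping.map of_int R \<noteq> (0 :: 'k::field bpoly)"
  shows "pconst (frac_of R) * x = frac_poly P \<longleftrightarrow>
    (\<forall>m. Poly_Mapping.lookup x m = Fract (Poly_Mapping.map of_int (Poly_Mapping.lookup P m)) (Poly_Mapping.map of_int R :: 'k bpoly))"
proof -
  have "frac_of R \<noteq> (0 :: 'k ratfun)" using assms by (simp add: frac_of_eq_0_iff)
  then show ?thesis
    unfolding poly_mapping_eq_iff fun_eq_iff lookup_pconst_mult lookup_frac_poly frac_of_divide[symmetric]
    by (auto simp: field_simps)
qed

text \<open>After subtraction it remains to see that 0 reduces only to 0: the integral numerator of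
  0 is itself zero, hence also zero over F_p.\<close>

lemma reduction_rel_unique:
  assumes "reduction_rel B B\<^sub>\<nu> B\<^sub>\<eta> x (y :: 'p::prime_card mod_ring ratfun cpoly)" "reduction_rel B B\<^sub>\<nu> B\<^sub>\<eta> x y'"
  shows "y = y'"
proof -
  have "reduction_rel B B\<^sub>\<nu> B\<^sub>\<eta> (x + - x) (y + - y')"
    using assms by (intro ring_rel_add[OF ring_rel_reduction_rel] ring_rel_uminus[OF ring_rel_reduction_rel])
  then obtain P R where R: "Poly_Mapping.map of_int R \<noteq> (0 :: 'p mod_ring bpoly)"
    and P: "pconst (frac_of R) * (x + - x) = frac_poly P" "pconst (frac_of R) * (y + - y') = frac_poly P"
    unfolding reduction_rel_def by blast
  have "frac_of (Poly_Mapping.lookup P m) = (0 :: rat ratfun)" for m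
    using arg_cong[OF P(1), of "\<lambda>q. Poly_Mapping.lookup q m"] by (simp add: lookup_frac_poly)
  then have "P = 0"
    by (intro poly_mapping_eqI) (simp add: frac_of_eq_0_iff map_of_int_rat_eq_0_iff)
  then have "frac_of R * Poly_Mapping.lookup (y + - y') m = 0" for m
    using arg_cong[OF P(2), of "\<lambda>q. Poly_Mapping.lookup q m"] by (simp add: lookup_pconst_mult)
  then have "y + - y' = 0"
    using R by (intro poly_mapping_eqI) (simp add: frac_of_eq_0_iff)
  then show ?thesis by simp
qed

section \<open>Agreement with valuation and reduction as defined\<close>

lemma content_exists:
  fixes P :: "int bpoly cpoly"
  assumes p: "p > 1" and "P \<noteq> 0"
  obtains l P' where "\<And>m n. Poly_Mapping.lookup (Poly_Mapping.lookup P m) n = int p ^ l * Poly_Mapping.lookup (Poly_Mapping.lookup P' m) n"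
    "\<exists>m n. \<not> int p dvd Poly_Mapping.lookup (Poly_Mapping.lookup P' m) n"
proof -
  let ?c = "\<lambda>m n. Poly_Mapping.lookup (Poly_Mapping.lookup P m) n"
  let ?D = "\<lambda>l. \<forall>m n. int p ^ l dvd ?c m n"
  obtain m0 n0 where c: "?c m0 n0 \<noteq> 0"
    using \<open>P \<noteq> 0\<close> by (metis lookup_zero poly_mapping_eqI)
  \<comment> \<open>A nonzero coefficient bounds the powers of p dividing all coefficients, so a
    greatest one exists.\<close>
  have bound: "l \<le> nat \<bar>?c m0 n0\<bar>" if "?D l" for l
  proof -
    have "int p ^ l dvd ?c m0 n0" using that by blast
    from dvd_imp_le_int[OF c this] have "int (p ^ l) \<le> \<bar>?c m0 n0\<bar>" by simp
    moreover have "l < p ^ l" using p by (simp add: power_gt_expt)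
    ultimately show ?thesis by linarith
  qed
  define l where "l = (GREATEST l. ?D l)"
  have Dl: "?D l" unfolding l_def by (rule GreatestI_nat[of ?D 0]) (use bound in auto)
  have max: "\<not> ?D (Suc l)"
  proof
    assume D: "?D (Suc l)"
    have "Suc l \<le> (GREATEST l. ?D l)" by (rule Greatest_le_nat[of ?D, OF D]) (use bound in blast)
    then show False by (simp add: l_def)
  qed
  define P' where "P' = Poly_Mapping.map (Poly_Mapping.map (\<lambda>z. z div int p ^ l)) P"
  have "Poly_Mapping.map (\<lambda>z. z div int p ^ l) 0 = (0 :: int bpoly)"
    by (rule poly_mapping_eqI) (simp add: lookup_map)
  then have "Poly_Mapping.lookup (Poly_Mapping.lookup P' m) n = ?c m n div int p ^ l" for m n
    by (simp add: P'_def lookup_map)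
  then have P': "?c m n = int p ^ l * Poly_Mapping.lookup (Poly_Mapping.lookup P' m) n" for m n
    using Dl by simp
  moreover have "\<exists>m n. \<not> int p dvd Poly_Mapping.lookup (Poly_Mapping.lookup P' m) n"
  proof (rule ccontr)
    assume "\<not> ?thesis"
    then have "?D (Suc l)" unfolding P' by (simp add: mult.commute mult_dvd_mono)
    then show False using max by blast
  qed
  ultimately show ?thesis using that by blast
qed

lemma of_nat_power_mult_Fract:
  "of_nat p ^ l * Fract (a :: 'k::field bpoly) b = Fract (of_nat p ^ l * a) b"
proof -
  have "of_nat p ^ l = (Fract (of_nat p ^ l) 1 :: 'k ratfun)"
    using of_nat_fract[of "p ^ l", where ?'a = "'k bpoly"] by simp
  then show ?thesis by simp
qed

lemma lookup_of_nat_mult: "Poly_Mapping.lookup (of_nat n * x) m = of_nat n * Poly_Mapping.lookup x m"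
  for x :: "('v \<Rightarrow>\<^sub>0 nat) \<Rightarrow>\<^sub>0 'a::comm_ring_1"
  using lookup_pconst_mult[of "of_nat n" x m] by simp

text \<open>The content \<open>p ^ l\<close> of the numerator is split off. For l = 0 the fraction
  has the required form; for l > 0 the valuation is positive and the factor p annihilates y.\<close>

lemma reduction_rel_imp_reduces_to:
  assumes "reduction_rel B B\<^sub>\<nu> B\<^sub>\<eta> x (y :: 'p::prime_card mod_ring ratfun cpoly)"
  shows "reduces_to B B\<^sub>\<nu> B\<^sub>\<eta> x y"
proof -
  let ?p = "CARD('p)" and ?v = "Nu ` B\<^sub>\<nu> \<union> Eta ` B\<^sub>\<eta>" and ?b = "set_encode ` B"
  have p: "?p > 1" using prime_card[where ?'a = 'p] prime_gt_1_nat by blast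
  obtain P R where PR: "vars_in ?v P" "\<forall>m. vars_in ?b (Poly_Mapping.lookup P m)"
      "vars_in ?b R" "Poly_Mapping.map of_int R \<noteq> (0 :: 'p mod_ring bpoly)"
      "pconst (frac_of R) * x = frac_poly P" "pconst (frac_of R) * y = frac_poly P"
    using assms unfolding reduction_rel_def by blast
  have "R \<noteq> 0" using PR(4) ring_map_on_zero[OF map_ring_map[OF ring_map_on_of_int]] by metis
  then have R0: "Poly_Mapping.map of_int R \<noteq> (0 :: rat bpoly)" by (simp add: map_of_int_rat_eq_0_iff)
  have Rn: "\<exists>n. \<not> int ?p dvd Poly_Mapping.lookup R n" using PR(4) by (simp add: map_of_int_mod_ring_eq_0_iff)
  have x: "Poly_Mapping.lookup x m = Fract (Poly_Mapping.map of_int (Poly_Mapping.lookup P m)) (Poly_Mapping.map of_int R)" for m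
    using PR(5) scaled_eq_frac_poly_iff[OF R0] by blast
  have y: "Poly_Mapping.lookup y m = Fract (Poly_Mapping.map of_int (Poly_Mapping.lookup P m)) (Poly_Mapping.map of_int R)" for m
    using PR(6) scaled_eq_frac_poly_iff[OF PR(4)] by blast
  show ?thesis
  proof (cases "P = 0")
    case True
    have z: "Poly_Mapping.map of_int (0 :: int bpoly) = (0 :: 'k::field bpoly)"
      using ring_map_on_zero[OF map_ring_map[OF ring_map_on_of_int]] by blast
    have "x = 0" "y = 0"
      using x y by (auto intro!: poly_mapping_eqI simp: True z fract_collapse)
    then show ?thesis by (simp add: reduces_to_def)
  next
    case False
    obtain l P' where P': "\<And>m n. Poly_Mapping.lookup (Poly_Mapping.lookup P m) n = int ?p ^ l * Poly_Mapping.lookup (Poly_Mapping.lookup P' m) n"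
      and ne: "\<exists>m n. \<not> int ?p dvd Poly_Mapping.lookup (Poly_Mapping.lookup P' m) n"
      using content_exists[OF p False] by blast
    have k1: "Poly_Mapping.keys (Poly_Mapping.lookup P' m) = Poly_Mapping.keys (Poly_Mapping.lookup P m)" for m
      by (auto simp: in_keys_iff P')
    have k0: "Poly_Mapping.lookup P' m = 0 \<longleftrightarrow> Poly_Mapping.lookup P m = 0" for m
      by (simp only: keys_eq_empty[symmetric] k1)
    have k2: "Poly_Mapping.keys P' = Poly_Mapping.keys P"
      by (rule Set.set_eqI) (simp only: in_keys_iff k0)
    have vars: "vars_in ?v P'" "\<forall>m. vars_in ?b (Poly_Mapping.lookup P' m)"
      using PR(1,2) unfolding vars_in_def k1 k2 by blast+
    have eq: "Poly_Mapping.map of_int (Poly_Mapping.lookup P m) = (of_nat ?p ^ l * Poly_Mapping.map of_int (Poly_Mapping.lookup P' m) :: 'k::field bpoly)" for m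
    proof (rule poly_mapping_eqI)
      fix n
      show "Poly_Mapping.lookup (Poly_Mapping.map of_int (Poly_Mapping.lookup P m)) n
        = Poly_Mapping.lookup (of_nat ?p ^ l * Poly_Mapping.map of_int (Poly_Mapping.lookup P' m) :: 'k bpoly) n"
        using lookup_of_nat_mult[of "?p ^ l" "Poly_Mapping.map of_int (Poly_Mapping.lookup P' m) :: 'k bpoly" n]
        by (simp add: lookup_map P')
    qed
    have pf: "pfrac ?p B B\<^sub>\<nu> B\<^sub>\<eta> (int l) P' R x"
      unfolding pfrac_def using vars PR(3) ne Rn by (simp add: x eq of_nat_power_mult_Fract)
    show ?thesis
    proof (cases "l = 0")
      case True
      then show ?thesis unfolding reduces_to_def using pf by (intro disjI2 exI[of _ P'] exI[of _ R]) (simp add: y eq)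
    next
      case l: False
      have "(of_nat ?p :: 'p mod_ring bpoly) = 0"
        using pconst_of_nat[of ?p, where ?'b = "'p mod_ring", symmetric] by simp
      then have "y = 0" using l by (intro poly_mapping_eqI) (simp add: y eq fract_collapse power_0_left)
      moreover have "\<exists>l>0. has_valuation ?p B B\<^sub>\<nu> B\<^sub>\<eta> x l"
        unfolding has_valuation_def using pf l by (intro exI[of _ "int l"]) auto
      ultimately show ?thesis by (simp add: reduces_to_def)
    qed
  qed
qed

lemma reduces_to_imp_reduction_rel:
  assumes "reduces_to B B\<^sub>\<nu> B\<^sub>\<eta> x (y :: 'p::prime_card mod_ring ratfun cpoly)"
  shows "reduction_rel B B\<^sub>\<nu> B\<^sub>\<eta> x y"
proof -
  let ?p = "CARD('p)" and ?v = "Nu ` B\<^sub>\<nu> \<union> Eta ` B\<^sub>\<eta>" and ?b = "set_encode ` B"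
  have key: "reduction_rel B B\<^sub>\<nu> B\<^sub>\<eta> x y"
    if pf: "pfrac ?p B B\<^sub>\<nu> B\<^sub>\<eta> (int l) P R x"
      and y: "\<And>m. Poly_Mapping.lookup y m = of_nat ?p ^ l *
        Fract (Poly_Mapping.map of_int (Poly_Mapping.lookup P m)) (Poly_Mapping.map of_int R)" for P R l
  proof -
    \<comment> \<open>The power of p is absorbed into the numerator; for l > 0 this makes the F_p
      side zero, as \<open>reduces_to\<close> demands.\<close>
    let ?P = "pconst (of_nat ?p ^ l) * P"
    have PR: "vars_in ?v P" "\<forall>m. vars_in ?b (Poly_Mapping.lookup P m)" "vars_in ?b R"
      "\<exists>n. \<not> int ?p dvd Poly_Mapping.lookup R n"
      "\<And>m. Poly_Mapping.lookup x m = of_nat ?p ^ l *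
        Fract (Poly_Mapping.map of_int (Poly_Mapping.lookup P m)) (Poly_Mapping.map of_int R)"
      using pf by (simp_all add: pfrac_def)
    have R: "Poly_Mapping.map of_int R \<noteq> (0 :: 'p mod_ring bpoly)"
      using PR(4) by (simp add: map_of_int_mod_ring_eq_0_iff)
    have "R \<noteq> 0" using PR(4) by auto
    then have R0: "Poly_Mapping.map of_int R \<noteq> (0 :: rat bpoly)" by (simp add: map_of_int_rat_eq_0_iff)
    have eq: "Poly_Mapping.map of_int (Poly_Mapping.lookup ?P m) = (of_nat ?p ^ l * Poly_Mapping.map of_int (Poly_Mapping.lookup P m) :: 'k::field bpoly)" for m
    proof (rule poly_mapping_eqI)
      fix n
      show "Poly_Mapping.lookup (Poly_Mapping.map of_int (Poly_Mapping.lookup ?P m)) n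
        = Poly_Mapping.lookup (of_nat ?p ^ l * Poly_Mapping.map of_int (Poly_Mapping.lookup P m) :: 'k bpoly) n"
        using lookup_of_nat_mult[of "?p ^ l" "Poly_Mapping.map of_int (Poly_Mapping.lookup P m) :: 'k bpoly" n]
          lookup_of_nat_mult[of "?p ^ l" "Poly_Mapping.lookup P m" n]
        by (simp add: lookup_map lookup_pconst_mult)
    qed
    have "vars_in ?b (pconst (of_nat (?p ^ l)) :: int bpoly)" by (rule vars_in_pconst)
    then have vo: "vars_in ?b (of_nat ?p ^ l :: int bpoly)"
      unfolding pconst_of_nat unfolding of_nat_power .
    have "pconst (frac_of R) * x = frac_poly ?P"
      unfolding scaled_eq_frac_poly_iff[OF R0] by (simp add: PR(5) eq of_nat_power_mult_Fract)
    moreover have "pconst (frac_of R) * y = frac_poly ?P"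
      unfolding scaled_eq_frac_poly_iff[OF R] by (simp add: y eq of_nat_power_mult_Fract)
    moreover have "vars_in ?v ?P" "\<forall>m. vars_in ?b (Poly_Mapping.lookup ?P m)"
      using PR vo by (simp_all add: vars_in_mult lookup_pconst_mult)
    ultimately show ?thesis unfolding reduction_rel_def using R PR(3) by (intro exI[of _ ?P] exI[of _ R]) blast
  qed
  consider "x = 0" "y = 0" | l where "l > 0" "has_valuation ?p B B\<^sub>\<nu> B\<^sub>\<eta> x l" "y = 0"
    | P R where "pfrac ?p B B\<^sub>\<nu> B\<^sub>\<eta> 0 P R x" "\<forall>m. Poly_Mapping.lookup y m =
           Fract (Poly_Mapping.map of_int (Poly_Mapping.lookup P m)) (Poly_Mapping.map of_int R)"
    using assms unfolding reduces_to_def by blast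
  then show ?thesis
  proof cases
    case 1
    then show ?thesis using reduction_rel_zero by simp
  next
    case (2 l)
    then obtain P R where "pfrac ?p B B\<^sub>\<nu> B\<^sub>\<eta> (int (nat l)) P R x" by (auto simp: has_valuation_def)
    moreover have "(of_nat ?p :: 'p mod_ring ratfun) ^ nat l = 0"
    proof -
      have "(of_nat ?p :: 'p mod_ring bpoly) = 0"
        using pconst_of_nat[of ?p, where ?'b = "'p mod_ring", symmetric] by simp
      then have "(of_nat ?p :: 'p mod_ring ratfun) = 0" by (simp add: of_nat_fract fract_collapse)
      then show ?thesis using 2 by simp
    qed
    ultimately show ?thesis using 2 by (intro key[of "nat l" P R]) simp_all
  next
    case (3 P R)
    then show ?thesis by (intro key[of 0 P R]) simp_all
  qed
qed

lemma reduces_to_iff: "reduces_to B B\<^sub>\<nu> B\<^sub>\<eta> x y \<longleftrightarrow> reduction_rel B B\<^sub>\<nu> B\<^sub>\<eta> x y"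
  using reduction_rel_imp_reduces_to reduces_to_imp_reduction_rel by blast

lemma reduction_rel_nonneg_valuation:
  assumes "reduction_rel B B\<^sub>\<nu> B\<^sub>\<eta> x (y :: 'p::prime_card mod_ring ratfun cpoly)"
  shows "nonneg_valuation CARD('p) B B\<^sub>\<nu> B\<^sub>\<eta> x"
proof -
  consider "x = 0" | l where "l > 0" "has_valuation CARD('p) B B\<^sub>\<nu> B\<^sub>\<eta> x l"
    | P R where "pfrac CARD('p) B B\<^sub>\<nu> B\<^sub>\<eta> 0 P R x"
    using reduction_rel_imp_reduces_to[OF assms] unfolding reduces_to_def by blast
  then show ?thesis
  proof cases
    case (2 l)
    then show ?thesis unfolding nonneg_valuation_def by (intro disjI2 exI[of _ l]) simp
  next
    case 3
    then show ?thesis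
      unfolding nonneg_valuation_def has_valuation_def by (intro disjI2 exI[of _ 0]) blast
  qed (simp add: nonneg_valuation_def)
qed

lemma scaled_frac_poly_in_cpolys:
  assumes "vars_in (Nu ` B\<^sub>\<nu> \<union> Eta ` B\<^sub>\<eta>) P" "\<forall>m. vars_in (set_encode ` B) (Poly_Mapping.lookup P m)"
    and "vars_in (set_encode ` B) R" and R: "Poly_Mapping.map of_int R \<noteq> (0 :: 'k::field bpoly)"
    and "pconst (frac_of R) * x = frac_poly P"
  shows "(x :: 'k ratfun cpoly) \<in> cpolys B B\<^sub>\<nu> B\<^sub>\<eta>"
proof -
  have x: "Poly_Mapping.lookup x m = Fract (Poly_Mapping.map of_int (Poly_Mapping.lookup P m)) (Poly_Mapping.map of_int R)" for m
    using assms(5) scaled_eq_frac_poly_iff[OF R] by blast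
  have "Poly_Mapping.keys x \<subseteq> Poly_Mapping.keys P"
  proof
    fix m assume m: "m \<in> Poly_Mapping.keys x"
    show "m \<in> Poly_Mapping.keys P"
    proof (rule ccontr)
      assume "m \<notin> Poly_Mapping.keys P"
      then have "Poly_Mapping.lookup P m = 0" by (simp add: in_keys_iff)
      then have "frac_of R * Poly_Mapping.lookup x m = 0"
        using arg_cong[OF assms(5), of "\<lambda>q. Poly_Mapping.lookup q m"]
        by (simp add: lookup_frac_poly lookup_pconst_mult)
      then show False using m R by (simp add: in_keys_iff frac_of_eq_0_iff)
    qed
  qed
  then have x_vars: "vars_in (Nu ` B\<^sub>\<nu> \<union> Eta ` B\<^sub>\<eta>) x" using assms(1) unfolding vars_in_def by blast
  have "vars_in (set_encode ` B) (Poly_Mapping.map of_int (Poly_Mapping.lookup P m) :: 'k bpoly)" for m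
    by (rule vars_in_map) (use assms(2) in auto)
  moreover have "vars_in (set_encode ` B) (Poly_Mapping.map of_int R :: 'k bpoly)"
    by (rule vars_in_map) (use assms(3) in auto)
  ultimately have "Poly_Mapping.lookup x m \<in> ratfuns B" for m
    unfolding ratfuns_def x using R by blast
  with x_vars show ?thesis unfolding cpolys_def by blast
qed

lemma reduction_rel_in_cpolys:
  assumes "reduction_rel B B\<^sub>\<nu> B\<^sub>\<eta> x (y :: 'p::prime_card mod_ring ratfun cpoly)"
  shows "x \<in> cpolys B B\<^sub>\<nu> B\<^sub>\<eta>" "y \<in> cpolys B B\<^sub>\<nu> B\<^sub>\<eta>"
proof -
  obtain P R where PR: "vars_in (Nu ` B\<^sub>\<nu> \<union> Eta ` B\<^sub>\<eta>) P" "\<forall>m. vars_in (set_encode ` B) (Poly_Mapping.lookup P m)"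
      "vars_in (set_encode ` B) R" "Poly_Mapping.map of_int R \<noteq> (0 :: 'p mod_ring bpoly)"
      "pconst (frac_of R) * x = frac_poly P" "pconst (frac_of R) * y = frac_poly P"
    using assms unfolding reduction_rel_def by blast
  have "R \<noteq> 0" using PR(4) ring_map_on_zero[OF map_ring_map[OF ring_map_on_of_int]] by metis
  then have R0: "Poly_Mapping.map of_int R \<noteq> (0 :: rat bpoly)" by (simp add: map_of_int_rat_eq_0_iff)
  show "x \<in> cpolys B B\<^sub>\<nu> B\<^sub>\<eta>" by (rule scaled_frac_poly_in_cpolys[OF PR(1-3) R0 PR(5)])
  show "y \<in> cpolys B B\<^sub>\<nu> B\<^sub>\<eta>" by (rule scaled_frac_poly_in_cpolys[OF PR(1-4) PR(6)])
qed

text \<open>Reduction can only lose monomials, so homogeneity survives it.\<close>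

lemma reduction_rel_keys:
  assumes "reduction_rel B B\<^sub>\<nu> B\<^sub>\<eta> x (y :: 'p::prime_card mod_ring ratfun cpoly)"
  shows "Poly_Mapping.keys y \<subseteq> Poly_Mapping.keys x"
proof
  fix m assume m: "m \<in> Poly_Mapping.keys y"
  obtain P R where R: "Poly_Mapping.map of_int R \<noteq> (0 :: 'p mod_ring bpoly)"
      and P: "pconst (frac_of R) * x = frac_poly P" "pconst (frac_of R) * y = frac_poly P"
    using assms unfolding reduction_rel_def by blast
  show "m \<in> Poly_Mapping.keys x"
  proof (rule ccontr)
    assume "m \<notin> Poly_Mapping.keys x"
    then have "frac_of (Poly_Mapping.lookup P m) = (0 :: rat ratfun)"
      using arg_cong[OF P(1), of "\<lambda>q. Poly_Mapping.lookup q m"]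
      by (simp add: lookup_frac_poly lookup_pconst_mult in_keys_iff)
    then have "Poly_Mapping.lookup P m = 0" by (simp add: frac_of_eq_0_iff map_of_int_rat_eq_0_iff)
    then have "frac_of R * Poly_Mapping.lookup y m = 0"
      using arg_cong[OF P(2), of "\<lambda>q. Poly_Mapping.lookup q m"]
      by (simp add: lookup_frac_poly lookup_pconst_mult)
    then show False using m R by (simp add: in_keys_iff frac_of_eq_0_iff)
  qed
qed

section \<open>Generic cocycles and the reduced cochain\<close>

lemma ring_map_of_int:
  assumes "ring_map_on UNIV h"
  shows "h (of_int z) = of_int z"
proof -
  define S where "S a b \<longleftrightarrow> b = h a" for a b
  have "ring_rel S" using assms by (simp add: S_def[abs_def] ring_map_on_def)
  from ring_rel_of_int[OF this, of z] show ?thesis by (simp add: S_def)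
qed

lemma ring_map_sum:
  assumes "ring_map_on UNIV h"
  shows "h (sum f A) = (\<Sum>a\<in>A. h (f a))"
  by (induction A rule: infinite_finite_induct)
    (simp_all add: ring_map_zero[OF assms] ring_map_add[OF assms])

definition linear_form :: "nat set set \<Rightarrow> (nat set \<Rightarrow> int) \<Rightarrow> int bpoly" where
  "linear_form B c = (\<Sum>F\<in>B. of_int (c F) * pvar (set_encode F))"

lemma vars_in_linear_form: "vars_in (set_encode ` B) (linear_form B c)"
  unfolding linear_form_def
  by (intro vars_in_sum vars_in_mult vars_in_pvar) (simp_all flip: pconst_of_int)

lemma map_linear_form:
  "Poly_Mapping.map of_int (linear_form B c)
    = (\<Sum>F\<in>B. of_int (c F) * pvar (set_encode F) :: 'k::comm_ring_1 bpoly)"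
proof -
  have h: "ring_map_on UNIV (Poly_Mapping.map of_int :: int bpoly \<Rightarrow> 'k bpoly)"
    by (rule map_ring_map[OF ring_map_on_of_int])
  show ?thesis
    unfolding linear_form_def ring_map_sum[OF h] ring_map_mult[OF h] ring_map_of_int[OF h]
      map_pvar[OF ring_map_on_of_int] ..
qed

lemma frac_of_linear_form: "frac_of (linear_form B c) = (\<Sum>F\<in>B. of_int (c F) * ratvar F)"
  unfolding linear_form_def frac_of_sum frac_of_mult frac_of_of_int frac_of_pvar ..

lemma lookup_pvar_sum:
  fixes a :: "nat set \<Rightarrow> 'k::comm_ring_1"
  assumes B: "finite B" "\<forall>F\<in>B. finite F" and F: "F \<in> B"
  shows "Poly_Mapping.lookup (\<Sum>F\<in>B. pconst (a F) * pvar (set_encode F)) (Poly_Mapping.single (set_encode F) 1) = a F"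
proof -
  have "Poly_Mapping.lookup (pconst (a F') * pvar (set_encode F')) (Poly_Mapping.single (set_encode F) 1)
      = (if F' = F then a F else 0)" if "F' \<in> B" for F'
  proof -
    have "Poly_Mapping.single (set_encode F') (1::nat) = Poly_Mapping.single (set_encode F) 1 \<longleftrightarrow> F' = F"
      using B that F by (metis keys_single set_encode_eq singleton_insert_inj_eq zero_neq_one)
    then show ?thesis by (simp add: lookup_pconst_mult pvar_def lookup_single when_def)
  qed
  then show ?thesis using B F by (simp add: lookup_sum)
qed

text \<open>The denominators of Q are the components of \<omega>; this is what keeps them invertible
  after reduction.\<close>

lemma map_linear_form_nonzero:
  assumes n: "component_matrix V B n" and F: "F \<in> faces 3 V"
  shows "Poly_Mapping.map of_int (linear_form B (n F)) \<noteq> (0 :: 'k::comm_ring_1 bpoly)"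
proof
  assume z: "Poly_Mapping.map of_int (linear_form B (n F)) = (0 :: 'k bpoly)"
  obtain F' where F': "F' \<in> B" "of_int (n F F') \<noteq> (0::'k)"
    by (rule component_matrix_row_nonzero[OF n F])
  have fin: "\<forall>F\<in>B. finite F" using component_matrix_faces[OF n] faces_finite_face by blast
  have "Poly_Mapping.map of_int (linear_form B (n F)) = (\<Sum>F'\<in>B. pconst (of_int (n F F')) * pvar (set_encode F') :: 'k bpoly)"
    unfolding map_linear_form pconst_of_int ..
  then have "of_int (n F F') = (0::'k)"
    using lookup_pvar_sum[OF component_matrix_finite_basis[OF n] fin F'(1), of "\<lambda>F'. of_int (n F F') :: 'k"] z
    by simp
  then show False using F'(2) by contradiction
qed

lemma generic_omega_expand:
  assumes n: "component_matrix V B n" and "generic_omega V B \<omega>" and F: "F \<in> faces 3 V"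
  shows "\<omega> F = frac_of (linear_form B (n F))"
proof -
  have "\<omega> F = (\<Sum>F'\<in>B. of_int (n F F') * \<omega> F')"
    using assms by (intro component_matrix_expand[OF n F]) (simp add: generic_omega_def)
  also have "\<dots> = (\<Sum>F'\<in>B. of_int (n F F') * ratvar F')"
    using assms by (intro sum.cong) (simp_all add: generic_omega_def)
  finally show ?thesis by (simp add: frac_of_linear_form)
qed

lemma generic_component_expand:
  assumes n: "component_matrix V B n" and "cocycle3 V \<nu>" and F: "F \<in> faces 3 V"
    and "\<forall>F\<in>B. \<nu> F = pvar (v F)"
  shows "\<nu> F = (\<Sum>F'\<in>B. of_int (n F F') * pvar (v F'))"
proof -
  have "\<nu> F = (\<Sum>F'\<in>B. of_int (n F F') * \<nu> F')"
    by (rule component_matrix_expand[OF n F assms(2)])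
  also have "\<dots> = (\<Sum>F'\<in>B. of_int (n F F') * pvar (v F'))"
    using assms by (intro sum.cong) simp_all
  finally show ?thesis .
qed

text \<open>Polymorphic in the field, so that the rational instance and the one over F_p are the
  same formula and can be related term by term.\<close>

definition generic_Q :: "nat set set \<Rightarrow> nat set set \<Rightarrow> nat set set \<Rightarrow> (nat set \<Rightarrow> nat set \<Rightarrow> int) \<Rightarrow>
    (nat set \<Rightarrow> nat set \<Rightarrow> int) \<Rightarrow> (nat set \<Rightarrow> nat set \<Rightarrow> int) \<Rightarrow> nat set \<Rightarrow> 'k::field ratfun cpoly" where
  "generic_Q B B\<^sub>\<nu> B\<^sub>\<eta> n n\<^sub>\<nu> n\<^sub>\<eta> =
     Qval (\<lambda>F. frac_of (linear_form B (n F))) (\<lambda>F. \<Sum>F'\<in>B\<^sub>\<nu>. of_int (n\<^sub>\<nu> F F') * pvar (Nu F'))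
       (\<lambda>F. \<Sum>F'\<in>B\<^sub>\<eta>. of_int (n\<^sub>\<eta> F F') * pvar (Eta F'))"

lemma card6_remove2:
  assumes "card V = 6" "v \<in> V" "u \<in> V - {v}"
  shows "V - {v} - {u} \<in> faces 3 V"
proof -
  have "finite V" using assms card_ge_0_finite by force
  then show ?thesis using assms by (auto simp: faces_def card_Diff_singleton)
qed

lemma Qval_eq_generic_Q:
  assumes "component_matrix V B n" "component_matrix V B\<^sub>\<nu> n\<^sub>\<nu>" "component_matrix V B\<^sub>\<eta> n\<^sub>\<eta>"
    and g: "generic_triple V B B\<^sub>\<nu> B\<^sub>\<eta> \<omega> \<nu> \<eta>" and "card V = 6" "v \<in> V"
  shows "Qval \<omega> \<nu> \<eta> (V - {v}) = generic_Q B B\<^sub>\<nu> B\<^sub>\<eta> n n\<^sub>\<nu> n\<^sub>\<eta> (V - {v})"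
  unfolding Qval_def generic_Q_def
proof (rule coboundary_cong)
  fix u assume "u \<in> V - {v}"
  then have F: "V - {v} - {u} \<in> faces 3 V" using assms by (simp add: card6_remove2)
  show "pconst (1 / \<omega> (V - {v} - {u})) * \<nu> (V - {v} - {u}) * \<eta> (V - {v} - {u}) =
     pconst (1 / frac_of (linear_form B (n (V - {v} - {u})))) *
     (\<Sum>F'\<in>B\<^sub>\<nu>. of_int (n\<^sub>\<nu> (V - {v} - {u}) F') * pvar (Nu F')) *
     (\<Sum>F'\<in>B\<^sub>\<eta>. of_int (n\<^sub>\<eta> (V - {v} - {u}) F') * pvar (Eta F'))"
    using g generic_omega_expand[OF assms(1) _ F, of \<omega>]
      generic_component_expand[OF assms(2) _ F, of \<nu> Nu] generic_component_expand[OF assms(3) _ F, of \<eta> Eta]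
    by (simp add: generic_triple_def)
qed

lemma reduction_rel_generic_Q:
  assumes n: "component_matrix V B n"
    and "card V = 6" "v \<in> V"
  shows "reduction_rel B B\<^sub>\<nu> B\<^sub>\<eta> (generic_Q B B\<^sub>\<nu> B\<^sub>\<eta> n n\<^sub>\<nu> n\<^sub>\<eta> (V - {v}))
     (generic_Q B B\<^sub>\<nu> B\<^sub>\<eta> n n\<^sub>\<nu> n\<^sub>\<eta> (V - {v}) :: 'p::prime_card mod_ring ratfun cpoly)"
  unfolding generic_Q_def Qval_def
proof (rule ring_rel_coboundary[OF ring_rel_reduction_rel])
  note S = ring_rel_reduction_rel[of B B\<^sub>\<nu> B\<^sub>\<eta>, where ?'p = 'p]
  fix u assume "u \<in> V - {v}"
  then have F: "V - {v} - {u} \<in> faces 3 V" using assms by (simp add: card6_remove2)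
  show "reduction_rel B B\<^sub>\<nu> B\<^sub>\<eta> (pconst (1 / frac_of (linear_form B (n (V - {v} - {u})))) *
     (\<Sum>F'\<in>B\<^sub>\<nu>. of_int (n\<^sub>\<nu> (V - {v} - {u}) F') * pvar (Nu F')) *
     (\<Sum>F'\<in>B\<^sub>\<eta>. of_int (n\<^sub>\<eta> (V - {v} - {u}) F') * pvar (Eta F')))
     (pconst (1 / frac_of (linear_form B (n (V - {v} - {u})))) *
     (\<Sum>F'\<in>B\<^sub>\<nu>. of_int (n\<^sub>\<nu> (V - {v} - {u}) F') * pvar (Nu F')) *
     (\<Sum>F'\<in>B\<^sub>\<eta>. of_int (n\<^sub>\<eta> (V - {v} - {u}) F') * pvar (Eta F')) :: 'p mod_ring ratfun cpoly)"
    by (intro ring_rel_mult[OF S] ring_rel_sum[OF S] ring_rel_of_int[OF S] reduction_rel_pvar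
        reduction_rel_inverse vars_in_linear_form map_linear_form_nonzero[OF n F]) auto
qed

lemma of_nat_ratfun_nonzero: "p \<noteq> 0 \<Longrightarrow> (of_nat p :: rat ratfun) \<noteq> 0"
  by (simp add: of_nat_fract Zero_fract_def eq_fract)

lemma lifted_eq_frobenius_defect:
  fixes \<omega> :: "nat set \<Rightarrow> rat ratfun"
  assumes p: "prime p" and k: "k \<ge> 1" and V: "finite V"
  shows "lifted p k \<omega> \<nu> \<eta> V = frobenius_defect p k (Qval \<omega> \<nu> \<eta>) V"
proof -
  have p0: "p \<noteq> 0" using p by auto
  have "coboundary (Qval \<omega> \<nu> \<eta>) V = 0"
    using coboundary_coboundary[OF V] by (simp add: Qval_def[abs_def])
  then have "coboundary (\<lambda>D. Qval \<omega> \<nu> \<eta> D ^ (p ^ k)) V = of_nat p * frobenius_defect p k (Qval \<omega> \<nu> \<eta>) V"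
    using p0 by (simp add: of_nat_mult_frobenius_defect[OF p k V] power_0_left)
  then have "lifted p k \<omega> \<nu> \<eta> V = pconst (1 / of_nat p * of_nat p) * frobenius_defect p k (Qval \<omega> \<nu> \<eta>) V"
    unfolding lifted_def pconst_mult pconst_of_nat by (simp only: mult.assoc)
  then show ?thesis using of_nat_ratfun_nonzero[OF p0] by simp
qed

lemma reduction_rel_lifted:
  assumes "component_matrix V B n" "component_matrix V B\<^sub>\<nu> n\<^sub>\<nu>" "component_matrix V B\<^sub>\<eta> n\<^sub>\<eta>"
    and "generic_triple V B B\<^sub>\<nu> B\<^sub>\<eta> \<omega> \<nu> \<eta>" and V: "card V = 6" and k: "k \<ge> 1"
  shows "reduction_rel B B\<^sub>\<nu> B\<^sub>\<eta> (lifted CARD('p) k \<omega> \<nu> \<eta> V)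
     (frobenius_defect CARD('p) k (generic_Q B B\<^sub>\<nu> B\<^sub>\<eta> n n\<^sub>\<nu> n\<^sub>\<eta>) V :: 'p::prime_card mod_ring ratfun cpoly)"
proof -
  have fin: "finite V" using V card_ge_0_finite by force
  have "frobenius_defect CARD('p) k (Qval \<omega> \<nu> \<eta>) V = frobenius_defect CARD('p) k (generic_Q B B\<^sub>\<nu> B\<^sub>\<eta> n n\<^sub>\<nu> n\<^sub>\<eta>) V"
    by (rule frobenius_defect_cong) (rule Qval_eq_generic_Q[OF assms(1-5)])
  then show ?thesis
    unfolding lifted_eq_frobenius_defect[OF prime_card k fin]
    by (simp only:) (rule ring_rel_frobenius_defect[OF ring_rel_reduction_rel fin],
        rule reduction_rel_generic_Q[OF assms(1) V])
qed

text \<open>By uniqueness of reduction c has a closed formula over F_p, from which the rational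
  cocycles have disappeared.\<close>

lemma reduced_cochain_eq:
  assumes c: "reduced_cochain k V B B\<^sub>\<nu> B\<^sub>\<eta> (c :: 'p::prime_card mod_ring ratfun cpoly)"
    and V: "card V = 6" and k: "k \<ge> 1"
  obtains n n\<^sub>\<nu> n\<^sub>\<eta> where "component_matrix V B n" "component_matrix V B\<^sub>\<nu> n\<^sub>\<nu>" "component_matrix V B\<^sub>\<eta> n\<^sub>\<eta>"
    "c = frobenius_defect CARD('p) k (generic_Q B B\<^sub>\<nu> B\<^sub>\<eta> n n\<^sub>\<nu> n\<^sub>\<eta>) V"
proof -
  obtain \<omega> \<nu> \<eta> where g: "generic_triple V B B\<^sub>\<nu> B\<^sub>\<eta> \<omega> \<nu> \<eta>"
    and red: "reduction_rel B B\<^sub>\<nu> B\<^sub>\<eta> (lifted CARD('p) k \<omega> \<nu> \<eta> V) c"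
    using c unfolding reduced_cochain_def reduces_to_iff by blast
  have mi: "max_indep_components TYPE(rat) V B" "max_indep_components TYPE(rat) V B\<^sub>\<nu>"
    "max_indep_components TYPE(rat) V B\<^sub>\<eta>" using g by (auto simp: generic_triple_def)
  obtain n where n: "component_matrix V B n" by (rule component_matrix_exists[OF V mi(1)])
  obtain n\<^sub>\<nu> where n\<^sub>\<nu>: "component_matrix V B\<^sub>\<nu> n\<^sub>\<nu>" by (rule component_matrix_exists[OF V mi(2)])
  obtain n\<^sub>\<eta> where n\<^sub>\<eta>: "component_matrix V B\<^sub>\<eta> n\<^sub>\<eta>" by (rule component_matrix_exists[OF V mi(3)])
  show ?thesis
    using that[OF n n\<^sub>\<nu> n\<^sub>\<eta>] reduction_rel_unique[OF red reduction_rel_lifted[OF n n\<^sub>\<nu> n\<^sub>\<eta> g V k]] by blast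
qed

section \<open>Evaluation at a cocycle\<close>

abbreviation subst_omega :: "(nat set \<Rightarrow> 'a::field ratfun) \<Rightarrow> 'a bpoly \<Rightarrow> 'a ratfun" where
  "subst_omega \<omega> \<equiv> peval ratconst (\<lambda>n. \<omega> (set_decode n))"

lemma ring_map_on_ratconst: "ring_map_on UNIV (ratconst :: 'a::field \<Rightarrow> 'a ratfun)"
  by (rule ring_map_onI) (auto simp: ratconst_def pconst_add pconst_mult One_fract_def)

lemma ring_map_on_subst_omega: "ring_map_on UNIV (subst_omega \<omega>)"
  by (rule peval_ring_map[OF ring_map_on_ratconst])

lemma subst_omega_pvar: "finite F \<Longrightarrow> subst_omega \<omega> (pvar (set_encode F)) = \<omega> F"
  by (simp add: peval_pvar ring_map_zero[OF ring_map_on_ratconst] ring_map_one[OF ring_map_on_ratconst])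

lemma ratval_Fract:
  assumes g: "subst_omega \<omega> g \<noteq> 0"
  shows "ratval \<omega> (Fract f g) = subst_omega \<omega> f / subst_omega \<omega> g"
  unfolding ratval_def Let_def
proof (rule the_equality)
  show "\<exists>f' g'. Fract f g = Fract f' g' \<and> subst_omega \<omega> g' \<noteq> 0 \<and> subst_omega \<omega> f / subst_omega \<omega> g = subst_omega \<omega> f' / subst_omega \<omega> g'"
    using g by blast
  fix z assume "\<exists>f' g'. Fract f g = Fract f' g' \<and> subst_omega \<omega> g' \<noteq> 0 \<and> z = subst_omega \<omega> f' / subst_omega \<omega> g'"
  then obtain f' g' where *: "Fract f g = Fract f' g'" "subst_omega \<omega> g' \<noteq> 0" "z = subst_omega \<omega> f' / subst_omega \<omega> g'"
    by blast
  have "g \<noteq> 0" "g' \<noteq> 0" using g *(2) by auto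
  then have "f * g' = f' * g" using *(1) by (simp add: eq_fract)
  then have "subst_omega \<omega> f * subst_omega \<omega> g' = subst_omega \<omega> f' * subst_omega \<omega> g"
    by (metis ring_map_mult[OF ring_map_on_subst_omega])
  then show "z = subst_omega \<omega> f / subst_omega \<omega> g" using *(2,3) g by (simp add: frac_eq_eq)
qed

text \<open>The localisation at the kernel of the substitution. It matters because \<omega> may be
  special, as in the nonvanishing witness.\<close>

definition ratval_domain :: "(nat set \<Rightarrow> 'a::field ratfun) \<Rightarrow> 'a ratfun set" where
  "ratval_domain \<omega> = {Fract f g | f g. subst_omega \<omega> g \<noteq> 0}"

lemma ring_map_on_ratval: "ring_map_on (ratval_domain \<omega>) (ratval \<omega>)"
proof (rule ring_map_onI)
  note ev = ring_map_on_subst_omega[of \<omega>]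
  have ev1: "subst_omega \<omega> 1 = 1" by (rule ring_map_one[OF ev])
  show "0 \<in> ratval_domain \<omega>" unfolding ratval_domain_def mem_Collect_eq
    by (intro exI[of _ 0] exI[of _ 1] conjI Zero_fract_def) (simp add: ev1)
  show "1 \<in> ratval_domain \<omega>" unfolding ratval_domain_def mem_Collect_eq
    by (intro exI[of _ 1] conjI One_fract_def) (simp add: ev1)
  show "ratval \<omega> 1 = 1" using ratval_Fract[of \<omega> 1 1] ev1 by (simp add: One_fract_def[symmetric])
  fix a assume "a \<in> ratval_domain \<omega>"
  then obtain f g where a: "a = Fract f g" "subst_omega \<omega> g \<noteq> 0" by (auto simp: ratval_domain_def)
  then show "- a \<in> ratval_domain \<omega>" by (auto simp: ratval_domain_def)
  fix b assume "b \<in> ratval_domain \<omega>"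
  then obtain f' g' where b: "b = Fract f' g'" "subst_omega \<omega> g' \<noteq> 0" by (auto simp: ratval_domain_def)
  have gg: "subst_omega \<omega> (g * g') \<noteq> 0" using a b by (simp add: ring_map_mult[OF ev])
  have "g \<noteq> 0" "g' \<noteq> 0" using a b by auto
  then have ab: "a + b = Fract (f * g' + f' * g) (g * g')" "a * b = Fract (f * f') (g * g')"
    using a b by simp_all
  then show "a + b \<in> ratval_domain \<omega>" "a * b \<in> ratval_domain \<omega>"
    using gg by (auto simp: ratval_domain_def)
  show "ratval \<omega> (a + b) = ratval \<omega> a + ratval \<omega> b" "ratval \<omega> (a * b) = ratval \<omega> a * ratval \<omega> b"
    unfolding ab unfolding a(1) b(1) ratval_Fract[OF gg] ratval_Fract[OF a(2)] ratval_Fract[OF b(2)]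
    using a(2) b(2) by (simp_all add: ring_map_mult[OF ev] ring_map_add[OF ev] add_frac_eq)
qed

definition field_Q :: "(nat set \<Rightarrow> 'c::field) \<Rightarrow> (nat set \<Rightarrow> 'c) \<Rightarrow> (nat set \<Rightarrow> 'c) \<Rightarrow> nat set \<Rightarrow> 'c" where
  "field_Q \<omega> \<nu> \<eta> = coboundary (\<lambda>F. \<nu> F * \<eta> F / \<omega> F)"

lemma subst_omega_linear_form:
  assumes n: "component_matrix V B n" and F: "F \<in> faces 3 V" and \<omega>: "cocycle3 V \<omega>"
  shows "subst_omega \<omega> (Poly_Mapping.map of_int (linear_form B (n F))) = \<omega> F"
proof -
  note ev = ring_map_on_subst_omega[of \<omega>]
  have "subst_omega \<omega> (Poly_Mapping.map of_int (linear_form B (n F))) = (\<Sum>F'\<in>B. of_int (n F F') * \<omega> F')"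
    unfolding map_linear_form ring_map_sum[OF ev] ring_map_mult[OF ev] ring_map_of_int[OF ev]
    by (intro sum.cong refl arg_cong2[of _ _ _ _ "(*)"] subst_omega_pvar)
      (use component_matrix_faces[OF n] faces_finite_face in blast)
  then show ?thesis using component_matrix_expand[OF n F \<omega>] by simp
qed

text \<open>Substitution commutes with the ring operations that build c, so evaluating the
  polynomial amounts to forming the defect from the actual cocycles. Since components of \<omega>
  are denominators, \<open>nz\<close> keeps the substitution defined.\<close>

lemma cval_reduced_cochain:
  fixes c :: "'p::prime_card mod_ring ratfun cpoly"
  assumes c: "reduced_cochain k V B B\<^sub>\<nu> B\<^sub>\<eta> c" and V: "card V = 6" and k: "k \<ge> 1"
    and \<omega>: "cocycle3 V \<omega>" and \<nu>: "cocycle3 V \<nu>" and \<eta>: "cocycle3 V \<eta>"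
    and nz: "\<And>F. F \<in> faces 3 V \<Longrightarrow> \<omega> F \<noteq> 0"
  shows "cval \<omega> c \<nu> \<eta> = frobenius_defect CARD('p) k (field_Q \<omega> \<nu> \<eta>) V"
proof -
  obtain n n\<^sub>\<nu> n\<^sub>\<eta> where n: "component_matrix V B n" and n\<^sub>\<nu>: "component_matrix V B\<^sub>\<nu> n\<^sub>\<nu>"
    and n\<^sub>\<eta>: "component_matrix V B\<^sub>\<eta> n\<^sub>\<eta>"
    and c_eq: "c = frobenius_defect CARD('p) k (generic_Q B B\<^sub>\<nu> B\<^sub>\<eta> n n\<^sub>\<nu> n\<^sub>\<eta>) V"
    by (rule reduced_cochain_eq[OF c V k])
  have fin: "finite V" using V card_ge_0_finite by force
  let ?x = "\<lambda>v. case v of Nu F \<Rightarrow> \<nu> F | Eta F \<Rightarrow> \<eta> F"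
  \<comment> \<open>Evaluation as a relation; the first conjunct keeps all coefficients inside the
    domain of \<open>ratval \<omega>\<close>.\<close>
  define S where "S = (\<lambda>a b. a \<in> {f. \<forall>m. Poly_Mapping.lookup f m \<in> ratval_domain \<omega>} \<and> b = peval (ratval \<omega>) ?x a)"
  note r = ring_map_on_ratval[of \<omega>]
  have S: "ring_rel S" using peval_ring_map_on[OF r] by (simp add: S_def ring_map_on_def)
  have r0: "ratval \<omega> 0 = 0" "0 \<in> ratval_domain \<omega>" and r1: "ratval \<omega> 1 = 1" "1 \<in> ratval_domain \<omega>"
    using ring_map_on_zero[OF r] ring_map_on_one[OF r] by auto
  have S_const: "S (pconst q) (ratval \<omega> q)" if "q \<in> ratval_domain \<omega>" for q
    using that r0 by (auto simp: S_def peval_pconst) (simp add: pconst_def lookup_single when_def)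
  have S_var: "S (pvar v) (?x v)" for v
    using r0 r1 by (auto simp: S_def peval_pvar) (simp add: pvar_def lookup_single when_def)
  have Q: "S (generic_Q B B\<^sub>\<nu> B\<^sub>\<eta> n n\<^sub>\<nu> n\<^sub>\<eta> (V - {v})) (field_Q \<omega> \<nu> \<eta> (V - {v}))" if "v \<in> V" for v
    unfolding generic_Q_def field_Q_def Qval_def
  proof (rule ring_rel_coboundary[OF S])
    fix u assume "u \<in> V - {v}"
    then have F: "V - {v} - {u} \<in> faces 3 V" (is "?F \<in> _") using V that by (simp add: card6_remove2)
    have ev: "subst_omega \<omega> (Poly_Mapping.map of_int (linear_form B (n ?F))) = \<omega> ?F"
      by (rule subst_omega_linear_form[OF n F \<omega>])
    then have nz': "subst_omega \<omega> (Poly_Mapping.map of_int (linear_form B (n ?F))) \<noteq> 0" using nz[OF F] by simp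
    have q: "1 / frac_of (linear_form B (n ?F)) = Fract 1 (Poly_Mapping.map of_int (linear_form B (n ?F)))"
      by (simp add: frac_of_def One_fract_def)
    have "S (pconst (1 / frac_of (linear_form B (n ?F)))) (ratval \<omega> (1 / frac_of (linear_form B (n ?F))))"
      by (rule S_const) (use nz' in \<open>auto simp: q ratval_domain_def\<close>)
    then have 1: "S (pconst (1 / frac_of (linear_form B (n ?F)))) (1 / \<omega> ?F)"
      unfolding q ratval_Fract[OF nz'] ev ring_map_one[OF ring_map_on_subst_omega] .
    have 2: "S (\<Sum>F'\<in>B\<^sub>\<nu>. of_int (n\<^sub>\<nu> ?F F') * pvar (Nu F')) (\<nu> ?F)"
    proof -
      have "S (\<Sum>F'\<in>B\<^sub>\<nu>. of_int (n\<^sub>\<nu> ?F F') * pvar (Nu F')) (\<Sum>F'\<in>B\<^sub>\<nu>. of_int (n\<^sub>\<nu> ?F F') * ?x (Nu F'))"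
        by (intro ring_rel_sum[OF S] ring_rel_mult[OF S] ring_rel_of_int[OF S] S_var)
      then show ?thesis using component_matrix_expand[OF n\<^sub>\<nu> F \<nu>] by simp
    qed
    have 3: "S (\<Sum>F'\<in>B\<^sub>\<eta>. of_int (n\<^sub>\<eta> ?F F') * pvar (Eta F')) (\<eta> ?F)"
    proof -
      have "S (\<Sum>F'\<in>B\<^sub>\<eta>. of_int (n\<^sub>\<eta> ?F F') * pvar (Eta F')) (\<Sum>F'\<in>B\<^sub>\<eta>. of_int (n\<^sub>\<eta> ?F F') * ?x (Eta F'))"
        by (intro ring_rel_sum[OF S] ring_rel_mult[OF S] ring_rel_of_int[OF S] S_var)
      then show ?thesis using component_matrix_expand[OF n\<^sub>\<eta> F \<eta>] by simp
    qed
    have "S (pconst (1 / frac_of (linear_form B (n ?F))) * (\<Sum>F'\<in>B\<^sub>\<nu>. of_int (n\<^sub>\<nu> ?F F') * pvar (Nu F')) *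
        (\<Sum>F'\<in>B\<^sub>\<eta>. of_int (n\<^sub>\<eta> ?F F') * pvar (Eta F'))) (1 / \<omega> ?F * \<nu> ?F * \<eta> ?F)"
      by (intro ring_rel_mult[OF S] 1 2 3)
    then show "S (pconst (1 / frac_of (linear_form B (n ?F))) * (\<Sum>F'\<in>B\<^sub>\<nu>. of_int (n\<^sub>\<nu> ?F F') * pvar (Nu F')) *
        (\<Sum>F'\<in>B\<^sub>\<eta>. of_int (n\<^sub>\<eta> ?F F') * pvar (Eta F'))) (\<nu> ?F * \<eta> ?F / \<omega> ?F)"
      by simp
  qed
  have "S c (frobenius_defect CARD('p) k (field_Q \<omega> \<nu> \<eta>) V)"
    unfolding c_eq by (rule ring_rel_frobenius_defect[OF S fin]) (rule Q)
  then show ?thesis by (simp add: S_def cval_def)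
qed

text \<open>Serves the 6-simplex, while the integer matrices above are constructed for six vertices.
  If the component at F vanished, its dependence on B would become a relation between distinct
  indeterminates; their coefficients would vanish, and F would be zero on every cocycle.\<close>

lemma generic_omega_nonzero:
  fixes \<omega> :: "nat set \<Rightarrow> 'k::field ratfun"
  assumes W: "finite W" and B: "max_indep_components TYPE('k) W B" and \<omega>: "generic_omega W B \<omega>"
    and F: "F \<in> faces 3 W"
  shows "\<omega> F \<noteq> 0"
proof (cases "F \<in> B")
  case True
  have "pvar (set_encode F) \<noteq> (0 :: 'k bpoly)"
    by (simp add: pvar_def single_zero[symmetric] del: single_zero)
      (metis lookup_single_eq lookup_zero zero_neq_one)
  then show ?thesis using True \<omega> by (simp add: generic_omega_def ratvar_def Zero_fract_def eq_fract)
next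
  case False
  have sub: "B \<subseteq> faces 3 W" using B by (simp add: max_indep_components_def indep_components_def)
  have finB: "finite B" using sub finite_faces[OF W] finite_subset by blast
  show ?thesis
  proof
    assume z: "\<omega> F = 0"
    obtain a :: "nat set \<Rightarrow> 'k" where aF: "a F \<noteq> 0"
      and a: "\<And>\<nu>. cocycle3 W \<nu> \<Longrightarrow> (\<Sum>F'\<in>insert F B. a F' * \<nu> F') = 0"
      using max_indep_components_dependent[OF B W F False] by blast
    have "(\<Sum>F'\<in>insert F B. ratconst (a F') * \<omega> F') = 0"
      by (rule cocycle3_relation_lift[OF ring_map_on_ratconst W _ a])
        (use sub F \<omega> in \<open>auto simp: generic_omega_def\<close>)
    then have "(\<Sum>F'\<in>B. ratconst (a F') * ratvar F') = 0"
      using finB False z \<omega> by (simp add: generic_omega_def)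
    moreover have "(\<Sum>F'\<in>B. ratconst (a F') * ratvar F') = Fract (\<Sum>F'\<in>B. pconst (a F') * pvar (set_encode F')) 1"
    proof -
      have "(\<Sum>F'\<in>C. ratconst (a F') * ratvar F') = Fract (\<Sum>F'\<in>C. pconst (a F') * pvar (set_encode F')) 1" if "finite C" for C
        using that by induction (auto simp: ratconst_def ratvar_def Zero_fract_def)
      then show ?thesis using finB by blast
    qed
    ultimately have "(\<Sum>F'\<in>B. pconst (a F') * pvar (set_encode F')) = (0 :: 'k bpoly)"
      by (simp add: Zero_fract_def eq_fract)
    moreover have "\<forall>F\<in>B. finite F" using sub faces_finite_face by blast
    ultimately have "a F' = 0" if "F' \<in> B" for F'
      using lookup_pvar_sum[OF finB _ that, of a] by simp
    then have aF0: "a F * \<nu> F = 0" if "cocycle3 W \<nu>" for \<nu>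
      using a[OF that] finB False by simp
    have "\<nu> F = 0" if "cocycle3 W \<nu>" for \<nu> :: "nat set \<Rightarrow> 'k" using aF0[OF that] aF by simp
    moreover obtain T where "coboundary (face_indicator T) F \<noteq> (0::'k)"
      using cocycle3_nonzero_component[OF F] .
    ultimately show False using cocycle3_coboundary by blast
  qed
qed

section \<open>Homogeneity\<close>

definition monomial_degree :: "'v set \<Rightarrow> ('v \<Rightarrow>\<^sub>0 nat) \<Rightarrow> nat" where
  "monomial_degree S m = (\<Sum>v\<in>Poly_Mapping.keys m \<inter> S. Poly_Mapping.lookup m v)"

definition homogeneous :: "'v set \<Rightarrow> nat \<Rightarrow> (('v \<Rightarrow>\<^sub>0 nat) \<Rightarrow>\<^sub>0 'a::zero) \<Rightarrow> bool" where
  "homogeneous S d x \<longleftrightarrow> (\<forall>m\<in>Poly_Mapping.keys x. monomial_degree S m = d)"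

lemma monomial_degree_add: "monomial_degree S (m + n) = monomial_degree S m + monomial_degree S n"
proof -
  let ?A = "(Poly_Mapping.keys m \<union> Poly_Mapping.keys n) \<inter> S"
  have "monomial_degree S k = (\<Sum>v\<in>?A. Poly_Mapping.lookup k v)" if "k \<in> {m, n, m + n}" for k
    unfolding monomial_degree_def
    by (rule sum.mono_neutral_left) (use that keys_add[of m n] in \<open>auto simp: in_keys_iff\<close>)
  then show ?thesis by (simp add: lookup_add sum.distrib)
qed

lemma homogeneous_zero [simp]: "homogeneous S d 0"
  by (simp add: homogeneous_def)

lemma homogeneous_add: "homogeneous S d x \<Longrightarrow> homogeneous S d y \<Longrightarrow> homogeneous S d (x + y)"
  using keys_add[of x y] by (auto simp: homogeneous_def)

lemma homogeneous_sum: "(\<And>a. a \<in> A \<Longrightarrow> homogeneous S d (f a)) \<Longrightarrow> homogeneous S d (sum f A)"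
  by (induction A rule: infinite_finite_induct) (auto intro: homogeneous_add)

lemma homogeneous_mult:
  fixes x y :: "('v \<Rightarrow>\<^sub>0 nat) \<Rightarrow>\<^sub>0 'a::comm_ring_1"
  assumes "homogeneous S d x" "homogeneous S e y"
  shows "homogeneous S (d + e) (x * y)"
  unfolding homogeneous_def
proof
  fix k assume "k \<in> Poly_Mapping.keys (x * y)"
  then obtain m n where "k = m + n" "m \<in> Poly_Mapping.keys x" "n \<in> Poly_Mapping.keys y"
    using keys_mult[of x y] by blast
  then show "monomial_degree S k = d + e" using assms by (simp add: homogeneous_def monomial_degree_add)
qed

lemma homogeneous_pconst: "homogeneous S 0 (pconst a)"
  by (simp add: homogeneous_def pconst_def monomial_degree_def)

lemma homogeneous_pvar:
  "homogeneous S (if v \<in> S then 1 else 0) (pvar v :: ('v \<Rightarrow>\<^sub>0 nat) \<Rightarrow>\<^sub>0 'a::comm_ring_1)"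
  by (auto simp: homogeneous_def pvar_def monomial_degree_def)

lemma homogeneous_power:
  fixes x :: "('v \<Rightarrow>\<^sub>0 nat) \<Rightarrow>\<^sub>0 'a::comm_ring_1"
  assumes "homogeneous S d x"
  shows "homogeneous S (n * d) (x ^ n)"
proof (induction n)
  case 0
  then show ?case using homogeneous_pconst[of S 1] by simp
next
  case (Suc n)
  then show ?case using homogeneous_mult[OF assms Suc] by simp
qed

lemma homogeneous_coboundary:
  fixes x :: "nat set \<Rightarrow> ('v \<Rightarrow>\<^sub>0 nat) \<Rightarrow>\<^sub>0 'a::comm_ring_1"
  assumes "\<And>v. v \<in> V \<Longrightarrow> homogeneous S d (x (V - {v}))"
  shows "homogeneous S d (coboundary x V)"
  unfolding coboundary_def
proof (rule homogeneous_sum)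
  fix v assume "v \<in> V"
  have "homogeneous S 0 ((- 1) ^ card {u \<in> V. u < v} :: ('v \<Rightarrow>\<^sub>0 nat) \<Rightarrow>\<^sub>0 'a)"
    using homogeneous_pconst[of S "1 :: 'a"] homogeneous_pconst[of S "- 1 :: 'a"]
    by (cases "even (card {u \<in> V. u < v})") (simp_all add: pconst_def single_uminus)
  from homogeneous_mult[OF this assms[OF \<open>v \<in> V\<close>]]
  show "homogeneous S d ((- 1) ^ card {u \<in> V. u < v} * x (V - {v}))" by simp
qed

text \<open>The boolean \<open>r\<close> tells whether S counts the variables in question, so that
  one lemma yields degree 1 in one group of variables and degree 0 in the other.\<close>

lemma homogeneous_generic_component:
  "homogeneous S (if r then 1 else 0) (\<Sum>F'\<in>B. of_int (n F') * pvar (v F') :: ('v \<Rightarrow>\<^sub>0 nat) \<Rightarrow>\<^sub>0 'a::comm_ring_1)"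
  if "\<And>F. v F \<in> S \<longleftrightarrow> r"
proof (rule homogeneous_sum)
  fix F' assume "F' \<in> B"
  show "homogeneous S (if r then 1 else 0) (of_int (n F') * pvar (v F') :: ('v \<Rightarrow>\<^sub>0 nat) \<Rightarrow>\<^sub>0 'a)"
    using homogeneous_mult[OF homogeneous_pconst[of S "of_int (n F') :: 'a"] homogeneous_pvar[of S "v F'", where ?'a = 'a]]
    unfolding that pconst_of_int add_0 .
qed

lemma homogeneous_generic_Q:
  "homogeneous (range Nu) 1 (generic_Q B B\<^sub>\<nu> B\<^sub>\<eta> n n\<^sub>\<nu> n\<^sub>\<eta> D :: 'a::field ratfun cpoly)"
  "homogeneous (range Eta) 1 (generic_Q B B\<^sub>\<nu> B\<^sub>\<eta> n n\<^sub>\<nu> n\<^sub>\<eta> D :: 'a ratfun cpoly)"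
proof -
  have *: "homogeneous S 1 (generic_Q B B\<^sub>\<nu> B\<^sub>\<eta> n n\<^sub>\<nu> n\<^sub>\<eta> D :: 'a ratfun cpoly)"
    if "\<And>F. Nu F \<in> S \<longleftrightarrow> r" "\<And>F. Eta F \<in> S \<longleftrightarrow> \<not> r" for S r
    unfolding generic_Q_def Qval_def
  proof (rule homogeneous_coboundary)
    fix F
    have "homogeneous S ((0 + (if r then 1 else 0)) + (if \<not> r then 1 else 0))
        (pconst (1 / frac_of (linear_form B (n (D - {F})))) *
        (\<Sum>F'\<in>B\<^sub>\<nu>. of_int (n\<^sub>\<nu> (D - {F}) F') * pvar (Nu F')) *
        (\<Sum>F'\<in>B\<^sub>\<eta>. of_int (n\<^sub>\<eta> (D - {F}) F') * pvar (Eta F')) :: 'a ratfun cpoly)"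
      by (intro homogeneous_mult homogeneous_pconst homogeneous_generic_component that)
    moreover have "(0 + (if r then 1 else 0)) + (if \<not> r then 1 else 0) = (1::nat)" by simp
    ultimately show "homogeneous S 1 (pconst (1 / frac_of (linear_form B (n (D - {F})))) *
        (\<Sum>F'\<in>B\<^sub>\<nu>. of_int (n\<^sub>\<nu> (D - {F}) F') * pvar (Nu F')) *
        (\<Sum>F'\<in>B\<^sub>\<eta>. of_int (n\<^sub>\<eta> (D - {F}) F') * pvar (Eta F')) :: 'a ratfun cpoly)"
      by (simp only:)
  qed
  show "homogeneous (range Nu) 1 (generic_Q B B\<^sub>\<nu> B\<^sub>\<eta> n n\<^sub>\<nu> n\<^sub>\<eta> D :: 'a ratfun cpoly)"
    by (rule *[of _ True]) auto
  show "homogeneous (range Eta) 1 (generic_Q B B\<^sub>\<nu> B\<^sub>\<eta> n n\<^sub>\<nu> n\<^sub>\<eta> D :: 'a ratfun cpoly)"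
    by (rule *[of _ False]) auto
qed

lemma homogeneous_lifted:
  assumes "component_matrix V B n" "component_matrix V B\<^sub>\<nu> n\<^sub>\<nu>" "component_matrix V B\<^sub>\<eta> n\<^sub>\<eta>"
    and "generic_triple V B B\<^sub>\<nu> B\<^sub>\<eta> \<omega> \<nu> \<eta>" and V: "card V = 6"
    and S: "S = range Nu \<or> S = range Eta"
  shows "homogeneous S (p ^ k) (lifted p k \<omega> \<nu> \<eta> V)"
proof -
  have "homogeneous S (p ^ k * 1) (Qval \<omega> \<nu> \<eta> (V - {v}) ^ (p ^ k))" if "v \<in> V" for v
    unfolding Qval_eq_generic_Q[OF assms(1-5) that]
    using S homogeneous_generic_Q by (intro homogeneous_power) blast
  then have "homogeneous S (p ^ k) (coboundary (\<lambda>D. Qval \<omega> \<nu> \<eta> D ^ (p ^ k)) V)"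
    by (intro homogeneous_coboundary) simp
  from homogeneous_mult[OF homogeneous_pconst this] show ?thesis by (simp add: lifted_def)
qed

lemma degree_in_homogeneous:
  assumes "homogeneous S d x" "x \<noteq> 0"
  shows "degree_in S x = d"
proof -
  have "(\<lambda>m. \<Sum>v\<in>Poly_Mapping.keys m \<inter> S. Poly_Mapping.lookup m v) ` Poly_Mapping.keys x = (\<lambda>m. d) ` Poly_Mapping.keys x"
    using assms by (intro image_cong) (auto simp: homogeneous_def monomial_degree_def)
  also have "\<dots> = {d}" using assms(2) by (simp add: image_constant_conv)
  finally have "(\<lambda>m. \<Sum>v\<in>Poly_Mapping.keys m \<inter> S. Poly_Mapping.lookup m v) ` Poly_Mapping.keys x = {d}" .
  then show ?thesis by (simp add: degree_in_def)
qed

section \<open>The reduced cochain does not vanish\<close>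

text \<open>With q = p^k, \<open>i * (q choose i) = q * (q - 1 choose (i - 1))\<close>; were p
  coprime to the binomial coefficient, q would divide the smaller number i.\<close>

lemma prime_dvd_choose_prime_power:
  assumes p: "prime p" and i: "0 < i" "i < p ^ k"
  shows "p dvd (p ^ k choose i)"
proof (rule ccontr)
  assume "\<not> p dvd (p ^ k choose i)"
  then have "coprime (p ^ k) (p ^ k choose i)"
    using p by (simp add: prime_imp_coprime)
  moreover have "p ^ k dvd i * (p ^ k choose i)"
    using times_binomial_minus1_eq[OF i(1), of "p ^ k"] by simp
  ultimately have "p ^ k dvd i" by (simp add: coprime_dvd_mult_left_iff)
  then show False using i dvd_imp_le by fastforce
qed

text \<open>By Pascal's rule neighbouring entries of the row \<open>p ^ k - 1\<close> add up to a
  multiple of p, and the row starts with 1.\<close>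

lemma prime_not_dvd_choose_pred_prime_power:
  assumes p: "prime p"
  shows "i < p ^ k \<Longrightarrow> \<not> p dvd (p ^ k - 1 choose i)"
proof (induction i)
  case 0
  then show ?case using p by auto
next
  case (Suc i)
  have "p dvd (p ^ k choose Suc i)" using prime_dvd_choose_prime_power[OF p _ Suc.prems] by simp
  moreover have "(p ^ k choose Suc i) = (p ^ k - 1 choose i) + (p ^ k - 1 choose Suc i)"
  proof -
    have "Suc (p ^ k - 1) = p ^ k" using Suc.prems by linarith
    then show ?thesis using binomial_Suc_Suc[of "p ^ k - 1" i] by simp
  qed
  moreover have "\<not> p dvd (p ^ k - 1 choose i)" using Suc by simp
  ultimately show ?case by (metis dvd_add_left_iff)
qed

text \<open>The row number divided by the index is exactly p, so the coefficient is p times an entry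
  of the row \<open>p ^ Suc k - 1\<close>.\<close>

lemma prime_square_not_dvd_choose:
  assumes p: "prime p"
  shows "\<not> p * p dvd (p ^ Suc k choose p ^ k)"
proof
  have p0: "p > 0" using p by (rule prime_gt_0_nat)
  then have j: "p ^ k > 0" by simp
  have "p ^ k * (p ^ Suc k choose p ^ k) = p ^ Suc k * (p ^ Suc k - 1 choose (p ^ k - 1))"
    by (rule times_binomial_minus1_eq[OF j])
  also have "\<dots> = p ^ k * (p * (p ^ Suc k - 1 choose (p ^ k - 1)))"
    by (simp only: power_Suc mult_ac)
  finally have eq: "(p ^ Suc k choose p ^ k) = p * (p ^ Suc k - 1 choose (p ^ k - 1))"
    using j by (metis mult_left_cancel less_irrefl)
  have "p ^ k \<le> p ^ Suc k" using p0 by simp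
  then have lt: "p ^ k - 1 < p ^ Suc k" using j by linarith
  assume "p * p dvd (p ^ Suc k choose p ^ k)"
  then have "p dvd (p ^ Suc k - 1 choose (p ^ k - 1))" unfolding eq using p by auto
  then show False using prime_not_dvd_choose_pred_prime_power[OF p lt] by contradiction
qed

lemma single_1_eq_iff: "Poly_Mapping.single i (1::nat) = Poly_Mapping.single j 1 \<longleftrightarrow> i = j"
  by (metis lookup_single_eq lookup_single_not_eq zero_neq_one)

lemma single_nonzero: "n \<noteq> 0 \<Longrightarrow> Poly_Mapping.single i n \<noteq> 0"
  by (metis lookup_single_eq lookup_zero)

text \<open>The polynomial is p times the defect of the witness below. For 0 < j < q its outer terms
  have other exponents, so only the binomial expansion contributes.\<close>

lemma lookup_witness_polynomial:
  fixes X :: "int bpoly"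
  assumes X: "X = pvar i" and j: "0 < j" "j < q"
  shows "Poly_Mapping.lookup (- ((X ^ 2) ^ q) + (X ^ 2 - 1) ^ q - (- 1) ^ q) (Poly_Mapping.single i (2 * j))
    = (- 1) ^ (q - j) * int (q choose j)"
proof -
  let ?s = "Poly_Mapping.single i (2 * j)"
  have l: "Poly_Mapping.lookup (X ^ n) ?s = (if n = 2 * j then 1 else 0)" for n
  proof -
    have "Poly_Mapping.single i n = ?s \<longleftrightarrow> n = 2 * j" by (metis lookup_single_eq)
    then show ?thesis unfolding X pvar_power lookup_single when_def eq_commute[of _ ?s] by auto
  qed
  have m1: "(- 1) ^ n = (pconst ((- 1) ^ n) :: int bpoly)" for n
    by (cases "even n") (simp_all add: pconst_def single_uminus)
  have o: "of_nat n = (pconst (int n) :: int bpoly)" for n by simp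
  have "(X ^ 2 - 1) ^ q = (\<Sum>n\<le>q. of_nat (q choose n) * (X ^ 2) ^ n * (- 1) ^ (q - n))"
    using binomial_ring[of "X ^ 2" "- 1" q] by simp
  also have "\<dots> = (\<Sum>n\<le>q. pconst (int (q choose n) * (- 1) ^ (q - n)) * X ^ (2 * n))"
    unfolding power_mult by (intro sum.cong refl) (simp only: m1 o pconst_mult mult_ac)
  finally have "Poly_Mapping.lookup ((X ^ 2 - 1) ^ q) ?s
      = (\<Sum>n\<le>q. if n = j then int (q choose j) * (- 1) ^ (q - j) else 0)"
    by (simp add: lookup_sum lookup_pconst_mult l if_distrib cong: if_cong)
  then have "Poly_Mapping.lookup ((X ^ 2 - 1) ^ q) ?s = int (q choose j) * (- 1) ^ (q - j)"
    using j by simp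
  moreover have "Poly_Mapping.lookup ((X ^ 2) ^ q) ?s = 0"
    using j l[of "2 * q"] by (simp add: power_mult)
  moreover have "Poly_Mapping.lookup ((- 1) ^ q :: int bpoly) ?s = 0"
  proof -
    have "?s \<noteq> 0" using j by (intro single_nonzero) simp
    then show ?thesis unfolding m1 by (simp add: pconst_def lookup_single when_def)
  qed
  ultimately show ?thesis by (simp add: lookup_add lookup_minus mult.commute)
qed

lemma remove2_eq_iff:
  assumes "v \<in> V" "u \<in> V" "v' \<in> V" "u' \<in> V"
  shows "V - {v} - {u} = V - {v'} - {u'} \<longleftrightarrow> {v, u} = {v', u'}"
proof -
  have "V - (V - {v} - {u}) = {v, u}" "V - (V - {v'} - {u'}) = {v', u'}" using assms by auto
  moreover have "V - {v} - {u} = V - {v, u}" "V - {v'} - {u'} = V - {v', u'}" by auto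
  ultimately show ?thesis by metis
qed

text \<open>Naming the vertices in order turns signs and equalities of faces into finite
  computations.\<close>

locale six_vertices =
  fixes V :: "nat set" and a b c x y z :: nat
  assumes V: "V = {a, b, c, x, y, z}"
    and ord: "a < b" "b < c" "c < x" "x < y" "y < z"
begin

lemma fin: "finite V" using V by simp

lemma card_V: "card V = 6" unfolding V using ord by simp

lemma in_V: "a \<in> V" "b \<in> V" "c \<in> V" "x \<in> V" "y \<in> V" "z \<in> V" using V by auto

lemma distinct_V: "a \<noteq> b" "a \<noteq> c" "a \<noteq> x" "a \<noteq> y" "a \<noteq> z" "b \<noteq> c" "b \<noteq> x" "b \<noteq> y" "b \<noteq> z"
  "c \<noteq> x" "c \<noteq> y" "c \<noteq> z" "x \<noteq> y" "x \<noteq> z" "y \<noteq> z" using ord by auto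

lemma min_V: "u \<in> V \<Longrightarrow> a \<le> u" using V ord by auto

text \<open>The code of the empty set is a fresh index, different from that of any triangle.\<close>

definition X :: "int bpoly" where "X = pvar (set_encode {})"

definition Y :: "nat set \<Rightarrow> int bpoly" where
  "Y T = (if a \<in> T then 0 else if T = {b, c, x} then 1 else if T = {b, c, y} then 1 + X
     else if T = {b, c, z} then X else pvar (set_encode T))"

text \<open>\<open>Y\<close> gives \<open>abcx\<close>, \<open>abcy\<close>, \<open>abcz\<close> the values \<open>1\<close>, \<open>1 + X\<close>, \<open>X\<close> of \<open>\<omega>\<close> and
  is generic elsewhere. With \<open>\<nu>\<close> the coboundary of the indicator of \<open>abc\<close> and \<open>\<eta> = X (1 + X) \<nu>\<close>,
  \<open>M\<close> is \<open>\<nu> \<eta> / \<omega>\<close>, and \<open>p\<close> times the reduced cochain becomes a polynomial in \<open>X\<close> alone.\<close>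

definition M :: "nat set \<Rightarrow> int bpoly" where
  "M F = (if F = V - {z} - {y} then X * (1 + X) else if F = V - {z} - {x} then X
     else if F = V - {y} - {x} then 1 + X else 0)"

text \<open>Y vanishes on sets containing a, so it is a cone with apex a, namely over the cochain
  that forgets a.\<close>

lemma coboundary_Y:
  assumes "F \<subseteq> V" "a \<in> F"
  shows "coboundary Y F = Y (F - {a})"
proof -
  have "Y = (\<lambda>T. if a \<in> T then 0 else (\<lambda>D. Y (D - {a})) (insert a T))"
    by (rule ext) (auto simp: Y_def)
  moreover have "coboundary (\<lambda>T. if a \<in> T then 0 else (\<lambda>D. Y (D - {a})) (insert a T)) F = Y (F - {a})"
    by (rule coboundary_cone) (use assms min_V fin finite_subset in blast)+
  ultimately show ?thesis by simp
qed

lemma Y_cases: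
  "Y T = 0 \<and> a \<in> T \<or> Y T = 1 \<and> b \<in> T \<or> Y T = 1 + X \<and> b \<in> T \<or> Y T = X \<and> b \<in> T
    \<or> a \<notin> T \<and> Y T = pvar (set_encode T)"
  by (simp add: Y_def)

text \<open>Away from a and b the cochain Y is generic: the indeterminate of \<open>T0\<close>
  occurs in no other value.\<close>

lemma lookup_Y:
  assumes "finite T" "finite T0" "T0 \<noteq> {}" "a \<notin> T0" "b \<notin> T0"
  shows "Poly_Mapping.lookup (Y T) (Poly_Mapping.single (set_encode T0) 1) = (if T = T0 then 1 else 0)"
proof -
  have s: "Poly_Mapping.single (set_encode S) (1::nat) = Poly_Mapping.single (set_encode T0) 1 \<longleftrightarrow> S = T0"
    if "finite S" for S
    unfolding single_1_eq_iff using set_encode_eq[OF that assms(2)] .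
  have one: "Poly_Mapping.single (set_encode T0) (1::nat) \<noteq> 0" by (rule single_nonzero) simp
  have X: "Poly_Mapping.lookup X (Poly_Mapping.single (set_encode T0) 1) = 0"
    unfolding X_def pvar_def lookup_single s[OF finite.emptyI] using assms(3) by simp
  have "T \<noteq> T0" if "a \<in> T \<or> b \<in> T" using that assms(4,5) by blast
  with Y_cases[of T] consider "Y T = 0" "T \<noteq> T0" | "Y T = 1" "T \<noteq> T0" | "Y T = 1 + X" "T \<noteq> T0"
    | "Y T = X" "T \<noteq> T0" | "Y T = pvar (set_encode T)" by blast
  then show ?thesis
  proof cases
    case 5
    show ?thesis unfolding 5 pvar_def lookup_single s[OF assms(1)] by (simp add: when_def)
  qed (use one X in \<open>simp_all add: lookup_add lookup_one\<close>)
qed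

text \<open>A coefficient 1 or -1 cannot vanish modulo p. For a in F, such a coefficient is visible
  in the value of Y on the triangle opposite to a; otherwise some indeterminate occurs in exactly
  one term.\<close>

lemma coboundary_Y_mod_nonzero:
  assumes F: "F \<in> faces 3 V"
  shows "Poly_Mapping.map of_int (coboundary Y F) \<noteq> (0 :: 'p::prime_card mod_ring bpoly)"
proof -
  have fF: "finite F" "F \<subseteq> V" "card F = 4" using faces_finite_face[OF F] F unfolding faces_def by simp_all
  have unit: "\<not> int CARD('p) dvd 1" "\<not> int CARD('p) dvd - 1"
    using prime_card[where ?'a = 'p] by auto
  have "\<exists>m. Poly_Mapping.lookup (coboundary Y F) m = 1 \<or> Poly_Mapping.lookup (coboundary Y F) m = - 1"
  proof (cases "a \<in> F")
    case True
    let ?T = "F - {a}"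
    have X0: "Poly_Mapping.lookup X 0 = 0" "Poly_Mapping.lookup X (Poly_Mapping.single (set_encode {}) 1) = 1"
      by (simp_all add: X_def pvar_def lookup_single when_def single_nonzero)
    consider "Y ?T = 1" | "Y ?T = 1 + X" | "Y ?T = X" | "Y ?T = pvar (set_encode ?T)"
      using Y_cases[of ?T] by blast
    then have "\<exists>m. Poly_Mapping.lookup (Y ?T) m = 1"
    proof cases
      case 1 then show ?thesis by (intro exI[of _ 0]) simp
    next
      case 2 then show ?thesis by (intro exI[of _ 0]) (simp add: lookup_add X0)
    next
      case 3 then show ?thesis using X0(2) by auto
    next
      case 4 then show ?thesis by (intro exI[of _ "Poly_Mapping.single (set_encode ?T) 1"]) (simp add: pvar_def)
    qed
    then show ?thesis using coboundary_Y[OF fF(2) True] by auto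
  next
    case False
    \<comment> \<open>Dropping b, if present, leaves a triangle without a and b, whose value under Y
      is an indeterminate of its own.\<close>
    define v0 where "v0 = (if b \<in> F then b else Min F)"
    have "F \<noteq> {}" using fF by auto
    then have v0: "v0 \<in> F" using fF by (auto simp: v0_def)
    let ?T = "F - {v0}" let ?m = "Poly_Mapping.single (set_encode ?T) (1::nat)"
    have T: "finite ?T" "?T \<noteq> {}" "a \<notin> ?T" "b \<notin> ?T"
    proof -
      have "card ?T = 3" using fF v0 by simp
      then show "?T \<noteq> {}" by (metis card.empty zero_neq_numeral)
    qed (use fF False in \<open>auto simp: v0_def\<close>)
    have "Poly_Mapping.lookup (vsign F v * Y (F - {v})) ?m = (if v = v0 then vsign F v0 else 0)" if "v \<in> F" for v
    proof -
      have "F - {v} = ?T \<longleftrightarrow> v = v0" using that v0 by auto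
      then have "Poly_Mapping.lookup (Y (F - {v})) ?m = (if v = v0 then 1 else 0)"
        using lookup_Y[of "F - {v}" ?T] fF(1) T by simp
      then show ?thesis
        by (auto simp: vsign_def minus_one_power_iff lookup_uminus)
    qed
    then have "Poly_Mapping.lookup (coboundary Y F) ?m = vsign F v0"
      unfolding coboundary_vsign using fF v0 by (simp add: lookup_sum)
    then show ?thesis using vsign_cases[of F v0, where ?'a = int] by metis
  qed
  then show ?thesis using unit by (metis map_of_int_mod_ring_eq_0_iff)
qed

lemma vsign_V: "vsign V x = (- 1 :: 'a::comm_ring_1)" "vsign V y = (1 :: 'a)" "vsign V z = (- 1 :: 'a)"
proof -
  have s: "{u\<in>V. u < x} = {a, b, c}" "{u\<in>V. u < y} = {a, b, c, x}" "{u\<in>V. u < z} = {a, b, c, x, y}"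
    unfolding V using ord by auto
  have "card {a, b, c} = 3" "card {a, b, c, x} = 4" "card {a, b, c, x, y} = 5"
    using distinct_V by simp_all
  then show "vsign V x = (- 1 :: 'a)" "vsign V y = (1 :: 'a)" "vsign V z = (- 1 :: 'a)"
    unfolding vsign_def s by simp_all
qed

lemma sum_V: "(\<Sum>v\<in>V. f v) = f a + f b + f c + f x + f y + f z" for f :: "nat \<Rightarrow> 'a::comm_monoid_add"
  unfolding V using distinct_V by (simp add: add.assoc)

lemma M_pair:
  assumes "v \<in> V" "u \<in> V"
  shows "M (V - {v} - {u}) = (if {v, u} = {z, y} then X * (1 + X) else if {v, u} = {z, x} then X
     else if {v, u} = {y, x} then 1 + X else 0)"
  unfolding M_def using assms in_V by (simp only: remove2_eq_iff)

lemma V_remove2: "V - {z} - {y} = {a, b, c, x}" "V - {z} - {x} = {a, b, c, y}" "V - {y} - {x} = {a, b, c, z}"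
  unfolding V using ord by auto

lemma Y_special: "Y {b, c, x} = 1" "Y {b, c, y} = 1 + X" "Y {b, c, z} = X"
proof -
  have "y \<notin> {b, c, x}" "z \<notin> {b, c, x}" "z \<notin> {b, c, y}" using ord by auto
  then have ne: "{b, c, y} \<noteq> {b, c, x}" "{b, c, z} \<noteq> {b, c, x}" "{b, c, z} \<noteq> {b, c, y}" by blast+
  have a: "a \<notin> {b, c, x}" "a \<notin> {b, c, y}" "a \<notin> {b, c, z}" using ord by auto
  show "Y {b, c, x} = 1" "Y {b, c, y} = 1 + X" "Y {b, c, z} = X"
    unfolding Y_def using ne a by (simp_all only: if_False if_True simp_thms)
qed

text \<open>The values of \<omega> were chosen for this outcome: the nonzero values of Q are -1, X^2
  - 1 and X^2, so p times the defect is the expansion of (X^2 - 1)^q without its two outer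
  terms.\<close>

lemma coboundary_M:
  "coboundary M (V - {a}) = 0" "coboundary M (V - {b}) = 0" "coboundary M (V - {c}) = 0"
  "coboundary M (V - {x}) = - 1" "coboundary M (V - {y}) = X ^ 2 - 1" "coboundary M (V - {z}) = X ^ 2"
proof -
  have e: "coboundary M (V - {v}) = (\<Sum>u\<in>V. if u = v then 0 else vsign (V - {v}) u * M (V - {v} - {u}))"
    if "v \<in> V" for v
    unfolding coboundary_vsign using fin that by (intro sum.mono_neutral_cong_left) auto
  have o: "\<not> y < x" "\<not> z < x" "\<not> z < y" "x < z" using ord by auto
  note simps = M_pair in_V doubleton_eq_iff distinct_V distinct_V[symmetric] vsign_remove[OF fin] vsign_V ord o
  show "coboundary M (V - {a}) = 0" unfolding e[OF in_V(1)] sum_V by (simp add: simps)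
  show "coboundary M (V - {b}) = 0" unfolding e[OF in_V(2)] sum_V by (simp add: simps)
  show "coboundary M (V - {c}) = 0" unfolding e[OF in_V(3)] sum_V by (simp add: simps)
  show "coboundary M (V - {x}) = - 1" unfolding e[OF in_V(4)] sum_V by (simp add: simps)
  show "coboundary M (V - {y}) = X ^ 2 - 1" unfolding e[OF in_V(5)] sum_V
    by (simp add: simps algebra_simps power2_eq_square)
  show "coboundary M (V - {z}) = X ^ 2" unfolding e[OF in_V(6)] sum_V
    by (simp add: simps algebra_simps power2_eq_square)
qed

text \<open>The monomial X^(2j) carries the coefficient C(p^k, j) up to sign, before division by p.
  The index j = p^(k-1) is taken because there the binomial coefficient is divisible by p only
  once.\<close>

lemma frobenius_defect_M_mod_nonzero:
  assumes k: "k \<ge> 1"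
  shows "Poly_Mapping.map of_int (frobenius_defect CARD('p) k (coboundary M) V) \<noteq> (0 :: 'p::prime_card mod_ring bpoly)"
proof
  let ?p = "CARD('p)" let ?\<Phi> = "frobenius_defect ?p k (coboundary M) V"
  obtain k' where k': "k = Suc k'" using k by (cases k) auto
  let ?q = "?p ^ k" let ?j = "?p ^ k'" let ?m = "Poly_Mapping.single (set_encode {}) (2 * ?j)"
  have p: "prime ?p" by (rule prime_card)
  have p1: "?p > 1" using p by (rule prime_gt_1_nat)
  have j: "0 < ?j" "?j < ?q" using p1 by (simp_all add: k')
  have "of_nat ?p * ?\<Phi> = coboundary (\<lambda>D. coboundary M D ^ ?q) V - 0 ^ ?q"
    unfolding of_nat_mult_frobenius_defect[OF p k fin] coboundary_coboundary[OF fin] ..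
  also have "\<dots> = - ((X ^ 2) ^ ?q) + (X ^ 2 - 1) ^ ?q - (- 1) ^ ?q"
    unfolding coboundary_vsign[of _ V] sum_V using j by (simp add: coboundary_M vsign_V power_0_left)
  finally have "int ?p * Poly_Mapping.lookup ?\<Phi> ?m = (- 1) ^ (?q - ?j) * int (?q choose ?j)"
    using lookup_witness_polynomial[OF X_def j] lookup_of_nat_mult[of ?p ?\<Phi> ?m] by simp
  moreover assume "Poly_Mapping.map of_int ?\<Phi> = (0 :: 'p mod_ring bpoly)"
  then have "int ?p dvd Poly_Mapping.lookup ?\<Phi> ?m" by (simp add: map_of_int_mod_ring_eq_0_iff)
  then have "int ?p * int ?p dvd int ?p * Poly_Mapping.lookup ?\<Phi> ?m" by simp
  ultimately have "int ?p * int ?p dvd (- 1) ^ (?q - ?j) * int (?q choose ?j)" by simp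
  then have "int (?p * ?p) dvd int (?q choose ?j)"
    by (cases "even (?q - ?j)") simp_all
  then have "?p * ?p dvd (?q choose ?j)" by (simp only: int_dvd_int_iff)
  then show False using prime_square_not_dvd_choose[OF p, of k'] unfolding k' by contradiction
qed

text \<open>The quotient \<nu>\<eta>/\<omega> is the image of the integral cochain M, so the defect
  over F_p is the reduction of the one computed over the integers.\<close>

lemma nonvanishing_witness:
  assumes k: "k \<ge> 1"
  obtains \<omega> \<nu> \<eta> :: "nat set \<Rightarrow> 'p::prime_card mod_ring ratfun"
  where "cocycle3 V \<omega>" "cocycle3 V \<nu>" "cocycle3 V \<eta>" "\<And>F. F \<in> faces 3 V \<Longrightarrow> \<omega> F \<noteq> 0"
    "frobenius_defect CARD('p) k (field_Q \<omega> \<nu> \<eta>) V \<noteq> 0"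
proof -
  let ?T = "{a, b, c}"
  define \<omega> :: "nat set \<Rightarrow> 'p mod_ring ratfun" where "\<omega> F = frac_of (coboundary Y F)" for F
  define \<nu> :: "nat set \<Rightarrow> 'p mod_ring ratfun" where "\<nu> = coboundary (face_indicator ?T)"
  \<comment> \<open>The factor is the product of the values 1, 1 + X, X of \<omega> on the
    tetrahedra where \<nu> lives; it clears all denominators.\<close>
  define \<eta> :: "nat set \<Rightarrow> 'p mod_ring ratfun" where "\<eta> F = frac_of (X * (1 + X)) * \<nu> F" for F
  define S where "S = (\<lambda>r s. s = (frac_of r :: 'p mod_ring ratfun))"
  have S: "ring_rel S" using ring_map_on_frac_of by (simp add: S_def ring_map_on_def)
  have \<omega>: "cocycle3 V \<omega>"
    unfolding cocycle3_def
  proof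
    fix D assume "D \<in> faces 4 V"
    have "S (coboundary (coboundary Y) D) (coboundary \<omega> D)"
      by (rule ring_rel_coboundary[OF S]) (simp add: S_def \<omega>_def)
    then show "coboundary \<omega> D = 0"
      using coboundary_coboundary[OF faces_finite_face[OF \<open>D \<in> faces 4 V\<close>], of Y] by (simp add: S_def)
  qed
  have \<nu>: "cocycle3 V \<nu>" unfolding \<nu>_def by (rule cocycle3_coboundary)
  have \<eta>: "cocycle3 V \<eta>" using \<nu> by (simp add: cocycle3_def \<eta>_def[abs_def] coboundary_mult)
  have nz: "\<omega> F \<noteq> 0" if "F \<in> faces 3 V" for F
    using coboundary_Y_mod_nonzero[OF that, where ?'p = 'p] by (simp add: \<omega>_def frac_of_eq_0_iff)
  have pair: "\<nu> F * \<eta> F / \<omega> F = frac_of (M F)" if F: "F \<in> faces 3 V" for F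
  proof (cases "?T \<subseteq> F")
    case True
    have "finite F" "card F = 4" "F \<subseteq> V" using faces_finite_face[OF F] F unfolding faces_def by simp_all
    have "card (F - ?T) = 1" using True \<open>card F = 4\<close> distinct_V by (simp add: card_Diff_subset)
    then obtain w where w: "F - ?T = {w}" by (auto simp: card_1_singleton_iff)
    then have Fw: "F = {a, b, c, w}" "w \<notin> ?T" "w \<in> {x, y, z}" using True \<open>F \<subseteq> V\<close> V by auto
    have "F - {w} = ?T" using Fw by auto
    then have \<nu>F: "\<nu> F = vsign F w"
      using coboundary_face_indicator[of F w] \<open>finite F\<close> Fw(1) unfolding \<nu>_def by simp
    have \<omega>F: "\<omega> F = frac_of (Y {b, c, w})"
    proof -
      have "F - {a} = {b, c, w}" using Fw distinct_V by auto
      then show ?thesis using coboundary_Y[of F] \<open>F \<subseteq> V\<close> Fw(1) by (simp add: \<omega>_def)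
    qed
    \<comment> \<open>The sign of \<nu> at F enters squared, so it need not be computed.\<close>
    have "\<nu> F * \<eta> F = vsign F w * vsign F w * frac_of (X * (1 + X))"
      unfolding \<eta>_def \<nu>F by (simp only: mult_ac)
    then have e: "\<nu> F * \<eta> F = frac_of (X * (1 + X))" by simp
    have YM: "X * (1 + X) = Y {b, c, w} * M F"
    proof -
      consider "w = x" | "w = y" | "w = z" using Fw(3) by blast
      then show ?thesis
      proof cases
        case 1
        then have "F = V - {z} - {y}" using Fw(1) V_remove2 by simp
        then show ?thesis using 1 in_V by (simp add: M_pair Y_special)
      next
        case 2
        then have "F = V - {z} - {x}" using Fw(1) V_remove2 by simp
        then show ?thesis using 2 in_V distinct_V by (simp add: M_pair Y_special doubleton_eq_iff)
      next
        case 3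
        then have "F = V - {y} - {x}" using Fw(1) V_remove2 by simp
        then show ?thesis using 3 in_V distinct_V by (simp add: M_pair Y_special doubleton_eq_iff)
      qed
    qed
    have "\<omega> F \<noteq> 0" by (rule nz[OF F])
    then show ?thesis unfolding e YM frac_of_mult \<omega>F[symmetric] by simp
  next
    case False
    have "\<nu> F = 0" unfolding \<nu>_def by (rule coboundary_face_indicator_0) (use False in auto)
    moreover have "M F = 0"
    proof -
      have "?T \<subseteq> V - {z} - {y}" "?T \<subseteq> V - {z} - {x}" "?T \<subseteq> V - {y} - {x}"
        unfolding V using distinct_V by auto
      then show ?thesis using False by (auto simp: M_def)
    qed
    ultimately show ?thesis by simp
  qed
  have Q: "S (coboundary M (V - {v})) (field_Q \<omega> \<nu> \<eta> (V - {v}))" if "v \<in> V" for v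
    unfolding field_Q_def
    by (rule ring_rel_coboundary[OF S]) (use that card_V in \<open>simp add: S_def pair card6_remove2\<close>)
  have "S (frobenius_defect CARD('p) k (coboundary M) V) (frobenius_defect CARD('p) k (field_Q \<omega> \<nu> \<eta>) V)"
    by (rule ring_rel_frobenius_defect[OF S fin]) (rule Q)
  then have "frobenius_defect CARD('p) k (field_Q \<omega> \<nu> \<eta>) V \<noteq> 0"
    using frobenius_defect_M_mod_nonzero[OF k, where ?'p = 'p] by (simp add: S_def frac_of_eq_0_iff)
  then show ?thesis using that \<omega> \<nu> \<eta> nz by blast
qed

end

lemma six_vertices_exist:
  assumes "card V = 6"
  obtains a b c x y z where "six_vertices V a b c x y z"
proof -
  let ?l = "sorted_list_of_set V"
  have fin: "finite V" using assms card_ge_0_finite by force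
  have "length ?l = 6" using assms fin by simp
  then obtain a b c x y z where l: "?l = [a, b, c, x, y, z]"
    by (auto simp: eval_nat_numeral length_Suc_conv simp del: sorted_list_of_set.length_sorted_key_list_of_set)
  have "sorted ?l" "distinct ?l" "set ?l = V" using fin by auto
  then have "six_vertices V a b c x y z"
    unfolding l by unfold_locales (auto simp: order_less_le)
  then show ?thesis using that by blast
qed

lemma reduced_cochain_nonzero:
  fixes c :: "'p::prime_card mod_ring ratfun cpoly"
  assumes c: "reduced_cochain k V B B\<^sub>\<nu> B\<^sub>\<eta> c" and V: "card V = 6" and k: "k \<ge> 1"
  shows "c \<noteq> 0"
proof
  assume c0: "c = 0"
  obtain v1 v2 v3 v4 v5 v6 where six: "six_vertices V v1 v2 v3 v4 v5 v6"
    by (rule six_vertices_exist[OF V])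
  obtain \<omega> \<nu> \<eta> :: "nat set \<Rightarrow> 'p mod_ring ratfun"
    where w: "cocycle3 V \<omega>" "cocycle3 V \<nu>" "cocycle3 V \<eta>" "\<And>F. F \<in> faces 3 V \<Longrightarrow> \<omega> F \<noteq> 0"
    "frobenius_defect CARD('p) k (field_Q \<omega> \<nu> \<eta>) V \<noteq> 0"
    using six_vertices.nonvanishing_witness[OF six k, where ?'p = 'p] by metis
  have "cval \<omega> c \<nu> \<eta> = frobenius_defect CARD('p) k (field_Q \<omega> \<nu> \<eta>) V"
    by (rule cval_reduced_cochain[OF c V k w(1-3)]) (rule w(4))
  then show False using w(5) by (simp add: c0 cval_def)
qed

section \<open>Dependence on colorings and the heptagon relation\<close>

lemma zero_in_ratfuns: "0 \<in> ratfuns B"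
  unfolding ratfuns_def mem_Collect_eq Zero_fract_def
  by (intro exI[of _ 0] exI[of _ 1] conjI refl) simp_all

lemma color_eq_imp_shift:
  assumes "color K \<omega> D \<nu> = color K \<omega> D \<nu>'" "0 \<in> K"
  obtains s where "\<And>F. F \<in> faces 3 D \<Longrightarrow> \<nu>' F = \<nu> F + s * \<omega> F"
proof -
  \<comment> \<open>The normalised \<nu>' lies in its own color, with t = 0, and therefore in that
    of \<nu>.\<close>
  have "(\<lambda>F. if F \<in> faces 3 D then \<nu>' F + 0 * \<omega> F else 0) \<in> color K \<omega> D \<nu>'"
    unfolding color_def using assms(2) by blast
  then have "(\<lambda>F. if F \<in> faces 3 D then \<nu>' F + 0 * \<omega> F else 0) \<in> color K \<omega> D \<nu>"
    unfolding assms(1) .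
  then obtain s where s: "(\<lambda>F. if F \<in> faces 3 D then \<nu>' F + 0 * \<omega> F else 0)
      = (\<lambda>F. if F \<in> faces 3 D then \<nu> F + s * \<omega> F else 0)"
    unfolding color_def by blast
  have "\<nu>' F = \<nu> F + s * \<omega> F" if "F \<in> faces 3 D" for F
    using fun_cong[OF s, of F] that by simp
  then show ?thesis using that by blast
qed

text \<open>Expanding, (\<nu> + s\<omega>)(\<eta> + t\<omega>)/\<omega> = \<nu>\<eta>/\<omega> +
  s\<eta> + t\<nu> + st\<omega>, and the coboundary kills the last three terms, which are
  cocycles.\<close>

lemma field_Q_shift:
  assumes D: "D \<in> faces 4 V" and c: "cocycle3 V \<omega>" "cocycle3 V \<nu>" "cocycle3 V \<eta>"
    and nz: "\<And>F. F \<in> faces 3 V \<Longrightarrow> \<omega> F \<noteq> 0"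
    and \<nu>': "\<And>F. F \<in> faces 3 D \<Longrightarrow> \<nu>' F = \<nu> F + s * \<omega> F"
    and \<eta>': "\<And>F. F \<in> faces 3 D \<Longrightarrow> \<eta>' F = \<eta> F + t * \<omega> F"
  shows "field_Q \<omega> \<nu>' \<eta>' D = field_Q \<omega> \<nu> \<eta> D"
proof -
  have "coboundary (\<lambda>F. \<nu>' F * \<eta>' F / \<omega> F) D
      = coboundary (\<lambda>F. \<nu> F * \<eta> F / \<omega> F + (s * \<eta> F + (t * \<nu> F + s * t * \<omega> F))) D"
  proof (rule coboundary_cong)
    fix v assume "v \<in> D"
    then have F: "D - {v} \<in> faces 3 D" and "D - {v} \<in> faces 3 V"
      using D by (auto simp: faces_def)
    then have "\<omega> (D - {v}) \<noteq> 0" using nz by blast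
    then show "\<nu>' (D - {v}) * \<eta>' (D - {v}) / \<omega> (D - {v}) = \<nu> (D - {v}) * \<eta> (D - {v}) / \<omega> (D - {v}) +
        (s * \<eta> (D - {v}) + (t * \<nu> (D - {v}) + s * t * \<omega> (D - {v})))"
      unfolding \<nu>'[OF F] \<eta>'[OF F] by (simp add: field_simps)
  qed
  then show ?thesis
    using c D unfolding field_Q_def cocycle3_def by (simp add: coboundary_add coboundary_mult)
qed

lemma field_Q_color:
  assumes "D \<in> faces 4 V" "cocycle3 V \<omega>" "cocycle3 V \<nu>" "cocycle3 V \<eta>"
    and "\<And>F. F \<in> faces 3 V \<Longrightarrow> \<omega> F \<noteq> 0" and K: "0 \<in> K"
    and "color K \<omega> D \<nu> = color K \<omega> D \<nu>'" "color K \<omega> D \<eta> = color K \<omega> D \<eta>'"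
  shows "field_Q \<omega> \<nu>' \<eta>' D = field_Q \<omega> \<nu> \<eta> D"
proof -
  obtain s where "\<And>F. F \<in> faces 3 D \<Longrightarrow> \<nu>' F = \<nu> F + s * \<omega> F"
    using color_eq_imp_shift[OF assms(7) K] by blast
  moreover obtain t where "\<And>F. F \<in> faces 3 D \<Longrightarrow> \<eta>' F = \<eta> F + t * \<omega> F"
    using color_eq_imp_shift[OF assms(8) K] by blast
  ultimately show ?thesis by (intro field_Q_shift[OF assms(1-5)]) blast+
qed

lemma card6_remove: "card V = 6 \<Longrightarrow> v \<in> V \<Longrightarrow> V - {v} \<in> faces 4 V"
  by (auto simp: faces_def card_Diff_singleton)

lemma lifted_reduction:
  fixes \<omega> :: "nat set \<Rightarrow> rat ratfun"
  assumes V: "card V = 6" and k: "k \<ge> 1" and g: "generic_triple V B B\<^sub>\<nu> B\<^sub>\<eta> \<omega> \<nu> \<eta>"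
  obtains c :: "'p::prime_card mod_ring ratfun cpoly"
  where "reduction_rel B B\<^sub>\<nu> B\<^sub>\<eta> (lifted CARD('p) k \<omega> \<nu> \<eta> V) c"
    "\<And>S. S = range Nu \<or> S = range Eta \<Longrightarrow> homogeneous S (CARD('p) ^ k) (lifted CARD('p) k \<omega> \<nu> \<eta> V)"
proof -
  have mi: "max_indep_components TYPE(rat) V B" "max_indep_components TYPE(rat) V B\<^sub>\<nu>"
    "max_indep_components TYPE(rat) V B\<^sub>\<eta>" using g by (auto simp: generic_triple_def)
  obtain n where n: "component_matrix V B n" by (rule component_matrix_exists[OF V mi(1)])
  obtain n\<^sub>\<nu> where n\<^sub>\<nu>: "component_matrix V B\<^sub>\<nu> n\<^sub>\<nu>" by (rule component_matrix_exists[OF V mi(2)])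
  obtain n\<^sub>\<eta> where n\<^sub>\<eta>: "component_matrix V B\<^sub>\<eta> n\<^sub>\<eta>" by (rule component_matrix_exists[OF V mi(3)])
  show ?thesis
    by (rule that[OF reduction_rel_lifted[OF n n\<^sub>\<nu> n\<^sub>\<eta> g V k] homogeneous_lifted[OF n n\<^sub>\<nu> n\<^sub>\<eta> g V]])
qed

lemma reduced_cochain_degree:
  fixes c :: "'p::prime_card mod_ring ratfun cpoly"
  assumes c: "reduced_cochain k V B B\<^sub>\<nu> B\<^sub>\<eta> c" and V: "card V = 6" and k: "k \<ge> 1"
  shows "c \<in> cpolys B B\<^sub>\<nu> B\<^sub>\<eta>" "degree_in (range Nu) c = CARD('p) ^ k" "degree_in (range Eta) c = CARD('p) ^ k"
proof -
  obtain \<omega> \<nu> \<eta> where g: "generic_triple V B B\<^sub>\<nu> B\<^sub>\<eta> \<omega> \<nu> \<eta>"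
    and red: "reduction_rel B B\<^sub>\<nu> B\<^sub>\<eta> (lifted CARD('p) k \<omega> \<nu> \<eta> V) c"
    using c unfolding reduced_cochain_def reduces_to_iff by blast
  show "c \<in> cpolys B B\<^sub>\<nu> B\<^sub>\<eta>" by (rule reduction_rel_in_cpolys(2)[OF red])
  have "homogeneous S (CARD('p) ^ k) (lifted CARD('p) k \<omega> \<nu> \<eta> V)" if "S = range Nu \<or> S = range Eta" for S
    using lifted_reduction[OF V k g, where ?'p = 'p] that by metis
  then have "homogeneous S (CARD('p) ^ k) c" if "S = range Nu \<or> S = range Eta" for S
    using that reduction_rel_keys[OF red] unfolding homogeneous_def by blast
  \<comment> \<open>Homogeneity alone does not fix the degree: \<open>degree_in\<close> assigns 0 to
    the zero polynomial.\<close>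
  then show "degree_in (range Nu) c = CARD('p) ^ k" "degree_in (range Eta) c = CARD('p) ^ k"
    using reduced_cochain_nonzero[OF c V k] by (simp_all add: degree_in_homogeneous)
qed

text \<open>The shifts may change from one 4-face to the next, because Q is compared face by face.
  This covers both equality of colors and a global shift by a multiple of \<omega>.\<close>

lemma cval_color:
  fixes c :: "'p::prime_card mod_ring ratfun cpoly"
  assumes c: "reduced_cochain k V B B\<^sub>\<nu> B\<^sub>\<eta> c" and V: "card V = 6" and k: "k \<ge> 1"
    and \<omega>: "generic_omega V B \<omega>"
    and co: "cocycle3 V \<nu>" "cocycle3 V \<nu>'" "cocycle3 V \<eta>" "cocycle3 V \<eta>'"
    and shift: "\<And>D. D \<in> faces 4 V \<Longrightarrow> \<exists>s t. \<forall>F\<in>faces 3 D. \<nu>' F = \<nu> F + s * \<omega> F \<and> \<eta>' F = \<eta> F + t * \<omega> F"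
  shows "cval \<omega> c \<nu> \<eta> = cval \<omega> c \<nu>' \<eta>'"
proof -
  obtain n n\<^sub>\<nu> n\<^sub>\<eta> where n: "component_matrix V B n" by (rule reduced_cochain_eq[OF c V k])
  have nz: "\<omega> F \<noteq> 0" if "F \<in> faces 3 V" for F
    using generic_omega_expand[OF n \<omega> that] map_linear_form_nonzero[OF n that, where ?'k = "'p mod_ring"]
    by (simp add: frac_of_eq_0_iff)
  have co\<omega>: "cocycle3 V \<omega>" using \<omega> by (simp add: generic_omega_def)
  have "frobenius_defect CARD('p) k (field_Q \<omega> \<nu> \<eta>) V = frobenius_defect CARD('p) k (field_Q \<omega> \<nu>' \<eta>') V"
  proof (rule frobenius_defect_cong)
    fix v assume "v \<in> V"
    then have D: "V - {v} \<in> faces 4 V" by (rule card6_remove[OF V])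
    obtain s t where "\<forall>F\<in>faces 3 (V - {v}). \<nu>' F = \<nu> F + s * \<omega> F \<and> \<eta>' F = \<eta> F + t * \<omega> F"
      using shift[OF D] by blast
    then show "field_Q \<omega> \<nu> \<eta> (V - {v}) = field_Q \<omega> \<nu>' \<eta>' (V - {v})"
      using field_Q_shift[OF D co\<omega> co(1) co(3) nz, of \<nu>' s \<eta>' t] by simp
  qed
  then show ?thesis
    using cval_reduced_cochain[OF c V k co\<omega> co(1) co(3) nz] cval_reduced_cochain[OF c V k co\<omega> co(2) co(4) nz]
    by simp
qed

text \<open>The values \<open>Q D\<close> depend only on the colors, so they form one 4-cochain on the 6-simplex,
  closed on every 5-face; contracting to the first vertex makes it a coboundary.\<close>

lemma heptagon_relation:
  fixes \<omega> :: "nat set \<Rightarrow> 'p::prime_card mod_ring ratfun"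
  assumes W: "card W = 7" and k: "k \<ge> 1" and B: "max_indep_components TYPE('p mod_ring) W B"
    and \<omega>: "generic_omega W B \<omega>"
    and faces: "\<And>V. V \<in> faces 5 W \<Longrightarrow> reduced_cochain k V (b V) (b\<^sub>\<nu> V) (b\<^sub>\<eta> V) (c V) \<and>
        induces (ratfuns B) \<omega> V (\<nu> V) r\<^sub>1 \<and> induces (ratfuns B) \<omega> V (\<eta> V) r\<^sub>2"
  shows "coboundary (\<lambda>V. cval \<omega> (c V) (\<nu> V) (\<eta> V)) W = 0"
proof -
  have fin: "finite W" using W card_ge_0_finite by force
  have nz: "\<omega> F \<noteq> 0" if "F \<in> faces 3 W" for F by (rule generic_omega_nonzero[OF fin B \<omega> that])
  have V: "card V = 6" "cocycle3 V \<omega>" "cocycle3 V (\<nu> V)" "cocycle3 V (\<eta> V)"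
    "\<And>F. F \<in> faces 3 V \<Longrightarrow> \<omega> F \<noteq> 0" if "V \<in> faces 5 W" for V
  proof -
    have sub: "V \<subseteq> W" and "card V = 6" using that by (auto simp: faces_def)
    then show "card V = 6" by simp
    show "cocycle3 V \<omega>" using cocycle3_mono[OF sub, of \<omega>] \<omega> by (simp add: generic_omega_def)
    show "cocycle3 V (\<nu> V)" "cocycle3 V (\<eta> V)"
      using faces[OF that] by (auto simp: induces_def cocycle3_in_def)
    show "\<And>F. F \<in> faces 3 V \<Longrightarrow> \<omega> F \<noteq> 0" using nz faces_mono[OF sub] by blast
  qed
  have col: "color (ratfuns B) \<omega> D (\<nu> V) = r\<^sub>1 D" "color (ratfuns B) \<omega> D (\<eta> V) = r\<^sub>2 D"
    if "V \<in> faces 5 W" "D \<in> faces 4 V" for V D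
    using faces[OF that(1)] that(2) unfolding induces_def by metis+
  \<comment> \<open>The cocycles on different 5-faces need not fit together, so the value on D is
    taken from an arbitrary 5-face containing it. Any other choice gives the same colors on D, hence
    the same value of Q.\<close>
  define q where "q D = (let V = SOME V. V \<in> faces 5 W \<and> D \<in> faces 4 V in field_Q \<omega> (\<nu> V) (\<eta> V) D)" for D
  have q: "field_Q \<omega> (\<nu> V) (\<eta> V) D = q D" if VD: "V \<in> faces 5 W" "D \<in> faces 4 V" for V D
  proof -
    define V' where "V' = (SOME V. V \<in> faces 5 W \<and> D \<in> faces 4 V)"
    have V': "V' \<in> faces 5 W" "D \<in> faces 4 V'"
      unfolding V'_def using someI[of "\<lambda>V. V \<in> faces 5 W \<and> D \<in> faces 4 V" V] VD by auto
    have "color (ratfuns B) \<omega> D (\<nu> V') = color (ratfuns B) \<omega> D (\<nu> V)"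
      "color (ratfuns B) \<omega> D (\<eta> V') = color (ratfuns B) \<omega> D (\<eta> V)"
      using col[OF VD] col[OF V'] by simp_all
    from field_Q_color[OF V'(2) V(2-5)[OF V'(1)] zero_in_ratfuns this]
    show ?thesis by (simp add: q_def V'_def Let_def)
  qed
  define y where "y T = (if Min W \<in> T then 0 else q (insert (Min W) T))" for T
  have dy: "coboundary y D = q D" if D: "D \<in> faces 4 W" for D
    unfolding y_def
  proof (rule coboundary_cone)
    show finD: "finite D" by (rule faces_finite_face[OF D])
    have "D \<subseteq> W" using D by (simp add: faces_def)
    then show "\<forall>u\<in>D. Min W \<le> u" using Min_le[OF fin] by blast
    assume "Min W \<notin> D"
    moreover have "W \<noteq> {}" using W by auto
    ultimately have V5: "insert (Min W) D \<in> faces 5 W"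
      using D fin finD by (auto simp: faces_def)
    let ?V = "insert (Min W) D"
    \<comment> \<open>On a single 5-face q comes from one pair of cocycles, and Q is a coboundary
      there by construction.\<close>
    have "coboundary q ?V = coboundary (field_Q \<omega> (\<nu> ?V) (\<eta> ?V)) ?V"
      using q[OF V5] card6_remove[OF V(1)[OF V5]] by (intro coboundary_cong) simp
    then show "coboundary q ?V = 0"
      unfolding field_Q_def using coboundary_coboundary[OF faces_finite_face[OF V5]] by simp
  qed
  have "coboundary (\<lambda>V. cval \<omega> (c V) (\<nu> V) (\<eta> V)) W = coboundary (frobenius_defect CARD('p) k (coboundary y)) W"
  proof (rule coboundary_cong)
    fix w assume "w \<in> W"
    then have V5: "W - {w} \<in> faces 5 W" using W fin by (auto simp: faces_def card_Diff_singleton)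
    let ?V = "W - {w}"
    have "cval \<omega> (c ?V) (\<nu> ?V) (\<eta> ?V) = frobenius_defect CARD('p) k (field_Q \<omega> (\<nu> ?V) (\<eta> ?V)) ?V"
      by (rule cval_reduced_cochain[OF _ V(1)[OF V5] k V(2-5)[OF V5]]) (use faces[OF V5] in blast)
    also have "\<dots> = frobenius_defect CARD('p) k (coboundary y) ?V"
    proof (rule frobenius_defect_cong)
      fix v assume "v \<in> ?V"
      then have D: "?V - {v} \<in> faces 4 ?V" by (rule card6_remove[OF V(1)[OF V5]])
      then have "?V - {v} \<in> faces 4 W" using faces_mono[of ?V W 4] by blast
      then show "field_Q \<omega> (\<nu> ?V) (\<eta> ?V) (?V - {v}) = coboundary y (?V - {v})"
        using q[OF V5 D] dy by simp
    qed
    finally show "cval \<omega> (c ?V) (\<nu> ?V) (\<eta> ?V) = frobenius_defect CARD('p) k (coboundary y) ?V" .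
  qed
  also have "\<dots> = 0" by (rule coboundary_frobenius_defect_coboundary[OF prime_card k fin])
  finally show ?thesis .
qed

text \<open>Colorings enter through representing cocycles. In (b), invariance is asserted both under
  equality of colors on each 4-face and under global multiples of \<omega>; in (c), component sets
  and cocycles are chosen on each 5-face independently, so that no compatibility between the choices
  is presupposed.\<close>

theorem proposition6:
  fixes p k :: nat
  assumes "p = CARD('p::prime_card)" and "k \<ge> 1"
  shows
    "(\<forall>V B B\<^sub>\<nu> B\<^sub>\<eta> (\<omega> :: nat set \<Rightarrow> rat ratfun) \<nu> \<eta>.
        card V = 6 \<and> generic_triple V B B\<^sub>\<nu> B\<^sub>\<eta> \<omega> \<nu> \<eta> \<longrightarrow>
          lifted p k \<omega> \<nu> \<eta> V \<in> cpolys B B\<^sub>\<nu> B\<^sub>\<eta> \<and>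
          nonneg_valuation p B B\<^sub>\<nu> B\<^sub>\<eta> (lifted p k \<omega> \<nu> \<eta> V) \<and>
          (\<exists>!c :: 'p mod_ring ratfun cpoly. reduces_to B B\<^sub>\<nu> B\<^sub>\<eta> (lifted p k \<omega> \<nu> \<eta> V) c))
     \<and>
     (\<forall>V B B\<^sub>\<nu> B\<^sub>\<eta> (c :: 'p mod_ring ratfun cpoly).
        card V = 6 \<and> reduced_cochain k V B B\<^sub>\<nu> B\<^sub>\<eta> c \<longrightarrow>
          c \<in> cpolys B B\<^sub>\<nu> B\<^sub>\<eta> \<and>
          degree_in (range Nu) c = p ^ k \<and> degree_in (range Eta) c = p ^ k \<and>
          (\<forall>\<omega> \<nu> \<nu>' \<eta> \<eta>'.
             generic_omega V B \<omega> \<and>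
             cocycle3_in (ratfuns B) V \<nu> \<and> cocycle3_in (ratfuns B) V \<nu>' \<and>
             cocycle3_in (ratfuns B) V \<eta> \<and> cocycle3_in (ratfuns B) V \<eta>' \<longrightarrow>
               ((\<forall>D\<in>faces 4 V. color (ratfuns B) \<omega> D \<nu> = color (ratfuns B) \<omega> D \<nu>') \<and>
                (\<forall>D\<in>faces 4 V. color (ratfuns B) \<omega> D \<eta> = color (ratfuns B) \<omega> D \<eta>') \<longrightarrow>
                  cval \<omega> c \<nu> \<eta> = cval \<omega> c \<nu>' \<eta>') \<and>
               ((\<exists>s\<in>ratfuns B. \<forall>F\<in>faces 3 V. \<nu>' F = \<nu> F + s * \<omega> F) \<and>
                (\<exists>t\<in>ratfuns B. \<forall>F\<in>faces 3 V. \<eta>' F = \<eta> F + t * \<omega> F) \<longrightarrow>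
                  cval \<omega> c \<nu> \<eta> = cval \<omega> c \<nu>' \<eta>')))
     \<and>
     (\<forall>W B (\<omega> :: nat set \<Rightarrow> 'p mod_ring ratfun) r\<^sub>1 r\<^sub>2 b b\<^sub>\<nu> b\<^sub>\<eta> c \<nu> \<eta>.
        card W = 7 \<and> max_indep_components TYPE('p mod_ring) W B \<and> generic_omega W B \<omega> \<and>
        permitted6 (ratfuns B) \<omega> W r\<^sub>1 \<and> permitted6 (ratfuns B) \<omega> W r\<^sub>2 \<and>
        (\<forall>V\<in>faces 5 W. reduced_cochain k V (b V) (b\<^sub>\<nu> V) (b\<^sub>\<eta> V) (c V) \<and>
           induces (ratfuns B) \<omega> V (\<nu> V) r\<^sub>1 \<and> induces (ratfuns B) \<omega> V (\<eta> V) r\<^sub>2) \<longrightarrow>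
          coboundary (\<lambda>V. cval \<omega> (c V) (\<nu> V) (\<eta> V)) W = 0)"
proof (intro conjI)
  note p = assms(1) and k = assms(2)
  show "\<forall>V B B\<^sub>\<nu> B\<^sub>\<eta> (\<omega> :: nat set \<Rightarrow> rat ratfun) \<nu> \<eta>.
        card V = 6 \<and> generic_triple V B B\<^sub>\<nu> B\<^sub>\<eta> \<omega> \<nu> \<eta> \<longrightarrow>
          lifted p k \<omega> \<nu> \<eta> V \<in> cpolys B B\<^sub>\<nu> B\<^sub>\<eta> \<and>
          nonneg_valuation p B B\<^sub>\<nu> B\<^sub>\<eta> (lifted p k \<omega> \<nu> \<eta> V) \<and>
          (\<exists>!c :: 'p mod_ring ratfun cpoly. reduces_to B B\<^sub>\<nu> B\<^sub>\<eta> (lifted p k \<omega> \<nu> \<eta> V) c)"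
  proof (intro allI impI)
    fix V B B\<^sub>\<nu> B\<^sub>\<eta> \<nu> \<eta> and \<omega> :: "nat set \<Rightarrow> rat ratfun"
    assume *: "card V = 6 \<and> generic_triple V B B\<^sub>\<nu> B\<^sub>\<eta> \<omega> \<nu> \<eta>"
    obtain c :: "'p mod_ring ratfun cpoly"
      where red: "reduction_rel B B\<^sub>\<nu> B\<^sub>\<eta> (lifted p k \<omega> \<nu> \<eta> V) c"
      using lifted_reduction[of V k B B\<^sub>\<nu> B\<^sub>\<eta> \<omega> \<nu> \<eta>, where ?'p = 'p] * k unfolding p by metis
    show "lifted p k \<omega> \<nu> \<eta> V \<in> cpolys B B\<^sub>\<nu> B\<^sub>\<eta> \<and>
          nonneg_valuation p B B\<^sub>\<nu> B\<^sub>\<eta> (lifted p k \<omega> \<nu> \<eta> V) \<and>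
          (\<exists>!c :: 'p mod_ring ratfun cpoly. reduces_to B B\<^sub>\<nu> B\<^sub>\<eta> (lifted p k \<omega> \<nu> \<eta> V) c)"
      unfolding reduces_to_iff
      using reduction_rel_in_cpolys(1)[OF red] reduction_rel_nonneg_valuation[OF red]
        red reduction_rel_unique[OF red] unfolding p by blast
  qed
next
  note p = assms(1) and k = assms(2)
  show "\<forall>V B B\<^sub>\<nu> B\<^sub>\<eta> (c :: 'p mod_ring ratfun cpoly).
        card V = 6 \<and> reduced_cochain k V B B\<^sub>\<nu> B\<^sub>\<eta> c \<longrightarrow>
          c \<in> cpolys B B\<^sub>\<nu> B\<^sub>\<eta> \<and>
          degree_in (range Nu) c = p ^ k \<and> degree_in (range Eta) c = p ^ k \<and>
          (\<forall>\<omega> \<nu> \<nu>' \<eta> \<eta>'.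
             generic_omega V B \<omega> \<and>
             cocycle3_in (ratfuns B) V \<nu> \<and> cocycle3_in (ratfuns B) V \<nu>' \<and>
             cocycle3_in (ratfuns B) V \<eta> \<and> cocycle3_in (ratfuns B) V \<eta>' \<longrightarrow>
               ((\<forall>D\<in>faces 4 V. color (ratfuns B) \<omega> D \<nu> = color (ratfuns B) \<omega> D \<nu>') \<and>
                (\<forall>D\<in>faces 4 V. color (ratfuns B) \<omega> D \<eta> = color (ratfuns B) \<omega> D \<eta>') \<longrightarrow>
                  cval \<omega> c \<nu> \<eta> = cval \<omega> c \<nu>' \<eta>') \<and>
               ((\<exists>s\<in>ratfuns B. \<forall>F\<in>faces 3 V. \<nu>' F = \<nu> F + s * \<omega> F) \<and>
                (\<exists>t\<in>ratfuns B. \<forall>F\<in>faces 3 V. \<eta>' F = \<eta> F + t * \<omega> F) \<longrightarrow>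
                  cval \<omega> c \<nu> \<eta> = cval \<omega> c \<nu>' \<eta>'))"
  proof (intro allI impI, elim conjE)
    fix V B B\<^sub>\<nu> B\<^sub>\<eta> and c :: "'p mod_ring ratfun cpoly"
    assume V: "card V = 6" and c: "reduced_cochain k V B B\<^sub>\<nu> B\<^sub>\<eta> c"
    let ?K = "ratfuns B :: 'p mod_ring ratfun set"
    have inv: "(\<forall>D\<in>faces 4 V. color ?K \<omega> D \<nu> = color ?K \<omega> D \<nu>') \<and>
          (\<forall>D\<in>faces 4 V. color ?K \<omega> D \<eta> = color ?K \<omega> D \<eta>') \<longrightarrow> cval \<omega> c \<nu> \<eta> = cval \<omega> c \<nu>' \<eta>'"
        "(\<exists>s\<in>?K. \<forall>F\<in>faces 3 V. \<nu>' F = \<nu> F + s * \<omega> F) \<and>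
          (\<exists>t\<in>?K. \<forall>F\<in>faces 3 V. \<eta>' F = \<eta> F + t * \<omega> F) \<longrightarrow> cval \<omega> c \<nu> \<eta> = cval \<omega> c \<nu>' \<eta>'"
      if \<omega>: "generic_omega V B \<omega>" and "cocycle3_in ?K V \<nu>" "cocycle3_in ?K V \<nu>'"
        "cocycle3_in ?K V \<eta>" "cocycle3_in ?K V \<eta>'" for \<omega> \<nu> \<nu>' \<eta> \<eta>'
    proof -
      have co: "cocycle3 V \<nu>" "cocycle3 V \<nu>'" "cocycle3 V \<eta>" "cocycle3 V \<eta>'"
        using that by (simp_all add: cocycle3_in_def)
      note main = cval_color[OF c V k \<omega> co]
      show "(\<forall>D\<in>faces 4 V. color ?K \<omega> D \<nu> = color ?K \<omega> D \<nu>') \<and>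
          (\<forall>D\<in>faces 4 V. color ?K \<omega> D \<eta> = color ?K \<omega> D \<eta>') \<longrightarrow> cval \<omega> c \<nu> \<eta> = cval \<omega> c \<nu>' \<eta>'"
      proof (intro impI main)
        fix D assume col: "(\<forall>D\<in>faces 4 V. color ?K \<omega> D \<nu> = color ?K \<omega> D \<nu>') \<and>
          (\<forall>D\<in>faces 4 V. color ?K \<omega> D \<eta> = color ?K \<omega> D \<eta>')" and D: "D \<in> faces 4 V"
        obtain s where "\<And>F. F \<in> faces 3 D \<Longrightarrow> \<nu>' F = \<nu> F + s * \<omega> F"
          by (rule color_eq_imp_shift[of ?K \<omega> D \<nu> \<nu>']) (use col D zero_in_ratfuns in auto)
        moreover obtain t where "\<And>F. F \<in> faces 3 D \<Longrightarrow> \<eta>' F = \<eta> F + t * \<omega> F"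
          by (rule color_eq_imp_shift[of ?K \<omega> D \<eta> \<eta>']) (use col D zero_in_ratfuns in auto)
        ultimately show "\<exists>s t. \<forall>F\<in>faces 3 D. \<nu>' F = \<nu> F + s * \<omega> F \<and> \<eta>' F = \<eta> F + t * \<omega> F"
          by blast
      qed
      show "(\<exists>s\<in>?K. \<forall>F\<in>faces 3 V. \<nu>' F = \<nu> F + s * \<omega> F) \<and>
          (\<exists>t\<in>?K. \<forall>F\<in>faces 3 V. \<eta>' F = \<eta> F + t * \<omega> F) \<longrightarrow> cval \<omega> c \<nu> \<eta> = cval \<omega> c \<nu>' \<eta>'"
      proof (intro impI main)
        fix D assume sh: "(\<exists>s\<in>?K. \<forall>F\<in>faces 3 V. \<nu>' F = \<nu> F + s * \<omega> F) \<and>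
          (\<exists>t\<in>?K. \<forall>F\<in>faces 3 V. \<eta>' F = \<eta> F + t * \<omega> F)" and D: "D \<in> faces 4 V"
        have "faces 3 D \<subseteq> faces 3 V" using D by (intro faces_mono) (simp add: faces_def)
        with sh show "\<exists>s t. \<forall>F\<in>faces 3 D. \<nu>' F = \<nu> F + s * \<omega> F \<and> \<eta>' F = \<eta> F + t * \<omega> F"
          by blast
      qed
    qed
    note deg = reduced_cochain_degree[OF c V k]
    show "c \<in> cpolys B B\<^sub>\<nu> B\<^sub>\<eta> \<and>
          degree_in (range Nu) c = p ^ k \<and> degree_in (range Eta) c = p ^ k \<and>
          (\<forall>\<omega> \<nu> \<nu>' \<eta> \<eta>'.
             generic_omega V B \<omega> \<and> cocycle3_in ?K V \<nu> \<and> cocycle3_in ?K V \<nu>' \<and>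
             cocycle3_in ?K V \<eta> \<and> cocycle3_in ?K V \<eta>' \<longrightarrow>
               ((\<forall>D\<in>faces 4 V. color ?K \<omega> D \<nu> = color ?K \<omega> D \<nu>') \<and>
                (\<forall>D\<in>faces 4 V. color ?K \<omega> D \<eta> = color ?K \<omega> D \<eta>') \<longrightarrow>
                  cval \<omega> c \<nu> \<eta> = cval \<omega> c \<nu>' \<eta>') \<and>
               ((\<exists>s\<in>?K. \<forall>F\<in>faces 3 V. \<nu>' F = \<nu> F + s * \<omega> F) \<and>
                (\<exists>t\<in>?K. \<forall>F\<in>faces 3 V. \<eta>' F = \<eta> F + t * \<omega> F) \<longrightarrow>
                  cval \<omega> c \<nu> \<eta> = cval \<omega> c \<nu>' \<eta>'))"
      unfolding p by (intro conjI allI impI deg; elim conjE) (rule inv[rule_format]; blast)+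
  qed
next
  note p = assms(1) and k = assms(2)
  show "\<forall>W B (\<omega> :: nat set \<Rightarrow> 'p mod_ring ratfun) r\<^sub>1 r\<^sub>2 b b\<^sub>\<nu> b\<^sub>\<eta> c \<nu> \<eta>.
        card W = 7 \<and> max_indep_components TYPE('p mod_ring) W B \<and> generic_omega W B \<omega> \<and>
        permitted6 (ratfuns B) \<omega> W r\<^sub>1 \<and> permitted6 (ratfuns B) \<omega> W r\<^sub>2 \<and>
        (\<forall>V\<in>faces 5 W. reduced_cochain k V (b V) (b\<^sub>\<nu> V) (b\<^sub>\<eta> V) (c V) \<and>
           induces (ratfuns B) \<omega> V (\<nu> V) r\<^sub>1 \<and> induces (ratfuns B) \<omega> V (\<eta> V) r\<^sub>2) \<longrightarrow>
          coboundary (\<lambda>V. cval \<omega> (c V) (\<nu> V) (\<eta> V)) W = 0"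
    by (intro allI impI, elim conjE, rule heptagon_relation[OF _ k]) (assumption | blast)+
qed

end
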